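(* Any stratified positive DEFiM $D$ is sensible for $\Lambda_{\tau(D)}$ and approximable.
   Context: A filter model is $(D,\wedge,\to)$ with $(D,\wedge)$ a meet-semilattice with top $\omega$ and order $\ge_D$, and $\to$ a binary operation such that $\gamma\to\delta\ge_D\bigwedge_i(\alpha_i\to\beta_i)$ iff $\delta\ge_D\bigwedge_{\{i\mid\gamma\le\alpha_i\}}\beta_i$. It is extensional if there is a function $\mathrm{ext}_D$ assigning to each $\alpha$ a finite set $\mathrm{ext}_D(\alpha)\subseteq D\times D$ with $\alpha=\bigwedge_{(\beta,\gamma)\in\mathrm{ext}_D(\alpha)}\beta\to\gamma$, and distributive if whenever $\alpha\ge\beta\wedge\gamma$ there are $\beta'\ge_D\beta$, $\gamma'\ge_D\gamma$ with $\alpha=\beta'\wedge\gamma'$. A DEFiM is a distributive extensional filter model. Terms of the $\lambda$-calculus are interpreted in $D$ in the standard way (equivalently by the intersection type system with types in $D$), $\llbracket M\rrbracket^{\vec x}$ being a downward-closed subset of $(D^{op})^{\vec x}\times D$. A DEFiM $D$ is stratified positive if there exist a valuation $\mathcal V:D\setminus\{\omega\}\to\{\mathrm{true},\mathrm{false}\}$ (the polarity) and a well-founded total preorder $\preceq$ on $D$ with $\omega$ as bottom (with induced equivalence $\simeq$) such that for all $\gamma\in D$ and all $(\alpha,\beta)\in\mathrm{ext}_D(\gamma)$: $\gamma\succeq\beta$; $\gamma\simeq\beta\Rightarrow\mathcal V(\gamma)=\mathcal V(\beta)$; $\gamma\succeq\alpha$; $\gamma\simeq\alpha\Rightarrow\mathcal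 V(\gamma)\neq\mathcal V(\alpha)$; and moreover for all $\alpha,\beta$: $\alpha\wedge\beta\preceq\alpha$ or $\alpha\wedge\beta\preceq\beta$; $(\alpha\wedge\beta)\prec\alpha\Rightarrow\alpha\wedge\beta=\beta$; and $\alpha\simeq\beta\Rightarrow\mathcal V(\alpha\wedge\beta)=\mathcal V(\alpha)\wedge\mathcal V(\beta)$. $\Lambda_{\tau(D)}$ is the $\lambda$-calculus with $D$-tests: terms $M::=x\mid\lambda x.M\mid M\,N\mid\sum_{i\le n}\bar\tau_{\alpha_i}(Q_i)$ and tests $Q::=\sum_i Q_i\mid\prod_i Q_i\mid\tau_\alpha(M)$ ($\alpha,\alpha_i\in D\setminus\{\omega\}$; empty sum $\mathbf 0$, empty product $\epsilon$, $\bar\epsilon_\alpha:=\bar\tau_\alpha(\epsilon)$), with reduction rules $(\lambda x.M)N\to M[N/x]$, $(\sum_i\bar\tau_{\alpha_i}(Q_i))N\to\sum_i\sum_{(\beta,\gamma)\in\mathrm{ext}_D(\alpha_i)}\bar\tau_\gamma(Q_i\cdot\tau_\beta(N))$, $\tau_\alpha(\lambda x.M)\to\prod_{(\beta,\gamma)\in\mathrm{ext}_D(\alpha)}\tau_\gamma(M[\bar\epsilon_\beta/x])$, $\tau_\alpha(\sum_{i\in I}\bar\tau_{\beta_i}(Q_i))\to\sum_{\{I'\subseteq I\mid\alpha\ge\bigwedge_{i\in I'}\beta_i\}}\prod_{i\in I'}Q_i$, plus distribution of sums over products and over $\bar\tau$, and a head-reduction strategy; convergence ($\Downarrow$) is may-head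 convergence to a may-head-normal form. $D$ interprets tests as subsets of $D^{\vec x}$ (e.g. $\llbracket\tau_\alpha(M)\rrbracket=\{\vec\beta\mid(\vec\beta,\alpha)\in\llbracket M\rrbracket\}$, products as intersections, sums as unions, $\llbracket\epsilon\rrbracket=D^{\vec x}$, $\llbracket\mathbf 0\rrbracket=\emptyset$). $D$ is sensible for $\Lambda_{\tau(D)}$ if for all terms $M$ and tests $Q$: $M$ diverges iff $\llbracket M\rrbracket^{\vec x}=\{(\vec\alpha,\omega)\mid\vec\alpha\}$, and $Q$ diverges iff $\llbracket Q\rrbracket^{\vec x}=\emptyset$. $D$ is approximable if for every $\lambda$-term $M$, $\llbracket M\rrbracket^{\vec x}=\bigcup_{N\in\mathcal A(M)}\llbracket N\rrbracket^{\vec x}$, where $\mathcal A(M)=\{M'^{\,\Omega}\mid M\to_h^* M'\}$ is the set of finite Böhm approximants, with $M^{\Omega}=\Omega$ if $M=\lambda\vec x.(\lambda y.M')N\vec M$ and $M^{\Omega}=\lambda\vec x.x_i M_1^{\Omega}\cdots M_k^{\Omega}$ if $M=\lambda\vec x.x_iM_1\cdots M_k$, and $\llbracket\Omega\rrbracket^{\vec x}=\{(\vec\alpha,\omega)\}$.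
   Formalization: D is assumed to have an element other than ω (for D={ω}, x converges but its interpretation is trivial); in A(M), head reduction also continues inside the arguments of head-normal forms (else x(I y) has only the approximant xΩ and approximability fails). *)

theory Defs
  imports Main
begin

section \<open>Filter models\<close>

text \<open>The carrier D is the type \<^typ>\<open>'d\<close>, with \<open>inf\<close> as meet, \<open>top\<close> as \<open>\<omega>\<close> and \<open>\<le>\<close> as the
  order; \<open>arr\<close> is the arrow. Finite families of pairs are represented by finite sets, which is
  harmless because meets are idempotent.\<close>

definition meet :: "'d::bounded_semilattice_inf_top set \<Rightarrow> 'd" where
  "meet A = Finite_Set.fold inf top A"

lemma meet_empty [simp]: "meet {} = top"
  by (simp add: meet_def)

lemma meet_insert [simp]:
  assumes "finite A"
  shows "meet (insert a A) = inf a (meet A)"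
proof -
  interpret comp_fun_idem "inf :: 'a \<Rightarrow> 'a \<Rightarrow> 'a"
    by standard (auto simp: fun_eq_iff inf_left_commute)
  show ?thesis
    using assms by (simp add: meet_def fold_insert_idem)
qed

lemma le_meet_iff: "finite A \<Longrightarrow> x \<le> meet A \<longleftrightarrow> (\<forall>a\<in>A. x \<le> a)"
  by (induction A rule: finite_induct) auto

definition filter_model :: "('d::bounded_semilattice_inf_top \<Rightarrow> 'd \<Rightarrow> 'd) \<Rightarrow> bool" where
  "filter_model arr \<longleftrightarrow>
     (\<forall>S \<gamma> \<delta>. finite S \<longrightarrow>
        (arr \<gamma> \<delta> \<ge> meet {arr \<alpha> \<beta> | \<alpha> \<beta>. (\<alpha>, \<beta>) \<in> S} \<longleftrightarrow>
         \<delta> \<ge> meet {\<beta>. \<exists>\<alpha>. (\<alpha>, \<beta>) \<in> S \<and> \<gamma> \<le> \<alpha>}))"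

definition extensional_by ::
  "('d::bounded_semilattice_inf_top \<Rightarrow> 'd \<Rightarrow> 'd) \<Rightarrow> ('d \<Rightarrow> ('d \<times> 'd) set) \<Rightarrow> bool" where
  "extensional_by arr ext \<longleftrightarrow>
     (\<forall>\<alpha>. finite (ext \<alpha>) \<and> \<alpha> = meet {arr \<beta> \<gamma> | \<beta> \<gamma>. (\<beta>, \<gamma>) \<in> ext \<alpha>})"

definition distributive :: "'d::bounded_semilattice_inf_top itself \<Rightarrow> bool" where
  "distributive _ \<longleftrightarrow>
     (\<forall>\<alpha> \<beta> \<gamma> :: 'd. \<alpha> \<ge> inf \<beta> \<gamma> \<longrightarrow> (\<exists>\<beta>' \<gamma>'. \<beta>' \<ge> \<beta> \<and> \<gamma>' \<ge> \<gamma> \<and> \<alpha> = inf \<beta>' \<gamma>'))"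

text \<open>The function \<open>ext\<close> is part of the data, since the calculus with tests depends on it.\<close>

definition DEFiM ::
  "('d::bounded_semilattice_inf_top \<Rightarrow> 'd \<Rightarrow> 'd) \<Rightarrow> ('d \<Rightarrow> ('d \<times> 'd) set) \<Rightarrow> bool" where
  "DEFiM arr ext \<longleftrightarrow> filter_model arr \<and> extensional_by arr ext \<and> distributive TYPE('d)"

text \<open>The valuation is only defined on types different from \<open>\<omega>\<close>: below it is a total function, and
  every condition that mentions its value at some type is required only when that type is not
  \<open>\<omega>\<close>.\<close>

definition stratified_positive ::
  "('d::bounded_semilattice_inf_top \<Rightarrow> ('d \<times> 'd) set) \<Rightarrow> bool" where
  "stratified_positive ext \<longleftrightarrow>
     (\<exists>(V :: 'd \<Rightarrow> bool) (le :: 'd \<Rightarrow> 'd \<Rightarrow> bool).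
        let lt = (\<lambda>a b. le a b \<and> \<not> le b a); eqv = (\<lambda>a b. le a b \<and> le b a) in
        reflp le \<and> transp le \<and> totalp le \<and> wfP lt \<and> (\<forall>\<alpha>. le top \<alpha>) \<and>
        (\<forall>\<gamma>. \<forall>(\<alpha>, \<beta>) \<in> ext \<gamma>.
           le \<beta> \<gamma> \<and>
           (eqv \<gamma> \<beta> \<and> \<gamma> \<noteq> top \<and> \<beta> \<noteq> top \<longrightarrow> V \<gamma> = V \<beta>) \<and>
           le \<alpha> \<gamma> \<and>
           (eqv \<gamma> \<alpha> \<and> \<gamma> \<noteq> top \<and> \<alpha> \<noteq> top \<longrightarrow> V \<gamma> \<noteq> V \<alpha>)) \<and>
        (\<forall>\<alpha> \<beta>.
           (le (inf \<alpha> \<beta>) \<alpha> \<or> le (inf \<alpha> \<beta>) \<beta>) \<and>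
           (lt (inf \<alpha> \<beta>) \<alpha> \<longrightarrow> inf \<alpha> \<beta> = \<beta>) \<and>
           (eqv \<alpha> \<beta> \<and> \<alpha> \<noteq> top \<and> \<beta> \<noteq> top \<longrightarrow> V (inf \<alpha> \<beta>) = (V \<alpha> \<and> V \<beta>))))"


section \<open>The lambda-calculus with D-tests\<close>

text \<open>Terms are in de Bruijn style. The summand \<open>(\<alpha>, Q)\<close> of \<open>TSum\<close> stands for
  \<open>\<tau>bar\<^sub>\<alpha>(Q)\<close>.\<close>

datatype 'd tm =
    Var nat
  | Lam "'d tm"
  | App "'d tm" "'d tm"
  | TSum "('d \<times> 'd test) list"
and 'd test =
    QSum "'d test list"
  | QProd "'d test list"
  | Tau 'd "'d tm"

text \<open>\<open>tm_in n M\<close>: M belongs to the calculus (no annotation is \<open>\<omega>\<close>) and its free variables are among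
  the first n; likewise for tests.\<close>

primrec tm_in :: "nat \<Rightarrow> 'd::bounded_semilattice_inf_top tm \<Rightarrow> bool"
  and test_in :: "nat \<Rightarrow> 'd test \<Rightarrow> bool" where
  "tm_in n (Var i) = (i < n)"
| "tm_in n (Lam M) = tm_in (Suc n) M"
| "tm_in n (App M N) = (tm_in n M \<and> tm_in n N)"
| "tm_in n (TSum ps) =
     (\<forall>(\<alpha>, b) \<in> set (map (map_prod id (\<lambda>Q. test_in n Q)) ps). \<alpha> \<noteq> top \<and> b)"
| "test_in n (QSum Qs) = (\<forall>b \<in> set (map (\<lambda>Q. test_in n Q) Qs). b)"
| "test_in n (QProd Qs) = (\<forall>b \<in> set (map (\<lambda>Q. test_in n Q) Qs). b)"
| "test_in n (Tau \<alpha> M) = (\<alpha> \<noteq> top \<and> tm_in n M)"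

primrec lift :: "nat \<Rightarrow> 'd tm \<Rightarrow> 'd tm"
  and lift_test :: "nat \<Rightarrow> 'd test \<Rightarrow> 'd test" where
  "lift k (Var i) = (if i < k then Var i else Var (Suc i))"
| "lift k (Lam M) = Lam (lift (Suc k) M)"
| "lift k (App M N) = App (lift k M) (lift k N)"
| "lift k (TSum ps) = TSum (map (map_prod id (\<lambda>Q. lift_test k Q)) ps)"
| "lift_test k (QSum Qs) = QSum (map (\<lambda>Q. lift_test k Q) Qs)"
| "lift_test k (QProd Qs) = QProd (map (\<lambda>Q. lift_test k Q) Qs)"
| "lift_test k (Tau \<alpha> M) = Tau \<alpha> (lift k M)"

text \<open>\<open>subst k N M\<close> replaces index k by N in M and decrements the larger free indices.\<close>

primrec subst :: "nat \<Rightarrow> 'd tm \<Rightarrow> 'd tm \<Rightarrow> 'd tm"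
  and subst_test :: "nat \<Rightarrow> 'd tm \<Rightarrow> 'd test \<Rightarrow> 'd test" where
  "subst k N (Var i) = (if i < k then Var i else if i = k then N else Var (i - 1))"
| "subst k N (Lam M) = Lam (subst (Suc k) (lift 0 N) M)"
| "subst k N (App M L) = App (subst k N M) (subst k N L)"
| "subst k N (TSum ps) = TSum (map (map_prod id (\<lambda>Q. subst_test k N Q)) ps)"
| "subst_test k N (QSum Qs) = QSum (map (\<lambda>Q. subst_test k N Q) Qs)"
| "subst_test k N (QProd Qs) = QProd (map (\<lambda>Q. subst_test k N Q) Qs)"
| "subst_test k N (Tau \<alpha> M) = Tau \<alpha> (subst k N M)"

text \<open>The pairs in \<open>ext \<alpha>\<close> may mention \<open>\<omega>\<close>, which is not a legal annotation. The reduction rules use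
  the conventions \<open>\<tau>\<^sub>\<omega>(M) = \<epsilon>\<close> (the empty product) and \<open>\<tau>bar\<^sub>\<omega>(Q) = 0\<close> (no summand), in
  accordance with the interpretation.\<close>

definition tau :: "'d::bounded_semilattice_inf_top \<Rightarrow> 'd tm \<Rightarrow> 'd test" where
  "tau \<alpha> M = (if \<alpha> = top then QProd [] else Tau \<alpha> M)"

definition taubar_sum :: "('d::bounded_semilattice_inf_top \<times> 'd test) list \<Rightarrow> 'd tm" where
  "taubar_sum ps = TSum (filter (\<lambda>(\<alpha>, Q). \<alpha> \<noteq> top) ps)"

definition epsbar :: "'d::bounded_semilattice_inf_top \<Rightarrow> 'd tm" where
  "epsbar \<alpha> = taubar_sum [(\<alpha>, QProd [])]"

definition ext_list :: "('d \<Rightarrow> ('d \<times> 'd) set) \<Rightarrow> 'd \<Rightarrow> ('d \<times> 'd) list" where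
  "ext_list ext \<alpha> = (SOME xs. set xs = ext \<alpha> \<and> distinct xs)"

lemma ext_list:
  assumes "finite (ext \<alpha>)"
  shows "set (ext_list ext \<alpha>) = ext \<alpha>" "distinct (ext_list ext \<alpha>)"
  using someI_ex[OF finite_distinct_list[OF assms]] by (auto simp: ext_list_def)

text \<open>Head reduction. In the context rules for application and \<open>\<tau>\<close> the reduced term is itself an
  application, as the other non-variable cases are handled by a rule at the root. In
  \<open>tau_sum\<close>, the list \<open>subseqs ps\<close> has one entry for each set of positions of ps.\<close>

inductive hstep :: "('d::bounded_semilattice_inf_top \<Rightarrow> ('d \<times> 'd) set) \<Rightarrow> 'd tm \<Rightarrow> 'd tm \<Rightarrow> bool"
  and hstep_test :: "('d \<Rightarrow> ('d \<times> 'd) set) \<Rightarrow> 'd test \<Rightarrow> 'd test \<Rightarrow> bool"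
  for ext :: "'d \<Rightarrow> ('d \<times> 'd) set" where
  beta: "hstep ext (App (Lam M) N) (subst 0 N M)"
| sum_app: "hstep ext (App (TSum ps) N)
     (taubar_sum [(\<gamma>, QProd [Q, tau \<beta> N]). (\<alpha>, Q) \<leftarrow> ps, (\<beta>, \<gamma>) \<leftarrow> ext_list ext \<alpha>])"
| tau_lam: "hstep_test ext (Tau \<alpha> (Lam M))
     (QProd [tau \<gamma> (subst 0 (epsbar \<beta>) M). (\<beta>, \<gamma>) \<leftarrow> ext_list ext \<alpha>])"
| tau_sum: "hstep_test ext (Tau \<alpha> (TSum ps))
     (QSum [QProd (map snd J). J \<leftarrow> subseqs ps, \<alpha> \<ge> meet (fst ` set J)])"
| prod_distr: "hstep_test ext (QProd (Ps @ QSum Qs # Rs)) (QSum [QProd (Ps @ Q # Rs). Q \<leftarrow> Qs])"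
| taubar_distr: "hstep ext (TSum (ps @ (\<alpha>, QSum Qs) # rs)) (TSum (ps @ [(\<alpha>, Q). Q \<leftarrow> Qs] @ rs))"
| ctx_lam: "hstep ext M M' \<Longrightarrow> hstep ext (Lam M) (Lam M')"
| ctx_app: "hstep ext (App M N) M' \<Longrightarrow> hstep ext (App (App M N) L) (App M' L)"
| ctx_taubar: "hstep_test ext Q Q' \<Longrightarrow>
     hstep ext (TSum (ps @ (\<alpha>, Q) # rs)) (TSum (ps @ (\<alpha>, Q') # rs))"
| ctx_tau: "hstep ext (App M N) M' \<Longrightarrow> hstep_test ext (Tau \<alpha> (App M N)) (Tau \<alpha> M')"
| ctx_sum: "hstep_test ext Q Q' \<Longrightarrow> hstep_test ext (QSum (Ps @ Q # Rs)) (QSum (Ps @ Q' # Rs))"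
| ctx_prod: "hstep_test ext Q Q' \<Longrightarrow> hstep_test ext (QProd (Ps @ Q # Rs)) (QProd (Ps @ Q' # Rs))"

text \<open>\<open>var_headed M\<close>: M is a variable applied to some (possibly zero) arguments.\<close>

fun var_headed :: "'d tm \<Rightarrow> bool" where
  "var_headed (Var i) = True"
| "var_headed (App M N) = var_headed M"
| "var_headed _ = False"

inductive test_hnf :: "'d test \<Rightarrow> bool" where
  "var_headed M \<Longrightarrow> test_hnf (Tau \<alpha> M)"
| "(\<forall>Q \<in> set Qs. test_hnf Q) \<Longrightarrow> test_hnf (QProd Qs)"

inductive test_mhnf :: "'d test \<Rightarrow> bool" where
  "test_hnf Q \<Longrightarrow> test_mhnf Q"
| "Q \<in> set Qs \<Longrightarrow> test_mhnf Q \<Longrightarrow> test_mhnf (QSum Qs)"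

inductive tm_mhnf :: "'d tm \<Rightarrow> bool" where
  "var_headed M \<Longrightarrow> tm_mhnf M"
| "tm_mhnf M \<Longrightarrow> tm_mhnf (Lam M)"
| "(\<alpha>, Q) \<in> set ps \<Longrightarrow> test_hnf Q \<Longrightarrow> tm_mhnf (TSum ps)"

definition converges :: "('d::bounded_semilattice_inf_top \<Rightarrow> ('d \<times> 'd) set) \<Rightarrow> 'd tm \<Rightarrow> bool" where
  "converges ext M \<longleftrightarrow> (\<exists>N. (hstep ext)\<^sup>*\<^sup>* M N \<and> tm_mhnf N)"

definition test_converges ::
  "('d::bounded_semilattice_inf_top \<Rightarrow> ('d \<times> 'd) set) \<Rightarrow> 'd test \<Rightarrow> bool" where
  "test_converges ext Q \<longleftrightarrow> (\<exists>P. (hstep_test ext)\<^sup>*\<^sup>* Q P \<and> test_mhnf P)"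


section \<open>Interpretation\<close>

text \<open>A context of n variables is interpreted by the lists of length n over D; the i-th entry is the
  type of the variable with index i.\<close>

definition sem_var :: "nat \<Rightarrow> nat \<Rightarrow> ('d::bounded_semilattice_inf_top list \<times> 'd) set" where
  "sem_var n i = {(\<Gamma>, \<alpha>). length \<Gamma> = n \<and> i < n \<and> \<alpha> \<ge> \<Gamma> ! i}"

definition sem_lam ::
  "('d::bounded_semilattice_inf_top \<Rightarrow> 'd \<Rightarrow> 'd) \<Rightarrow> nat \<Rightarrow> ('d list \<times> 'd) set \<Rightarrow> ('d list \<times> 'd) set" where
  "sem_lam arr n X = {(\<Gamma>, \<alpha>). length \<Gamma> = n \<and>
     (\<exists>F. finite F \<and> (\<forall>(\<beta>, \<gamma>) \<in> F. (\<beta> # \<Gamma>, \<gamma>) \<in> X) \<and>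
          \<alpha> \<ge> meet {arr \<beta> \<gamma> | \<beta> \<gamma>. (\<beta>, \<gamma>) \<in> F})}"

definition sem_app ::
  "('d \<Rightarrow> 'd \<Rightarrow> 'd) \<Rightarrow> ('d list \<times> 'd) set \<Rightarrow> ('d list \<times> 'd) set \<Rightarrow> ('d list \<times> 'd) set" where
  "sem_app arr X Y = {(\<Gamma>, \<alpha>). \<exists>\<beta>. (\<Gamma>, arr \<beta> \<alpha>) \<in> X \<and> (\<Gamma>, \<beta>) \<in> Y}"

definition sem_taubar_sum ::
  "nat \<Rightarrow> ('d::bounded_semilattice_inf_top \<times> 'd list set) list \<Rightarrow> ('d list \<times> 'd) set" where
  "sem_taubar_sum n rs =
     {(\<Gamma>, \<alpha>). length \<Gamma> = n \<and> \<alpha> \<ge> meet {\<beta>. \<exists>R. (\<beta>, R) \<in> set rs \<and> \<Gamma> \<in> R}}"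

definition sem_bot :: "nat \<Rightarrow> ('d::bounded_semilattice_inf_top list \<times> 'd) set" where
  "sem_bot n = {(\<Gamma>, top) | \<Gamma>. length \<Gamma> = n}"

primrec interp ::
    "('d::bounded_semilattice_inf_top \<Rightarrow> 'd \<Rightarrow> 'd) \<Rightarrow> nat \<Rightarrow> 'd tm \<Rightarrow> ('d list \<times> 'd) set"
  and interp_test :: "('d \<Rightarrow> 'd \<Rightarrow> 'd) \<Rightarrow> nat \<Rightarrow> 'd test \<Rightarrow> 'd list set" where
  "interp arr n (Var i) = sem_var n i"
| "interp arr n (Lam M) = sem_lam arr n (interp arr (Suc n) M)"
| "interp arr n (App M N) = sem_app arr (interp arr n M) (interp arr n N)"
| "interp arr n (TSum ps) = sem_taubar_sum n (map (map_prod id (\<lambda>Q. interp_test arr n Q)) ps)"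
| "interp_test arr n (QSum Qs) = \<Union> (set (map (\<lambda>Q. interp_test arr n Q) Qs))"
| "interp_test arr n (QProd Qs) =
     {\<Gamma>. length \<Gamma> = n} \<inter> \<Inter> (set (map (\<lambda>Q. interp_test arr n Q) Qs))"
| "interp_test arr n (Tau \<alpha> M) = {\<Gamma>. (\<Gamma>, \<alpha>) \<in> interp arr n M}"

lemma interp_zero: "interp arr n (TSum []) = sem_bot n"
  by (auto simp: sem_taubar_sum_def sem_bot_def top_unique)

definition sensible ::
  "('d::bounded_semilattice_inf_top \<Rightarrow> 'd \<Rightarrow> 'd) \<Rightarrow> ('d \<Rightarrow> ('d \<times> 'd) set) \<Rightarrow> bool" where
  "sensible arr ext \<longleftrightarrow>
     (\<forall>n M. tm_in n M \<longrightarrow> (\<not> converges ext M \<longleftrightarrow> interp arr n M = sem_bot n)) \<and>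
     (\<forall>n Q. test_in n Q \<longrightarrow> (\<not> test_converges ext Q \<longleftrightarrow> interp_test arr n Q = {}))"


section \<open>Approximability\<close>

text \<open>The ordinary lambda-terms are the terms without tests.\<close>

fun lambda_term :: "'d tm \<Rightarrow> bool" where
  "lambda_term (Var i) = True"
| "lambda_term (Lam M) = lambda_term M"
| "lambda_term (App M N) = (lambda_term M \<and> lambda_term N)"
| "lambda_term (TSum ps) = False"

text \<open>Lambda-terms with the additional constant \<open>\<Omega>\<close>.\<close>

datatype approximant =
    Omega
  | AVar nat
  | ALam approximant
  | AApp approximant approximant

primrec interp_approx ::
  "('d::bounded_semilattice_inf_top \<Rightarrow> 'd \<Rightarrow> 'd) \<Rightarrow> nat \<Rightarrow> approximant \<Rightarrow> ('d list \<times> 'd) set" where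
  "interp_approx arr n Omega = sem_bot n"
| "interp_approx arr n (AVar i) = sem_var n i"
| "interp_approx arr n (ALam A) = sem_lam arr n (interp_approx arr (Suc n) A)"
| "interp_approx arr n (AApp A B) = sem_app arr (interp_approx arr n A) (interp_approx arr n B)"

text \<open>\<open>has_head_redex M\<close>: the term M is of the form
  \<open>\<lambda>x1 \<dots> xn. (\<lambda>y. M') N M1 \<dots> Mk\<close>.\<close>

fun has_head_redex :: "'d tm \<Rightarrow> bool" where
  "has_head_redex (Lam M) = has_head_redex M"
| "has_head_redex (App (Lam M) N) = True"
| "has_head_redex (App M N) = has_head_redex M"
| "has_head_redex _ = False"

text \<open>On lambda-terms this is \<open>M\<^sup>\<Omega>\<close>: a lambda-term without head redex is a head-normal form
  \<open>\<lambda>x1 \<dots> xn. x M1 \<dots> Mk\<close>, and the recursion along its spine never meets a head redex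
  outside of the arguments. The value on \<open>TSum\<close> is irrelevant.\<close>

primrec direct_approx :: "'d tm \<Rightarrow> approximant" where
  "direct_approx (Var i) = AVar i"
| "direct_approx (Lam M) = (if has_head_redex (Lam M) then Omega else ALam (direct_approx M))"
| "direct_approx (App M N) =
     (if has_head_redex (App M N) then Omega else AApp (direct_approx M) (direct_approx N))"
| "direct_approx (TSum ps) = Omega"

text \<open>Finite Boehm approximants are obtained by head reduction, pursued in the arguments once a
  head variable has been reached: reduction at the root alone would leave the arguments of a
  head-normal form unevaluated, so that for instance \<open>x ((\<lambda>z. z) y)\<close> would have \<open>x \<Omega>\<close> as its
  only approximant.\<close>

inductive bohm_step :: "('d::bounded_semilattice_inf_top \<Rightarrow> ('d \<times> 'd) set) \<Rightarrow> 'd tm \<Rightarrow> 'd tm \<Rightarrow> bool"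
  for ext where
  "hstep ext M M' \<Longrightarrow> bohm_step ext M M'"
| "bohm_step ext M M' \<Longrightarrow> bohm_step ext (Lam M) (Lam M')"
| "var_headed M \<Longrightarrow> bohm_step ext M M' \<Longrightarrow> bohm_step ext (App M N) (App M' N)"
| "var_headed M \<Longrightarrow> bohm_step ext N N' \<Longrightarrow> bohm_step ext (App M N) (App M N')"

definition approximants ::
  "('d::bounded_semilattice_inf_top \<Rightarrow> ('d \<times> 'd) set) \<Rightarrow> 'd tm \<Rightarrow> approximant set" where
  "approximants ext M = {direct_approx M' | M'. (bohm_step ext)\<^sup>*\<^sup>* M M'}"

definition approximable ::
  "('d::bounded_semilattice_inf_top \<Rightarrow> 'd \<Rightarrow> 'd) \<Rightarrow> ('d \<Rightarrow> ('d \<times> 'd) set) \<Rightarrow> bool" where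
  "approximable arr ext \<longleftrightarrow>
     (\<forall>n M. tm_in n M \<and> lambda_term M \<longrightarrow>
        interp arr n M = (\<Union>A \<in> approximants ext M. interp_approx arr n A))"

end

(*
  Reducibility candidates R(a), one for each type a, are sought with
  R(a) = {M | for all (u, v) in ext a and N in R(u), M N is in R(v)} such that {a | M in R(a)} is a
  filter for every M and such that R(a) lies between the neutral terms and the terms accepted at a.
  They are built by well-founded recursion on the strata of the preorder. On one stratum the equation
  is not well-founded, but by the conditions on the polarity it is monotone once the positive types
  are ordered by reverse inclusion, so that the positive candidates are greatest and the negative
  ones least fixed points. Distributivity, together with the conditions on meets, is what makes the
  fixed point compatible with meets: a lower type above a meet is already a meet of lower types, one
  above each component. The exception are negative types that are the meet of a positive and a lower
  type; they depend positively on each other and otherwise only on lower types, and are treated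
  first.

  The fundamental lemma then shows that a test with a non-empty interpretation reduces to a
  head-normal form; the converse is subject reduction and expansion. For approximability, a typing
  of M in a context G yields a finite successful reduction of the test tau_a(M[epsbar_G/x]), which
  only looks at a finite part of the Boehm tree of M; this part is an approximant of the same type.
*)

theory Submission
  imports Defs
begin

text \<open>Typing an application only yields \<open>a \<le> arr u v\<close>, so that
  \<open>v\<close> is merely above the meet of the results of \<open>ext a\<close> at
  \<open>u\<close>. To place \<open>M N\<close> in the candidate of \<open>v\<close>, the types
  whose candidate contains a given term must form a filter. This is why \<open>family\<close>
  carries the filter property through every step of the fixed-point construction, and not only the
  two bounds. The same property makes the equation for R independent of the finite set of arrows
  chosen to represent a type. Hence the mixed types may be given arrows other than those of
  \<open>ext\<close>, whose left components are all lower. Tests supply a syntactic witness of each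
  type: \<open>epsbar a\<close> is accepted exactly at the types above \<open>a\<close>, and it
  belongs to R(a). Instantiating the fundamental lemma with the variables themselves gives
  sensibility; instantiating it with \<open>epsbar\<close> at the types of the context gives
  approximability. The assumption that some type differs from \<omega> excludes the one-point model,
  where a variable converges although every term is interpreted as \<open>sem_bot\<close>.\<close>

lemma meet_lower: "finite A \<Longrightarrow> a \<in> A \<Longrightarrow> meet A \<le> a"
  using le_meet_iff by blast

lemma meet_union: "finite A \<Longrightarrow> finite B \<Longrightarrow> meet (A \<union> B) = inf (meet A) (meet B)"
  by (rule order.antisym) (auto simp: le_meet_iff intro: meet_lower le_infI1 le_infI2)

lemma meet_closed:
  assumes "finite B" "B \<subseteq> U" "top \<in> U" "\<And>a b. a \<in> U \<Longrightarrow> b \<in> U \<Longrightarrow> inf a b \<in> U"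
  shows "meet B \<in> U"
  using assms(1,2) by (induction B rule: finite_induct) (auto simp: assms(3,4))

section \<open>Arrows in a filter model\<close>

locale arrow_model =
  fixes arr :: "'d::bounded_semilattice_inf_top \<Rightarrow> 'd \<Rightarrow> 'd"
  assumes filter_model: "filter_model arr"
begin

definition arrows :: "('d \<times> 'd) set \<Rightarrow> 'd set" where
  "arrows S = {arr \<beta> \<gamma> | \<beta> \<gamma>. (\<beta>, \<gamma>) \<in> S}"

text \<open>\<open>meet (results S u)\<close> is the application of \<open>meet (arrows S)\<close>
  to \<open>u\<close>: by \<open>meet_arrows_le\<close>, the least \<open>v\<close> with
  \<open>meet (arrows S) \<le> arr u v\<close>.\<close>

definition results :: "('d \<times> 'd) set \<Rightarrow> 'd \<Rightarrow> 'd set" where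
  "results S u = {v. \<exists>u'. (u', v) \<in> S \<and> u \<le> u'}"

lemma arrows_image: "arrows S = (\<lambda>(u, v). arr u v) ` S"
  by (auto simp: arrows_def)

lemma finite_arrows [simp]: "finite S \<Longrightarrow> finite (arrows S)"
  by (simp add: arrows_image)

lemma finite_results [simp]: "finite S \<Longrightarrow> finite (results S u)"
  by (rule finite_subset[of _ "snd ` S"]) (force simp: results_def)+

lemma meet_arrows_le: "finite S \<Longrightarrow> meet (arrows S) \<le> arr u v \<longleftrightarrow> meet (results S u) \<le> v"
  using filter_model by (auto simp: filter_model_def arrows_def results_def)

lemma arrows_Un: "arrows (S \<union> T) = arrows S \<union> arrows T"
  by (auto simp: arrows_def)

lemma arr_mono: "u' \<le> u \<Longrightarrow> v \<le> v' \<Longrightarrow> arr u v \<le> arr u' v'"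
  using meet_arrows_le[of "{(u, v)}" u' v'] by (auto simp: arrows_def results_def)

text \<open>The filter-model axiom for the empty family.\<close>

lemma arr_top_iff [simp]: "arr u v = top \<longleftrightarrow> v = top"
  using meet_arrows_le[of "{}" u v] by (auto simp: arrows_def results_def top_unique)

lemma inf_arr_le: "inf (arr u v) (arr u' v') \<le> arr (inf u u') (inf v v')"
proof -
  have "results {(u, v), (u', v')} (inf u u') = {v, v'}"
    by (auto simp: results_def)
  then show ?thesis
    using meet_arrows_le[of "{(u, v), (u', v')}" "inf u u'" "inf v v'"]
    by (simp add: arrows_image)
qed

text \<open>The function is a parameter because, besides \<open>ext\<close>, two modifications of it
  are used to represent the same types.\<close>

definition represents :: "('d \<Rightarrow> ('d \<times> 'd) set) \<Rightarrow> bool" where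
  "represents E \<longleftrightarrow> (\<forall>a. finite (E a) \<and> a = meet (arrows (E a)))"

lemma represents_finite: "represents E \<Longrightarrow> finite (E a)"
  by (simp add: represents_def)

lemma represents_eq: "represents E \<Longrightarrow> meet (arrows (E a)) = a"
  by (simp add: represents_def)

lemma represents_le: "represents E \<Longrightarrow> a \<le> arr u v \<longleftrightarrow> meet (results (E a) u) \<le> v"
  using meet_arrows_le[of "E a" u v] by (simp add: represents_def)

lemma represents_mem: "represents E \<Longrightarrow> (u, v) \<in> E a \<Longrightarrow> a \<le> arr u v"
  using meet_lower[of "results (E a) u" v]
  by (simp add: represents_le represents_finite) (auto simp: results_def)

lemma represents_le_iff: "represents E \<Longrightarrow> a \<le> b \<longleftrightarrow> (\<forall>(u, v) \<in> E b. a \<le> arr u v)"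
  using le_meet_iff[of "arrows (E b)" a]
  by (simp add: represents_eq represents_finite) (auto simp: arrows_def)

text \<open>The union of \<open>E a\<close> and \<open>E b\<close> represents
  \<open>inf a b\<close>, whatever \<open>E (inf a b)\<close> is.\<close>

lemma represents_inf:
  assumes "represents E" "inf a b \<le> arr u v"
  shows "meet (results (E a \<union> E b) u) \<le> v"
proof -
  have "inf a b = meet (arrows (E a \<union> E b))"
    using assms(1) by (simp add: arrows_Un meet_union represents_finite represents_eq)
  then show ?thesis
    using assms meet_arrows_le[of "E a \<union> E b" u v] by (simp add: represents_finite)
qed

end

section \<open>Families of candidates\<close>

text \<open>The part of the argument that does not depend on the syntax. \<open>Sp a\<close> bounds
  the candidate of \<open>a\<close> from above, \<open>Sp a \<inter> Neut\<close> bounds it from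
  below. \<open>Neut_app\<close> and \<open>Sp_abs\<close> make these bounds survive
  \<open>unfold_arrows\<close>; in \<open>Sp_abs\<close> only neutral arguments are tested, since
  these are known to lie in the candidates by the lower bound.\<close>

locale candidates = arrow_model arr
  for arr :: "'d::bounded_semilattice_inf_top \<Rightarrow> 'd \<Rightarrow> 'd" +
  fixes app :: "'t \<Rightarrow> 't \<Rightarrow> 't"
    and step :: "'t \<Rightarrow> 't \<Rightarrow> bool"
    and Sp :: "'d \<Rightarrow> 't set"
    and Neut :: "'t set"
  assumes Sp_top: "Sp top = UNIV"
    and Sp_inf: "inf a b \<le> c \<Longrightarrow> M \<in> Sp a \<Longrightarrow> M \<in> Sp b \<Longrightarrow> M \<in> Sp c"
    and Neut_app: "M \<in> Sp a \<Longrightarrow> M \<in> Neut \<Longrightarrow> a \<le> arr u v \<Longrightarrow> N \<in> Sp u \<Longrightarrow>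
      app M N \<in> Sp v \<and> app M N \<in> Neut"
    and Sp_abs: "(\<And>u v N. a \<le> arr u v \<Longrightarrow> N \<in> Sp u \<Longrightarrow> N \<in> Neut \<Longrightarrow> app M N \<in> Sp v) \<Longrightarrow> M \<in> Sp a"
    and step_app: "step M M' \<Longrightarrow> step (app M N) (app M' N)"
    and Sp_step: "step M M' \<Longrightarrow> M \<in> Sp a \<longleftrightarrow> M' \<in> Sp a"
    and Neut_step: "step M M' \<Longrightarrow> M \<in> Neut \<longleftrightarrow> M' \<in> Neut"
begin

text \<open>The condition with \<open>inf a b \<le> c\<close> combines upward closure (take
  \<open>a = b\<close>) with closure under meets: for a fixed term, the types of \<open>U\<close>
  whose set contains it form a filter relative to \<open>U\<close>.\<close>

definition family :: "'d set \<Rightarrow> ('d \<Rightarrow> 't set) \<Rightarrow> bool" where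
  "family U X \<longleftrightarrow> X top = UNIV \<and>
     (\<forall>a\<in>U. \<forall>b\<in>U. \<forall>c\<in>U. inf a b \<le> c \<longrightarrow> X a \<inter> X b \<subseteq> X c) \<and>
     (\<forall>a\<in>U. Sp a \<inter> Neut \<subseteq> X a \<and> X a \<subseteq> Sp a) \<and>
     (\<forall>a\<in>U. \<forall>M M'. step M M' \<longrightarrow> (M \<in> X a \<longleftrightarrow> M' \<in> X a))"

definition unfold_arrows :: "('d \<Rightarrow> ('d \<times> 'd) set) \<Rightarrow> ('d \<Rightarrow> 't set) \<Rightarrow> 'd \<Rightarrow> 't set" where
  "unfold_arrows E X a = {M. \<forall>(u, v) \<in> E a. \<forall>N \<in> X u. app M N \<in> X v}"

definition closed_under :: "('d \<Rightarrow> ('d \<times> 'd) set) \<Rightarrow> 'd set \<Rightarrow> bool" where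
  "closed_under E U \<longleftrightarrow> top \<in> U \<and> (\<forall>a\<in>U. \<forall>b\<in>U. inf a b \<in> U) \<and> (\<forall>a\<in>U. E a \<subseteq> U \<times> U)"

definition solves :: "('d \<Rightarrow> ('d \<times> 'd) set) \<Rightarrow> 'd set \<Rightarrow> ('d \<Rightarrow> 't set) \<Rightarrow> bool" where
  "solves E U X \<longleftrightarrow> family U X \<and> (\<forall>a\<in>U. X a = unfold_arrows E X a)"

lemma family_top: "family U X \<Longrightarrow> X top = UNIV"
  by (simp add: family_def)

lemma family_inf:
  "family U X \<Longrightarrow> a \<in> U \<Longrightarrow> b \<in> U \<Longrightarrow> c \<in> U \<Longrightarrow> inf a b \<le> c \<Longrightarrow> M \<in> X a \<Longrightarrow> M \<in> X b \<Longrightarrow> M \<in> X c"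
  unfolding family_def by blast

lemma family_mono: "family U X \<Longrightarrow> a \<in> U \<Longrightarrow> c \<in> U \<Longrightarrow> a \<le> c \<Longrightarrow> M \<in> X a \<Longrightarrow> M \<in> X c"
  using family_inf[of U X a a c] by simp

lemma family_lower: "family U X \<Longrightarrow> a \<in> U \<Longrightarrow> M \<in> Sp a \<Longrightarrow> M \<in> Neut \<Longrightarrow> M \<in> X a"
  by (auto simp: family_def)

lemma family_upper: "family U X \<Longrightarrow> a \<in> U \<Longrightarrow> M \<in> X a \<Longrightarrow> M \<in> Sp a"
  by (auto simp: family_def)

lemma family_step: "family U X \<Longrightarrow> a \<in> U \<Longrightarrow> step M M' \<Longrightarrow> M \<in> X a \<longleftrightarrow> M' \<in> X a"
  by (auto simp: family_def)

lemma family_meet: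
  assumes X: "family U X" and U: "closed_under E U"
    and B: "finite B" "B \<subseteq> U" "\<forall>b\<in>B. M \<in> X b" and c: "c \<in> U" "meet B \<le> c"
  shows "M \<in> X c"
proof -
  have "meet B \<in> U \<and> M \<in> X (meet B)"
    using B
  proof (induction B rule: finite_induct)
    case empty
    then show ?case using X U by (simp add: family_top closed_under_def)
  next
    case (insert b B)
    then have "inf b (meet B) \<in> U" using U by (simp add: closed_under_def)
    then show ?case
      using insert family_inf[OF X, of b "meet B" "inf b (meet B)"] by simp
  qed
  then show ?thesis using family_mono[OF X] c by blast
qed

lemma Sp_family: "family UNIV Sp"
  using Sp_top Sp_inf Sp_step by (auto simp: family_def)

lemma Sp_meet: "finite B \<Longrightarrow> \<forall>b\<in>B. M \<in> Sp b \<Longrightarrow> meet B \<le> c \<Longrightarrow> M \<in> Sp c"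
  by (rule family_meet[OF Sp_family, of "\<lambda>_. {}"]) (auto simp: closed_under_def)

lemma unfold_arrowsD:
  assumes "M \<in> unfold_arrows E X a" "(u, v) \<in> E a" "N \<in> X u"
  shows "app M N \<in> X v"
  using assms by (auto simp: unfold_arrows_def)

lemma unfold_arrows_cong:
  "(\<And>b. b \<in> U \<Longrightarrow> X b = Y b) \<Longrightarrow> closed_under E U \<Longrightarrow> a \<in> U \<Longrightarrow>
   unfold_arrows E X a = unfold_arrows E Y a"
  by (fastforce simp: unfold_arrows_def closed_under_def)

lemma family_cong:
  assumes "\<And>b. b \<in> U \<Longrightarrow> X b = Y b" "top \<in> U"
  shows "family U X \<longleftrightarrow> family U Y"
  using assms unfolding family_def by simp

lemma solves_cong:
  assumes "\<And>b. b \<in> U \<Longrightarrow> X b = Y b" "closed_under E U" "solves E U X"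
  shows "solves E U Y"
proof -
  have "family U Y"
    using assms family_cong[of U X Y] by (simp add: solves_def closed_under_def)
  then show ?thesis
    using assms unfold_arrows_cong[of U X Y E] unfolding solves_def by auto
qed

text \<open>Given an arrow \<open>(u, v)\<close> above \<open>c\<close>, the type \<open>v\<close>
  is above the meet of the results of \<open>E a\<close> and \<open>E b\<close> at \<open>u\<close>.
  An argument in \<open>X u\<close> lies in \<open>X u'\<close> for every left component
  \<open>u'\<close> above \<open>u\<close>, so the application has all these results, and the filter
  property of \<open>X\<close> yields \<open>v\<close>. As \<open>E'\<close> is arbitrary, this
  gives both the filter property of the unfolding (\<open>E' = E\<close>) and its independence of
  the representation (\<open>a = b = c\<close>).\<close>

lemma unfold_arrows_inf:
  assumes E: "represents E" and U: "closed_under E U" and E': "E' c \<subseteq> U \<times> U" "\<And>u v. (u, v) \<in> E' c \<Longrightarrow> c \<le> arr u v"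
    and X: "family U X" and abc: "a \<in> U" "b \<in> U" "inf a b \<le> c"
    and M: "M \<in> unfold_arrows E X a" "M \<in> unfold_arrows E X b"
  shows "M \<in> unfold_arrows E' X c"
  unfolding unfold_arrows_def
proof (clarify)
  fix u v N assume uv: "(u, v) \<in> E' c" and N: "N \<in> X u"
  have uU: "u \<in> U" "v \<in> U" using uv E' by auto
  have Ea: "E a \<subseteq> U \<times> U" "E b \<subseteq> U \<times> U" using U abc by (auto simp: closed_under_def)
  have "inf a b \<le> arr u v" using abc E'(2)[OF uv] by (rule_tac order.trans)
  then have "meet (results (E a \<union> E b) u) \<le> v" by (rule represents_inf[OF E])
  moreover have "app M N \<in> X w \<and> w \<in> U" if "w \<in> results (E a \<union> E b) u" for w
  proof -
    obtain u' where u': "(u', w) \<in> E a \<union> E b" "u \<le> u'" using \<open>w \<in> _\<close> by (auto simp: results_def)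
    then have "u' \<in> U" "w \<in> U" using Ea by auto
    moreover have "N \<in> X u'" using family_mono[OF X uU(1) \<open>u' \<in> U\<close> u'(2) N] .
    ultimately show ?thesis using u'(1) M unfold_arrowsD by blast
  qed
  ultimately show "app M N \<in> X v"
    using family_meet[OF X U, of "results (E a \<union> E b) u"] uU E by (auto simp: represents_finite)
qed

lemma unfold_arrows_top:
  assumes "represents E" "X top = UNIV"
  shows "unfold_arrows E X top = UNIV"
proof -
  have "v = top" if "(u, v) \<in> E top" for u v
    using represents_mem[OF assms(1) that] by (simp add: top_unique)
  then show ?thesis using assms(2) by (auto simp: unfold_arrows_def)
qed

text \<open>Because unfolding stays within families, a fixed point can be sought among
  families.\<close>

lemma unfold_arrows_family:
  assumes E: "represents E" and U: "closed_under E U" and X: "family U X"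
  shows "family U (unfold_arrows E X)" (is "family U ?Y")
  unfolding family_def
proof (intro conjI ballI impI allI)
  show "?Y top = UNIV" using unfold_arrows_top[where X = X, OF E family_top[OF X]] .
  have EU: "E a \<subseteq> U \<times> U" if "a \<in> U" for a using U that by (simp add: closed_under_def)
  fix a assume a: "a \<in> U"
  show "?Y a \<inter> ?Y b \<subseteq> ?Y c" if "b \<in> U" "c \<in> U" "inf a b \<le> c" for b c
    using unfold_arrows_inf[where E' = E, OF E U EU represents_mem[OF E] X a] that by blast
  show "Sp a \<inter> Neut \<subseteq> ?Y a"
  proof
    fix M assume M: "M \<in> Sp a \<inter> Neut"
    have "app M N \<in> X v" if "(u, v) \<in> E a" "N \<in> X u" for u v N
    proof -
      have "u \<in> U" "v \<in> U" using EU[OF a] that by auto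
      then have "N \<in> Sp u" using family_upper[OF X] that by blast
      then have "app M N \<in> Sp v \<and> app M N \<in> Neut"
        using Neut_app[of M a u v N] M represents_mem[OF E that(1)] by blast
      then show ?thesis using family_lower[OF X] \<open>v \<in> U\<close> by blast
    qed
    then show "M \<in> ?Y a" by (auto simp: unfold_arrows_def)
  qed
  show "?Y a \<subseteq> Sp a"
  proof
    fix M assume "M \<in> ?Y a"
    then have M: "M \<in> unfold_arrows E X a" .
    show "M \<in> Sp a"
    proof (rule Sp_abs)
      fix u v N assume uv: "a \<le> arr u v" and N: "N \<in> Sp u" "N \<in> Neut"
      have "app M N \<in> Sp w" if "w \<in> results (E a) u" for w
      proof -
        obtain u' where u': "(u', w) \<in> E a" "u \<le> u'" using \<open>w \<in> _\<close> by (auto simp: results_def)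
        then have U': "u' \<in> U" "w \<in> U" using EU[OF a] by auto
        have "N \<in> Sp u'" using N(1) u'(2) Sp_inf[of u u u'] by simp
        then have "N \<in> X u'" using family_lower[OF X U'(1)] N(2) by blast
        then show ?thesis using unfold_arrowsD[OF M u'(1)] family_upper[OF X U'(2)] by blast
      qed
      then show "app M N \<in> Sp v"
        using Sp_meet[of "results (E a) u"] uv E by (auto simp: represents_finite represents_le)
    qed
  qed
  show "(M \<in> ?Y a) = (M' \<in> ?Y a)" if "step M M'" for M M'
  proof -
    have "app M N \<in> X v \<longleftrightarrow> app M' N \<in> X v" if "(u, v) \<in> E a" for u v N
      using family_step[OF X _ step_app[OF \<open>step M M'\<close>]] EU[OF a] that by auto
    then show ?thesis unfolding unfold_arrows_def by fast
  qed
qed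

text \<open>This licenses the replacement of \<open>ext\<close> by a representation better suited to
  the mixed types, and the return to \<open>ext\<close> afterwards.\<close>

lemma solves_change:
  assumes E: "represents E" "closed_under E U" and E': "represents E'" "closed_under E' U"
    and X: "solves E U X"
  shows "solves E' U X"
proof -
  have X1: "family U X" "\<And>a. a \<in> U \<Longrightarrow> X a = unfold_arrows E X a"
    using X by (auto simp: solves_def)
  have "M \<in> unfold_arrows E X a \<longleftrightarrow> M \<in> unfold_arrows E' X a" if "a \<in> U" for a M
  proof -
    have "E a \<subseteq> U \<times> U" "E' a \<subseteq> U \<times> U"
      using E E' that by (auto simp: closed_under_def)
    then show ?thesis
      using unfold_arrows_inf[where c = a and E' = E', OF E _ represents_mem[OF E'(1)] X1(1) that that]
        unfold_arrows_inf[where c = a and E' = E, OF E' _ represents_mem[OF E(1)] X1(1) that that]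
      by auto
  qed
  then show ?thesis using X1 by (auto simp: solves_def)
qed

text \<open>The least fixed point on \<open>Cf\<close> and, dually, the greatest one on \<open>Ct\<close> are reached together by
  encoding a family on \<open>Ct \<union> Cf\<close> as the set of pairs \<open>(a, M)\<close> with \<open>M \<in> X a\<close> for \<open>a \<in> Cf\<close> and
  \<open>M \<notin> X a\<close> for \<open>a \<in> Ct\<close>. Zorn's lemma then yields a fixed point which, unlike the one obtained
  from Knaster--Tarski, is closed under meets: this property survives unions of chains. The iteration starts from the largest (\<open>Hi\<close>) and the
  smallest (\<open>Lo\<close>) extension of \<open>X\<close> that respect meets with types in \<open>U\<close>.\<close>

lemma solves_extend:
  assumes E: "represents E"
    and X: "solves E U X" and U: "closed_under E U"
    and disj: "U \<inter> (Ct \<union> Cf) = {}" "Ct \<inter> Cf = {}"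
    and W: "closed_under E (U \<union> Ct \<union> Cf)"
    and true_false: "\<And>a b c. a \<in> Ct \<Longrightarrow> b \<in> U \<Longrightarrow> c \<in> Cf \<Longrightarrow> inf a b \<le> c \<Longrightarrow> inf a b \<in> U"
      "\<And>a b c. a \<in> Ct \<Longrightarrow> b \<in> Ct \<Longrightarrow> c \<in> Cf \<Longrightarrow> \<not> inf a b \<le> c"
    and split: "\<And>a b g w. a \<in> Ct \<Longrightarrow> b \<in> Ct \<Longrightarrow> g \<in> U \<Longrightarrow> w \<in> U \<Longrightarrow> inf (inf a b) g \<le> w \<Longrightarrow>
      inf a g \<in> U \<or> inf b g \<in> U \<or> (\<exists>x\<in>U. \<exists>y\<in>U. w = inf x y \<and> inf a g \<le> x \<and> inf b g \<le> y)"
    and pol_t: "\<And>a u v. a \<in> Ct \<Longrightarrow> (u, v) \<in> E a \<Longrightarrow> u \<notin> Ct \<and> v \<notin> Cf"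
    and pol_f: "\<And>a u v. a \<in> Cf \<Longrightarrow> (u, v) \<in> E a \<Longrightarrow> u \<notin> Cf \<and> v \<notin> Ct"
  shows "\<exists>Y. solves E (U \<union> Ct \<union> Cf) Y \<and> (\<forall>a\<in>U. Y a = X a)"
proof -
  \<comment> \<open>The types in \<open>Ct\<close> get the greatest, those in \<open>Cf\<close> the
    least fixed point. By \<open>true_false\<close>, a type of \<open>Cf\<close> is above a meet
    with a type of \<open>Ct\<close> only when that meet lies in the part \<open>U\<close> already
    solved. The assumption \<open>split\<close> is the form in which distributivity is used. The
    assumptions on polarity make the unfolding monotone on encodings.\<close>
  let ?W = "U \<union> Ct \<union> Cf"
  have XU: "family U X" and Xfix: "\<And>a. a \<in> U \<Longrightarrow> X a = unfold_arrows E X a"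
    using X by (auto simp: solves_def)
  have topU: "top \<in> U" and infU: "\<And>a b. a \<in> U \<Longrightarrow> b \<in> U \<Longrightarrow> inf a b \<in> U"
    using U by (auto simp: closed_under_def)
  have EW: "E a \<subseteq> ?W \<times> ?W" if "a \<in> ?W" for a
    using W that unfolding closed_under_def by blast

  define Hi where "Hi a = {M \<in> Sp a. \<forall>g\<in>U. \<forall>w\<in>U. M \<in> X g \<longrightarrow> inf a g \<le> w \<longrightarrow> M \<in> X w}" for a
  define Lo where "Lo a = {M. M \<in> Sp a \<and> M \<in> Neut \<or> (\<exists>w\<in>U. w \<le> a \<and> M \<in> X w)}" for a
  define dec where "dec Z a = (if a \<in> U then X a else if a \<in> Ct then {M. (a, M) \<notin> Z}
    else {M. (a, M) \<in> Z})" for Z a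
  define enc where "enc Y = {(a, M). a \<in> Ct \<and> M \<notin> Y a \<or> a \<in> Cf \<and> M \<in> Y a}" for Y :: "'d \<Rightarrow> 't set"
  have dec_U: "dec Z a = X a" if "a \<in> U" for Z a using that by (simp add: dec_def)
  have dec_enc: "dec (enc Y) a = Y a" if "a \<in> Ct \<union> Cf" for Y a
    using that disj by (auto simp: dec_def enc_def)
  have dec_t: "M \<in> dec Z a \<longleftrightarrow> (a, M) \<notin> Z" if "a \<in> Ct" for Z a M
    using that disj by (auto simp: dec_def)
  have dec_f: "M \<in> dec Z a \<longleftrightarrow> (a, M) \<in> Z" if "a \<in> Cf" for Z a M
    using that disj by (auto simp: dec_def)
  have unfold_dec_U: "unfold_arrows E (dec Z) a = X a" if "a \<in> U" for Z a
    using unfold_arrows_cong[of U "dec Z" X E a] dec_U U that Xfix by simp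

  \<comment> \<open>In the order of encodings these are the \<open>Z\<close> with
    \<open>Z \<subseteq> enc (unfold_arrows E (dec Z))\<close>, the post-fixed points of a monotone
    operator, restricted to those that decode to a family.\<close>
  define \<A> where "\<A> = {Z. Z \<subseteq> (Ct \<union> Cf) \<times> UNIV \<and> family ?W (dec Z) \<and>
    (\<forall>a\<in>Ct. unfold_arrows E (dec Z) a \<subseteq> dec Z a) \<and> (\<forall>a\<in>Cf. dec Z a \<subseteq> unfold_arrows E (dec Z) a)}"

  have unfold_t: "unfold_arrows E (dec Z') a \<subseteq> unfold_arrows E (dec Z) a"
    if "Z \<subseteq> Z'" "a \<in> Ct" for Z Z' a
  proof -
    have "dec Z u \<subseteq> dec Z' u" "dec Z' v \<subseteq> dec Z v" if uv: "(u, v) \<in> E a" for u v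
      using pol_t[OF \<open>a \<in> Ct\<close> uv] \<open>Z \<subseteq> Z'\<close> EW[of a] \<open>a \<in> Ct\<close> uv by (auto simp: dec_def)
    then show ?thesis unfolding unfold_arrows_def by fast
  qed
  have unfold_f: "unfold_arrows E (dec Z) a \<subseteq> unfold_arrows E (dec Z') a"
    if "Z \<subseteq> Z'" "a \<in> Cf" for Z Z' a
  proof -
    have "dec Z' u \<subseteq> dec Z u" "dec Z v \<subseteq> dec Z' v" if uv: "(u, v) \<in> E a" for u v
      using pol_f[OF \<open>a \<in> Cf\<close> uv] \<open>Z \<subseteq> Z'\<close> EW[of a] \<open>a \<in> Cf\<close> uv by (auto simp: dec_def)
    then show ?thesis unfolding unfold_arrows_def by fast
  qed

  have base: "enc (\<lambda>a. if a \<in> Ct then Hi a else Lo a) \<in> \<A>" (is "enc ?Y0 \<in> \<A>")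
  proof -
    let ?X0 = "dec (enc ?Y0)"
    have X0: "?X0 a = (if a \<in> U then X a else if a \<in> Ct then Hi a else Lo a)" if "a \<in> ?W" for a
      using dec_enc[of a ?Y0] dec_U[of a] that disj by auto
    have X0_U: "?X0 a = X a" if "a \<in> U" for a using dec_U that .
    have X0_t: "?X0 a = Hi a" if "a \<in> Ct" for a using X0[of a] that disj by auto
    have X0_f: "?X0 a = Lo a" if "a \<in> Cf" for a using X0[of a] that disj by auto
    have up: "?X0 a \<subseteq> Sp a" if "a \<in> ?W" for a
    proof -
      have "M \<in> Sp a" if "w \<in> U" "w \<le> a" "M \<in> X w" for w M
        using family_upper[OF XU that(1,3)] Sp_inf[of w w a] that(2) by simp
      then have "Lo a \<subseteq> Sp a" by (auto simp: Lo_def)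
      then show ?thesis using that X0_U X0_t X0_f family_upper[OF XU] by (fastforce simp: Hi_def)
    qed
    have low: "M \<in> ?X0 a" if a: "a \<in> ?W" and M: "M \<in> Sp a" "M \<in> Neut" for a M
    proof -
      have "M \<in> X w" if "g \<in> U" "w \<in> U" "M \<in> X g" "inf a g \<le> w" for g w
        using family_lower[OF XU that(2) _ M(2)] family_upper[OF XU that(1,3)] Sp_inf[OF that(4) M(1)]
        by blast
      then have "M \<in> Hi a" "M \<in> Lo a" using M by (auto simp: Hi_def Lo_def)
      then show ?thesis using a X0_U X0_t X0_f family_lower[OF XU _ M] by blast
    qed
    have HiD: "M \<in> X w" if "M \<in> Hi a" "g \<in> U" "w \<in> U" "M \<in> X g" "inf a g \<le> w" for a g w M
      using that unfolding Hi_def by blast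
    \<comment> \<open>\<open>Hi\<close> tests one type of \<open>Ct\<close> against \<open>U\<close>
      at a time. For two of them, \<open>split\<close> leaves two possibilities: one meet with
      \<open>g\<close> falls into \<open>U\<close> and can be used as the new \<open>g\<close>, or
      \<open>w\<close> is a meet of types of \<open>U\<close> each of which is obtained from one of
      the two.\<close>
    have two: "M \<in> X w" if ab: "a \<in> Ct" "b \<in> Ct" and gw: "g \<in> U" "w \<in> U" and le: "inf (inf a b) g \<le> w"
      and M: "M \<in> Hi a" "M \<in> Hi b" "M \<in> X g" for a b g w M
      using split[OF ab gw le]
    proof (elim disjE bexE conjE)
      assume "inf a g \<in> U"
      then have "M \<in> X (inf a g)" using HiD[OF M(1) gw(1) _ M(3)] by blast
      then show ?thesis using HiD[OF M(2) \<open>inf a g \<in> U\<close> gw(2)] le by (simp add: ac_simps)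
    next
      assume "inf b g \<in> U"
      then have "M \<in> X (inf b g)" using HiD[OF M(2) gw(1) _ M(3)] by blast
      then show ?thesis using HiD[OF M(1) \<open>inf b g \<in> U\<close> gw(2)] le by (simp add: ac_simps)
    next
      fix x y assume xy: "x \<in> U" "y \<in> U" "w = inf x y" "inf a g \<le> x" "inf b g \<le> y"
      have "M \<in> X x" "M \<in> X y"
        using HiD[OF M(1) gw(1) xy(1) M(3) xy(4)] HiD[OF M(2) gw(1) xy(2) M(3) xy(5)] .
      then show ?thesis using family_inf[OF XU xy(1,2) gw(2)] xy(3) by simp
    qed
    \<comment> \<open>A component that lies in \<open>U\<close> is absorbed into
      \<open>g\<close>.\<close>
    have three: "M \<in> X w"
      if ab: "a \<in> U \<union> Ct" "b \<in> U \<union> Ct" and gw: "g \<in> U" "w \<in> U" and le: "inf (inf a b) g \<le> w"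
        and M: "M \<in> ?X0 a" "M \<in> ?X0 b" "M \<in> X g" for a b g w M
    proof -
      have mixed: "M \<in> X w"
        if ab: "a \<in> Ct" "b \<in> U" and le: "inf (inf a b) g \<le> w" and M': "M \<in> ?X0 a" "M \<in> ?X0 b" for a b
      proof -
        have bg: "inf b g \<in> U" using infU[OF ab(2) gw(1)] .
        then have "M \<in> X (inf b g)" using family_inf[OF XU ab(2) gw(1) bg] M'(2) M(3) X0_U[OF ab(2)] by simp
        then show ?thesis using HiD[of M a "inf b g" w] M'(1) X0_t[OF ab(1)] bg gw(2) le by (simp add: inf.assoc)
      qed
      consider "a \<in> U" "b \<in> U" | "a \<in> Ct" "b \<in> U" | "a \<in> U" "b \<in> Ct" | "a \<in> Ct" "b \<in> Ct"
        using ab by blast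
      then show ?thesis
      proof cases
        case 1
        have "M \<in> X (inf a b)" using family_inf[OF XU 1 infU[OF 1]] M X0_U 1 by simp
        then show ?thesis using family_inf[OF XU infU[OF 1] gw le] M(3) by blast
      next
        case 2 show ?thesis using mixed[OF 2 le M(1,2)] .
      next
        case 3 then show ?thesis using mixed[OF 3(2,1) _ M(2,1)] le by (simp add: inf.commute)
      next
        case 4 then show ?thesis using two[OF 4 gw le] M X0_t by simp
      qed
    qed
    have inf_UC: "M \<in> ?X0 c"
      if ab: "a \<in> U \<union> Ct" "b \<in> U \<union> Ct" and c: "c \<in> ?W" and le: "inf a b \<le> c"
        and M: "M \<in> ?X0 a" "M \<in> ?X0 b" for a b c M
    proof -
      have S: "M \<in> Sp c" using Sp_inf[OF le, of M] up M ab by blast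
      have w: "M \<in> X w" if "w \<in> U" "inf a b \<le> w" for w
        using three[OF ab topU that(1) _ M] that(2) family_top[OF XU] by simp
      consider "c \<in> U" | "c \<in> Ct" | "c \<in> Cf" using c by blast
      then show ?thesis
      proof cases
        case 1 then show ?thesis using w le X0_U by simp
      next
        case 2
        have "M \<in> X w" if "w \<in> U" "g \<in> U" "M \<in> X g" "inf c g \<le> w" for g w
        proof -
          have "inf (inf a b) g \<le> w" using inf_mono[OF le order_refl, of g] that(4) by (rule order.trans)
          then show ?thesis using three[OF ab that(2,1) _ M that(3)] by blast
        qed
        then show ?thesis using S X0_t[OF 2] by (auto simp: Hi_def)
      next
        case 3
        \<comment> \<open>Both parts of \<open>true_false\<close> are needed here. Once the meet is
          in \<open>U\<close>, it is the witness required by \<open>Lo\<close>.\<close>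
        have "inf a b \<in> U"
          using ab true_false(1)[of a b c] true_false(1)[of b a c] true_false(2)[of a b c] infU[of a b] 3 le
          by (auto simp: inf.commute)
        then show ?thesis using w X0_f[OF 3] le by (auto simp: Lo_def)
      qed
    qed
    have inf: "M \<in> ?X0 c" if abc: "a \<in> ?W" "b \<in> ?W" "c \<in> ?W" "inf a b \<le> c"
      and M: "M \<in> ?X0 a" "M \<in> ?X0 b" for a b c M
    proof (cases "M \<in> Neut")
      case True
      then show ?thesis using low[OF abc(3)] Sp_inf[OF abc(4)] up abc(1,2) M by blast
    next
      case False
      \<comment> \<open>A term that is not neutral enters \<open>Lo d\<close> only through a type of
        \<open>U\<close> below \<open>d\<close>, so types of \<open>Cf\<close> can be removed from
        the left-hand side of the meet.\<close>
      have red: "\<exists>w \<in> U \<union> Ct. w \<le> d \<and> M \<in> ?X0 w" if "d \<in> ?W" "M \<in> ?X0 d" for d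
        using that X0_f[of d] X0_U False unfolding Lo_def by blast
      obtain a' b' where "a' \<in> U \<union> Ct" "a' \<le> a" "M \<in> ?X0 a'" "b' \<in> U \<union> Ct" "b' \<le> b" "M \<in> ?X0 b'"
        using red[OF abc(1) M(1)] red[OF abc(2) M(2)] by blast
      then show ?thesis using inf_UC[of a' b' c M] abc(3,4) by (meson inf_mono order.trans)
    qed
    have "(M \<in> ?X0 a) = (M' \<in> ?X0 a)" if "a \<in> ?W" and st: "step M M'" for a M M'
    proof -
      have "M \<in> Hi a \<longleftrightarrow> M' \<in> Hi a"
        using Sp_step[OF st] family_step[OF XU _ st] unfolding Hi_def by simp
      moreover have "M \<in> Lo a \<longleftrightarrow> M' \<in> Lo a"
        using Sp_step[OF st] Neut_step[OF st] family_step[OF XU _ st] unfolding Lo_def by auto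
      ultimately show ?thesis using X0[OF that(1)] family_step[OF XU _ st] by simp
    qed
    then have fam: "family ?W ?X0"
      using inf low up X0_U[OF topU] family_top[OF XU] unfolding family_def by blast
    then have fam': "family ?W (unfold_arrows E ?X0)"
      using unfold_arrows_family[OF E W] by blast
    \<comment> \<open>On \<open>U\<close> the unfolding is \<open>X\<close> itself. As the unfolding
      is a family, its members at \<open>a\<close> meet the condition that defines
      \<open>Hi a\<close>; dually, on \<open>Cf\<close> it contains what \<open>Lo\<close> puts
      in.\<close>
    have "unfold_arrows E ?X0 a \<subseteq> ?X0 a" if a: "a \<in> Ct" for a
    proof
      fix M assume M: "M \<in> unfold_arrows E ?X0 a"
      have "M \<in> X w" if "g \<in> U" "w \<in> U" "M \<in> X g" "inf a g \<le> w" for g w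
        using family_inf[OF fam' _ _ _ that(4), of M] a that M unfold_dec_U by blast
      moreover have "M \<in> Sp a" using family_upper[OF fam'] a M by blast
      ultimately show "M \<in> ?X0 a" using X0_t[OF a] by (auto simp: Hi_def)
    qed
    moreover have "?X0 a \<subseteq> unfold_arrows E ?X0 a" if a: "a \<in> Cf" for a
    proof
      fix M assume M: "M \<in> ?X0 a"
      have "M \<in> unfold_arrows E ?X0 a" if "w \<in> U" "w \<le> a" "M \<in> X w" for w
        using family_mono[OF fam' _ _ that(2)] a that unfold_dec_U by blast
      then show "M \<in> unfold_arrows E ?X0 a"
        using M X0_f[OF a] family_lower[OF fam'] a unfolding Lo_def by blast
    qed
    moreover have "enc ?Y0 \<subseteq> (Ct \<union> Cf) \<times> UNIV" by (auto simp: enc_def)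
    ultimately show ?thesis unfolding \<A>_def using fam by blast
  qed

  have "\<Union>\<C> \<in> \<A>" if "\<C> \<noteq> {}" and chain: "subset.chain \<A> \<C>" for \<C>
  proof -
    have lin: "Z \<subseteq> Z' \<or> Z' \<subseteq> Z" if "Z \<in> \<C>" "Z' \<in> \<C>" for Z Z'
      using chain that by (meson subset_chain_def)
    have mem: "Z \<in> \<A>" if "Z \<in> \<C>" for Z using chain that by (meson subset_chain_def subsetD)
    let ?L = "\<Union>\<C>"
    \<comment> \<open>Membership at the union of the chain is membership at all sufficiently large
      elements of the chain, for every kind of type. Each condition of \<open>family\<close>
      concerns finitely many types and hence passes to the union.\<close>
    have ev: "M \<in> dec ?L a \<longleftrightarrow> (\<exists>Z\<in>\<C>. \<forall>Z'\<in>\<C>. Z \<subseteq> Z' \<longrightarrow> M \<in> dec Z' a)" if a: "a \<in> ?W" for M a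
    proof -
      consider "a \<in> U" | "a \<in> Ct" | "a \<in> Cf" using a by blast
      then show ?thesis
      proof cases
        case 1 then show ?thesis using \<open>\<C> \<noteq> {}\<close> dec_U by auto
      next
        case 2
        have "(a, M) \<notin> ?L" if Z: "Z \<in> \<C>" "\<forall>Z'\<in>\<C>. Z \<subseteq> Z' \<longrightarrow> (a, M) \<notin> Z'" for Z
        proof
          assume "(a, M) \<in> ?L"
          then obtain Z' where "Z' \<in> \<C>" "(a, M) \<in> Z'" by blast
          then show False using lin[OF Z(1), of Z'] Z by blast
        qed
        then show ?thesis using \<open>\<C> \<noteq> {}\<close> unfolding dec_t[OF 2] by blast
      next
        case 3 then show ?thesis unfolding dec_f[OF 3] by blast
      qed
    qed
    have "family ?W (dec ?L)"
      unfolding family_def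
    proof (intro conjI ballI impI allI)
      show "dec ?L top = UNIV" using dec_U[OF topU] family_top[OF XU] by simp
      fix a assume a: "a \<in> ?W"
      show "dec ?L a \<inter> dec ?L b \<subseteq> dec ?L c" if bc: "b \<in> ?W" "c \<in> ?W" "inf a b \<le> c" for b c
      proof
        fix M assume M: "M \<in> dec ?L a \<inter> dec ?L b"
        obtain Za where Za: "Za \<in> \<C>" "\<forall>Z'\<in>\<C>. Za \<subseteq> Z' \<longrightarrow> M \<in> dec Z' a"
          using IntD1[OF M] unfolding ev[OF a] by (elim bexE)
        obtain Zb where Zb: "Zb \<in> \<C>" "\<forall>Z'\<in>\<C>. Zb \<subseteq> Z' \<longrightarrow> M \<in> dec Z' b"
          using IntD2[OF M] unfolding ev[OF bc(1)] by (elim bexE)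
        obtain Z where Z: "Z \<in> \<C>" "Za \<subseteq> Z" "Zb \<subseteq> Z"
          using lin[OF Za(1) Zb(1)] Za(1) Zb(1) by (elim disjE) auto
        have "M \<in> dec Z' c" if "Z' \<in> \<C>" "Z \<subseteq> Z'" for Z'
        proof -
          have "family ?W (dec Z')" using mem[OF that(1)] by (simp add: \<A>_def)
          moreover have "M \<in> dec Z' a" "M \<in> dec Z' b" using Za Zb Z that by auto
          ultimately show ?thesis using family_inf[of ?W "dec Z'"] a bc by blast
        qed
        then show "M \<in> dec ?L c" unfolding ev[OF bc(2)] using Z(1) by (intro bexI[of _ Z]) auto
      qed
      have fam: "family ?W (dec Z)" if "Z \<in> \<C>" for Z using mem[OF that] by (simp add: \<A>_def)
      obtain Z0 where Z0: "Z0 \<in> \<C>" using \<open>\<C> \<noteq> {}\<close> by blast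
      show "Sp a \<inter> Neut \<subseteq> dec ?L a"
      proof
        fix M assume "M \<in> Sp a \<inter> Neut"
        then have "M \<in> dec Z a" if "Z \<in> \<C>" for Z using family_lower[OF fam[OF that] a] by blast
        then show "M \<in> dec ?L a" unfolding ev[OF a] using Z0 by (intro bexI[of _ Z0]) auto
      qed
      show "dec ?L a \<subseteq> Sp a"
      proof
        fix M assume "M \<in> dec ?L a"
        then obtain Z where "Z \<in> \<C>" "\<forall>Z'\<in>\<C>. Z \<subseteq> Z' \<longrightarrow> M \<in> dec Z' a"
          unfolding ev[OF a] by (elim bexE)
        then show "M \<in> Sp a" using family_upper[OF fam a, of Z M] by blast
      qed
      show "(M \<in> dec ?L a) = (M' \<in> dec ?L a)" if "step M M'" for M M'
        using ev[OF a] family_step[OF fam a that] by simp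
    qed
    moreover have "unfold_arrows E (dec ?L) a \<subseteq> dec ?L a" if a: "a \<in> Ct" for a
    proof
      fix M assume M: "M \<in> unfold_arrows E (dec ?L) a"
      have "(a, M) \<notin> Z" if "Z \<in> \<C>" for Z
      proof -
        have "M \<in> unfold_arrows E (dec Z) a" using unfold_t[of Z ?L a] that a M by blast
        moreover have "unfold_arrows E (dec Z) a \<subseteq> dec Z a" using mem[OF that] a by (simp add: \<A>_def)
        ultimately show ?thesis using dec_t[OF a, of M Z] by blast
      qed
      then show "M \<in> dec ?L a" by (simp add: dec_t[OF a])
    qed
    moreover have "dec ?L a \<subseteq> unfold_arrows E (dec ?L) a" if a: "a \<in> Cf" for a
    proof
      fix M assume "M \<in> dec ?L a"
      then obtain Z where Z: "Z \<in> \<C>" "M \<in> dec Z a" by (auto simp: dec_f[OF a])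
      moreover have "dec Z a \<subseteq> unfold_arrows E (dec Z) a" using mem[OF Z(1)] a by (simp add: \<A>_def)
      ultimately have "M \<in> unfold_arrows E (dec Z) a" by blast
      then show "M \<in> unfold_arrows E (dec ?L) a" using unfold_f[of Z ?L a] Z(1) a by blast
    qed
    moreover have "?L \<subseteq> (Ct \<union> Cf) \<times> UNIV"
    proof (rule Union_least)
      show "Z \<subseteq> (Ct \<union> Cf) \<times> UNIV" if "Z \<in> \<C>" for Z using mem[OF that] by (simp add: \<A>_def)
    qed
    ultimately show ?thesis unfolding \<A>_def by blast
  qed
  then obtain Z where Z: "Z \<in> \<A>" and max: "\<And>Z'. Z' \<in> \<A> \<Longrightarrow> Z \<subseteq> Z' \<Longrightarrow> Z' = Z"
    using subset_Zorn_nonempty[of \<A>] base by blast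
  let ?F = "unfold_arrows E (dec Z)"
  have fam: "family ?W (dec Z)" using Z by (simp add: \<A>_def)
  have dec_F: "dec (enc ?F) a = ?F a" if "a \<in> ?W" for a
    using dec_enc[of a] dec_U[of a] unfold_dec_U[of a] that by auto
  \<comment> \<open>\<open>Z\<close> is post-fixed, so unfolding enlarges it. The unfolding is again
    in \<open>\<A>\<close>, and maximality of \<open>Z\<close> forces equality.\<close>
  have sub: "Z \<subseteq> enc ?F"
  proof
    fix p assume "p \<in> Z"
    then obtain a M where p: "p = (a, M)" "a \<in> Ct \<union> Cf" using Z by (cases p) (auto simp: \<A>_def)
    have "?F a \<subseteq> dec Z a" if "a \<in> Ct" using Z that by (simp add: \<A>_def)
    moreover have "dec Z a \<subseteq> ?F a" if "a \<in> Cf" using Z that by (simp add: \<A>_def)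
    ultimately have "a \<in> Ct \<and> M \<notin> ?F a \<or> a \<in> Cf \<and> M \<in> ?F a"
      using p \<open>p \<in> Z\<close> dec_t[of a M Z] dec_f[of a M Z] by blast
    then show "p \<in> enc ?F" by (simp add: enc_def p(1))
  qed
  have "family ?W (dec (enc ?F))"
  proof -
    have "family ?W ?F" using unfold_arrows_family[OF E W fam] .
    moreover have "top \<in> ?W" using topU by blast
    ultimately show ?thesis using dec_F unfolding family_def by simp
  qed
  moreover have "unfold_arrows E (dec (enc ?F)) a \<subseteq> dec (enc ?F) a" if "a \<in> Ct" for a
    using unfold_t[OF sub that] dec_F[of a] that by simp
  moreover have "dec (enc ?F) a \<subseteq> unfold_arrows E (dec (enc ?F)) a" if "a \<in> Cf" for a
    using unfold_f[OF sub that] dec_F[of a] that by simp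
  moreover have "enc ?F \<subseteq> (Ct \<union> Cf) \<times> UNIV" by (auto simp: enc_def)
  ultimately have "enc ?F \<in> \<A>" unfolding \<A>_def by blast
  then have "enc ?F = Z" using max sub by blast
  then have "dec Z a = ?F a" if "a \<in> ?W" for a using dec_F[OF that] by simp
  then have "solves E ?W (dec Z)" using fam by (simp add: solves_def)
  then show ?thesis using dec_U by blast
qed

end

section \<open>Strata\<close>

locale stratified_candidates = candidates arr app step Sp Neut
  for arr :: "'d::bounded_semilattice_inf_top \<Rightarrow> 'd \<Rightarrow> 'd"
    and app :: "'t \<Rightarrow> 't \<Rightarrow> 't" and step Sp Neut +
  fixes ext :: "'d \<Rightarrow> ('d \<times> 'd) set" and V :: "'d \<Rightarrow> bool" and le :: "'d \<Rightarrow> 'd \<Rightarrow> bool"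
  assumes ext: "represents ext"
    and distributive: "distributive TYPE('d)"
    and le_refl [simp]: "le a a"
    and le_trans: "le a b \<Longrightarrow> le b c \<Longrightarrow> le a c"
    and le_total: "le a b \<or> le b a"
    and wf_lt: "wfP (\<lambda>a b. le a b \<and> \<not> le b a)"
    and le_top [simp]: "le top a"
    and ext_le: "(u, v) \<in> ext a \<Longrightarrow> le u a \<and> le v a"
    and ext_pos: "(u, v) \<in> ext a \<Longrightarrow> le a v \<Longrightarrow> a \<noteq> top \<Longrightarrow> v \<noteq> top \<Longrightarrow> V a = V v"
    and ext_neg: "(u, v) \<in> ext a \<Longrightarrow> le a u \<Longrightarrow> a \<noteq> top \<Longrightarrow> u \<noteq> top \<Longrightarrow> V a \<noteq> V u"
    and inf_le_or: "le (inf a b) a \<or> le (inf a b) b"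
    and inf_lt: "\<not> le a (inf a b) \<Longrightarrow> inf a b = b"
    and V_inf: "le a b \<Longrightarrow> le b a \<Longrightarrow> a \<noteq> top \<Longrightarrow> b \<noteq> top \<Longrightarrow> V (inf a b) = (V a \<and> V b)"
begin

text \<open>The class of \<open>\<omega>\<close> may contain other types; \<open>\<omega>\<close> is separated from it, since the valuation is
  meaningless there.\<close>

definition below :: "'d \<Rightarrow> 'd set" where
  "below r = {a. a = top \<or> \<not> le r a}"

definition stratum :: "'d \<Rightarrow> 'd set" where
  "stratum r = {a. a \<noteq> top \<and> le a r \<and> le r a}"

definition positives :: "'d \<Rightarrow> 'd set" where
  "positives r = {a \<in> stratum r. V a}"

text \<open>The negative types which are the meet of a positive type and a lower one obstruct a direct
  least/greatest fixed point on the stratum, since the candidate of the former would be a greatest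
  and the one of the latter a least fixed point. They only depend positively on each other, so that
  they can be treated beforehand, as an additional stratum.\<close>

definition mixed :: "'d \<Rightarrow> 'd set" where
  "mixed r = {a \<in> stratum r. \<not> V a \<and> (\<exists>d\<in>positives r. \<exists>g\<in>below r. a = inf d g)}"

text \<open>A pair \<open>(u, top)\<close> in \<open>ext top\<close> may have \<open>u\<close>
  equivalent to \<open>top\<close> without being \<open>top\<close>. For \<open>r\<close> in the
  lowest class, \<open>below r\<close> is just \<open>{top}\<close>, which such a pair would prevent
  from being closed.\<close>

definition ext0 :: "'d \<Rightarrow> ('d \<times> 'd) set" where
  "ext0 a = (if a = top then {} else ext a)"

lemma represents_ext0: "represents ext0"
  using ext by (auto simp: represents_def ext0_def arrows_def)

lemma below_or_stratum: "le a r \<Longrightarrow> a \<in> below r \<or> a \<in> stratum r"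
  by (auto simp: below_def stratum_def)

lemma below_le: "a \<in> below r \<Longrightarrow> le a r"
  using le_total by (auto simp: below_def)

lemma below_down: "a \<in> below r \<Longrightarrow> le b a \<Longrightarrow> a \<noteq> top \<Longrightarrow> b \<in> below r"
  using le_trans by (auto simp: below_def)

lemma below_stratum_disjoint: "a \<in> below r \<Longrightarrow> a \<notin> stratum r"
  by (auto simp: below_def stratum_def)

lemma top_below [simp]: "top \<in> below r"
  by (simp add: below_def)

lemma inf_le_trans: "le a r \<Longrightarrow> le b r \<Longrightarrow> le (inf a b) r"
  using inf_le_or le_trans by blast

lemma inf_below: "a \<in> below r \<Longrightarrow> b \<in> below r \<Longrightarrow> inf a b \<in> below r"
  using inf_le_or[of a b] below_down by (cases "a = top"; cases "b = top") auto

text \<open>If the meet leaves the stratum of \<open>a\<close> downwards, the condition on strictly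
  smaller meets identifies it with \<open>b\<close>.\<close>

lemma inf_stratum_below:
  assumes a: "a \<in> stratum r" and b: "b \<in> below r"
  shows "inf a b \<in> stratum r \<or> inf a b = b"
proof (cases "le a (inf a b)")
  case True
  have "inf a b \<noteq> top" using a by (auto simp: stratum_def inf_eq_top_iff)
  moreover have "le r (inf a b)" using a True le_trans by (auto simp: stratum_def)
  moreover have "le (inf a b) r" using inf_le_trans a below_le[OF b] by (auto simp: stratum_def)
  ultimately show ?thesis by (simp add: stratum_def)
qed (use inf_lt in blast)

lemma inf_stratum: "a \<in> stratum r \<Longrightarrow> b \<in> stratum r \<Longrightarrow> inf a b \<in> stratum r"
  using inf_lt[of a b] inf_le_trans[of a r b] le_trans[of r a "inf a b"]
  by (cases "le a (inf a b)") (auto simp: stratum_def inf_eq_top_iff)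

lemma V_inf_stratum: "a \<in> stratum r \<Longrightarrow> b \<in> stratum r \<Longrightarrow> V (inf a b) = (V a \<and> V b)"
  using V_inf[of a b] le_trans by (auto simp: stratum_def)

text \<open>The case \<open>inf a b = a\<close> of the condition on polarities of meets: nothing
  negative lies above a positive type of the same stratum.\<close>

lemma V_mono: "a \<in> stratum r \<Longrightarrow> b \<in> stratum r \<Longrightarrow> a \<le> b \<Longrightarrow> V a \<Longrightarrow> V b"
  using V_inf_stratum[of a r b] by (simp add: inf_absorb1)

text \<open>A component of a lower meet is itself lower unless it is redundant.\<close>

lemma below_split: "inf x y \<in> below r \<Longrightarrow> x \<in> below r \<or> inf x y = y"
  using inf_lt[of x y] le_trans[of r x "inf x y"] by (auto simp: below_def inf_eq_top_iff)

lemma ext_stratum: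
  assumes "a \<in> stratum r" "(u, v) \<in> ext a"
  shows "u \<in> below r \<or> u \<in> stratum r \<and> V a \<noteq> V u" "v \<in> below r \<or> v \<in> stratum r \<and> V a = V v"
  using assms ext_le[OF assms(2)] ext_pos[OF assms(2)] ext_neg[OF assms(2)] le_trans
  unfolding below_def stratum_def by blast+

lemma ext_below: "a \<in> below r \<Longrightarrow> a \<noteq> top \<Longrightarrow> (u, v) \<in> ext a \<Longrightarrow> u \<in> below r \<and> v \<in> below r"
  using below_down ext_le by blast

lemma closed_under_ext0I:
  assumes "top \<in> U" "\<And>a b. a \<in> U \<Longrightarrow> b \<in> U \<Longrightarrow> inf a b \<in> U"
    and "\<And>a u v. a \<in> U \<Longrightarrow> a \<noteq> top \<Longrightarrow> (u, v) \<in> ext a \<Longrightarrow> u \<in> U \<and> v \<in> U"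
  shows "closed_under ext0 U"
proof -
  have "ext0 a \<subseteq> U \<times> U" if "a \<in> U" for a
    using assms(3)[OF that] by (cases "a = top") (auto simp: ext0_def)
  then show ?thesis using assms(1,2) by (simp add: closed_under_def)
qed

lemma closed_under_below: "closed_under ext0 (below r)"
proof (rule closed_under_ext0I)
  show "u \<in> below r \<and> v \<in> below r" if "a \<in> below r" "a \<noteq> top" "(u, v) \<in> ext a" for a u v
    using ext_below[OF that] .
qed (simp_all add: inf_below)

lemma closed_under_stratum: "closed_under ext0 (below r \<union> stratum r)"
proof (rule closed_under_ext0I)
  have le: "le a r" if "a \<in> below r \<union> stratum r" for a
    using that below_le[of a r] by (auto simp: stratum_def)
  show "inf a b \<in> below r \<union> stratum r"
    if "a \<in> below r \<union> stratum r" "b \<in> below r \<union> stratum r" for a b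
    using below_or_stratum[OF inf_le_trans[OF le[OF that(1)] le[OF that(2)]]] by simp
  show "u \<in> below r \<union> stratum r \<and> v \<in> below r \<union> stratum r"
    if "a \<in> below r \<union> stratum r" "(u, v) \<in> ext a" for a u v
  proof -
    have "le u r" "le v r" using ext_le[OF that(2)] le_trans[OF _ le[OF that(1)]] by blast+
    then show ?thesis using below_or_stratum[of u r] below_or_stratum[of v r] by simp
  qed
qed simp

text \<open>With the mixed type written as \<open>inf d g'\<close>, the new lower type joins
  \<open>g'\<close>; if the result stays in the stratum, \<open>V_mono\<close> keeps it
  negative.\<close>

lemma inf_mixed_below:
  assumes "a \<in> mixed r" "g \<in> below r"
  shows "inf a g \<in> below r \<union> mixed r"
proof -
  obtain d g' where d: "d \<in> positives r" "g' \<in> below r" "a = inf d g'" and a: "a \<in> stratum r" "\<not> V a"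
    using assms(1) by (auto simp: mixed_def)
  have "inf a g = inf d (inf g' g)" "inf g' g \<in> below r"
    using d assms(2) inf_below by (auto simp: inf.assoc)
  moreover have "inf a g \<in> stratum r \<Longrightarrow> \<not> V (inf a g)" using V_mono[of "inf a g" r a] a by auto
  ultimately show ?thesis
    using inf_stratum_below[OF a(1) assms(2)] assms(2) d(1) unfolding mixed_def by auto
qed

lemma inf_positives: "a \<in> positives r \<Longrightarrow> b \<in> positives r \<Longrightarrow> inf a b \<in> positives r"
  by (auto simp: positives_def inf_stratum V_inf_stratum)

lemma inf_positives_below:
  assumes "d \<in> positives r" "g \<in> below r"
  shows "inf d g \<in> below r \<union> mixed r \<union> positives r"
  using inf_stratum_below[of d r g] assms by (auto simp: positives_def mixed_def)

lemma inf_positives_mixed: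
  assumes d: "d \<in> positives r" and g: "g \<in> below r \<union> mixed r"
  shows "inf d g \<in> below r \<union> mixed r \<union> positives r"
proof (cases "g \<in> below r")
  case False
  then obtain d' g' where "d' \<in> positives r" "g' \<in> below r" "g = inf d' g'"
    using g by (auto simp: mixed_def)
  then show ?thesis
    using inf_positives_below[OF inf_positives[OF d]] by (simp add: inf.assoc[symmetric])
qed (use inf_positives_below[OF d] in blast)

lemma inf_mixed:
  assumes "a \<in> mixed r" "b \<in> mixed r"
  shows "inf a b \<in> mixed r"
proof -
  obtain d g d' g' where d: "d \<in> positives r" "g \<in> below r" "a = inf d g"
    "d' \<in> positives r" "g' \<in> below r" "b = inf d' g'"
    using assms by (auto simp: mixed_def)
  have "inf a b = inf (inf d d') (inf g g')" using d by (simp add: ac_simps)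
  moreover have "inf a b \<in> stratum r" "\<not> V (inf a b)"
    using assms inf_stratum V_inf_stratum by (auto simp: mixed_def)
  ultimately show ?thesis
    using inf_positives[OF d(1,4)] inf_below[OF d(2,5)] unfolding mixed_def by blast
qed

lemma inf_below_mixed: "a \<in> below r \<union> mixed r \<Longrightarrow> b \<in> below r \<union> mixed r \<Longrightarrow> inf a b \<in> below r \<union> mixed r"
  using inf_below[of a r b] inf_mixed[of a r b] inf_mixed_below[of a r b] inf_mixed_below[of b r a]
  by (auto simp: inf.commute)

lemma inf_below_mixed_positives:
  assumes "a \<in> below r \<union> mixed r \<union> positives r" "b \<in> below r \<union> mixed r \<union> positives r"
  shows "inf a b \<in> below r \<union> mixed r \<union> positives r"
  using assms inf_below_mixed[of a r b] inf_positives_mixed[of a r b] inf_positives_mixed[of b r a]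
    inf_positives[of a r b] by (auto simp: inf.commute)

lemma inf_below_negatives:
  assumes "a \<in> below r \<union> {a \<in> stratum r. \<not> V a}" "b \<in> below r \<union> {a \<in> stratum r. \<not> V a}"
  shows "inf a b \<in> below r \<union> {a \<in> stratum r. \<not> V a}"
proof -
  have *: "inf a b \<in> below r \<union> {a \<in> stratum r. \<not> V a}" if "a \<in> stratum r" "\<not> V a" "b \<in> below r" for a b
    using inf_stratum_below[OF that(1,3)] that V_mono[of "inf a b" r a] by auto
  show ?thesis
    using assms *[of a b] *[of b a] inf_below[of a r b] inf_stratum[of a r b] V_inf_stratum[of a r b]
    by (auto simp: inf.commute)
qed

text \<open>Let \<open>a = inf d g\<close> be mixed. A pair \<open>(x, y)\<close> in the extension of \<open>a\<close> with \<open>x\<close> in the stratum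
  has a positive \<open>x\<close>, which cannot be below the left component of a pair in \<open>ext d\<close> unless
  that component is lower. Hence the pairs whose left component is lower suffice.\<close>

lemma mixed_representation:
  assumes a: "a \<in> mixed r"
  shows "\<exists>S. finite S \<and> a = meet (arrows S) \<and> S \<subseteq> below r \<times> (below r \<union> mixed r)"
proof -
  obtain d g where d: "d \<in> stratum r" "V d" and g: "g \<in> below r" and adg: "a = inf d g"
    using a by (auto simp: mixed_def positives_def)
  have as: "a \<in> stratum r" "\<not> V a" using a by (auto simp: mixed_def)
  have "g \<noteq> top" using d as adg by auto
  define X where "X = below r \<inter> fst ` (ext a \<union> ext d \<union> ext g)"
  \<comment> \<open>One arrow for each lower left component \<open>x\<close> occurring in any of the
    three extensions; its right component is the application of \<open>a\<close> to
    \<open>x\<close>, hence the strongest result available.\<close>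
  define S where "S = (\<lambda>x. (x, meet (results (ext a) x))) ` X"
  have fin: "finite (ext x)" for x using ext by (rule represents_finite)
  then have finS: "finite S" by (simp add: S_def X_def)
  have dg: "w \<in> results (ext d \<union> ext g) x \<Longrightarrow> a \<le> arr x w" for w x
  proof -
    assume "w \<in> results (ext d \<union> ext g) x"
    then obtain u where "x \<le> u" "(u, w) \<in> ext d \<or> (u, w) \<in> ext g" by (auto simp: results_def)
    moreover from this have "a \<le> arr u w"
      using represents_mem[OF ext, of u w] le_infI1[of d _ g] le_infI2[of g _ d] adg by blast
    ultimately show ?thesis using arr_mono[of x u w w] order.trans by blast
  qed
  \<comment> \<open>The application of \<open>a\<close> can be computed from \<open>ext a\<close> or
    from \<open>ext d\<close> and \<open>ext g\<close> together. Comparing the two descriptions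
    drives the rest of the proof.\<close>
  have app_a: "meet (results (ext a) x) = meet (results (ext d \<union> ext g) x)" for x
  proof (rule order.antisym)
    have "a \<le> arr x (meet (results (ext a) x))" by (simp add: represents_le[OF ext])
    then show "meet (results (ext d \<union> ext g) x) \<le> meet (results (ext a) x)"
      using represents_inf[OF ext] adg by blast
    show "meet (results (ext a) x) \<le> meet (results (ext d \<union> ext g) x)"
      using dg fin by (simp add: le_meet_iff represents_le[OF ext])
  qed
  have le: "meet (arrows S) \<le> arr x y" if xy: "(x, y) \<in> ext a" for x y
  proof (cases "x \<in> below r")
    case True
    then have "(x, meet (results (ext a) x)) \<in> S" using xy by (force simp: S_def X_def)
    then have "meet (arrows S) \<le> arr x (meet (results (ext a) x))"
      using finS by (intro meet_lower finite_arrows) (auto simp: arrows_def)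
    also have "\<dots> \<le> arr x y"
      using xy fin by (intro arr_mono meet_lower finite_results) (auto simp: results_def)
    finally show ?thesis .
  next
    case False
    then have x: "x \<in> stratum r" "V x" using ext_stratum[OF as(1) xy] as(2) by auto
    have "meet (results S x) \<le> w" if w: "w \<in> results (ext d \<union> ext g) x" for w
    proof -
      obtain u where u: "(u, w) \<in> ext d \<union> ext g" "x \<le> u" using w by (auto simp: results_def)
      have "u \<in> below r"
      proof (cases "(u, w) \<in> ext g")
        case True
        then show ?thesis using ext_below[OF g \<open>g \<noteq> top\<close>] by blast
      next
        case False
        then have "u \<in> below r \<or> u \<in> stratum r \<and> \<not> V u" using ext_stratum(1)[OF d(1)] u(1) d(2) by blast
        then show ?thesis using V_mono[OF x(1) _ u(2) x(2)] by blast
      qed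
      then have "(u, meet (results (ext a) u)) \<in> S" using u(1) by (force simp: S_def X_def)
      then have "meet (results S x) \<le> meet (results (ext a) u)"
        using finS u(2) by (intro meet_lower finite_results) (auto simp: results_def)
      also have "\<dots> \<le> w"
        unfolding app_a using u(1) fin by (intro meet_lower finite_results) (auto simp: results_def)
      finally show ?thesis .
    qed
    then have "meet (results S x) \<le> meet (results (ext d \<union> ext g) x)" using fin by (simp add: le_meet_iff)
    also have "\<dots> \<le> y" using represents_inf[OF ext] represents_mem[OF ext xy] adg by blast
    finally show ?thesis using meet_arrows_le[OF finS] by blast
  qed
  have "meet (arrows S) = a"
  proof (rule order.antisym)
    show "meet (arrows S) \<le> a" using le by (subst represents_le_iff[OF ext]) blast
    have "a \<le> arr x (meet (results (ext a) x))" for x by (simp add: represents_le[OF ext])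
    then show "a \<le> meet (arrows S)" using finS by (simp add: le_meet_iff) (auto simp: arrows_def S_def)
  qed
  \<comment> \<open>Computed from \<open>ext a\<close>, the result is lower or negative; computed
    from \<open>ext d\<close> and \<open>ext g\<close>, it is lower, mixed or positive. Only lower
    and mixed remain.\<close>
  moreover have "meet (results (ext a) x) \<in> below r \<union> mixed r" for x
  proof -
    have "results (ext a) x \<subseteq> below r \<union> {a \<in> stratum r. \<not> V a}"
      using ext_stratum(2)[OF as(1)] as(2) unfolding results_def by blast
    then have "meet (results (ext a) x) \<in> below r \<union> {a \<in> stratum r. \<not> V a}"
      using finite_results[OF fin] inf_below_negatives top_below by (intro meet_closed) blast+
    moreover have "results (ext d \<union> ext g) x \<subseteq> below r \<union> mixed r \<union> positives r"
      using ext_stratum(2)[OF d(1)] d(2) ext_below[OF g \<open>g \<noteq> top\<close>]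
      unfolding results_def positives_def by blast
    then have "meet (results (ext d \<union> ext g) x) \<in> below r \<union> mixed r \<union> positives r"
      using finite_results[of "ext d \<union> ext g"] fin inf_below_mixed_positives top_below
      by (intro meet_closed) auto
    ultimately show ?thesis using below_stratum_disjoint unfolding app_a positives_def by blast
  qed
  then have "S \<subseteq> below r \<times> (below r \<union> mixed r)" by (auto simp: S_def X_def)
  ultimately show ?thesis using finS by blast
qed

definition ext1 :: "'d \<Rightarrow> 'd \<Rightarrow> ('d \<times> 'd) set" where
  "ext1 r a = (if a \<in> mixed r
     then SOME S. finite S \<and> a = meet (arrows S) \<and> S \<subseteq> below r \<times> (below r \<union> mixed r)
     else ext0 a)"

lemma ext1_mixed:
  assumes "a \<in> mixed r"
  shows "finite (ext1 r a) \<and> a = meet (arrows (ext1 r a)) \<and> ext1 r a \<subseteq> below r \<times> (below r \<union> mixed r)"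
proof -
  have "ext1 r a = (SOME S. finite S \<and> a = meet (arrows S) \<and> S \<subseteq> below r \<times> (below r \<union> mixed r))"
    using assms by (simp add: ext1_def)
  then show ?thesis using someI_ex[OF mixed_representation[OF assms]] by simp
qed

lemma represents_ext1: "represents (ext1 r)"
  unfolding represents_def
proof
  show "finite (ext1 r a) \<and> a = meet (arrows (ext1 r a))" for a
    using represents_ext0 ext1_mixed[of a r] by (cases "a \<in> mixed r") (auto simp: represents_def ext1_def)
qed

lemma mixed_stratum: "mixed r \<subseteq> stratum r"
  by (auto simp: mixed_def)

lemma closed_under_ext1:
  assumes "below r \<subseteq> U" "mixed r \<inter> U = {} \<or> mixed r \<subseteq> U" "closed_under ext0 U"
  shows "closed_under (ext1 r) U"
proof -
  have "ext1 r a \<subseteq> U \<times> U" if "a \<in> U" for a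
  proof (cases "a \<in> mixed r")
    case True
    then show ?thesis using ext1_mixed[OF True] assms(1,2) that by blast
  qed (use assms(3) that in \<open>auto simp: closed_under_def ext1_def\<close>)
  then show ?thesis using assms(3) by (simp add: closed_under_def)
qed

text \<open>Distributivity writes \<open>w\<close> as \<open>inf x y\<close>. If \<open>x\<close> is
  not lower then \<open>w = y\<close> by \<open>below_split\<close>, and \<open>x\<close> may be
  replaced by \<open>top\<close>; the same holds with \<open>x\<close> and \<open>y\<close>
  exchanged.\<close>

lemma below_decompose:
  assumes "inf p q \<le> w" "w \<in> below r"
  shows "\<exists>x\<in>below r. \<exists>y\<in>below r. w = inf x y \<and> p \<le> x \<and> q \<le> y"
proof -
  obtain x y where xy: "p \<le> x" "q \<le> y" "w = inf x y"
    using distributive assms(1) unfolding distributive_def by blast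
  have "x \<in> below r \<or> w = y" "y \<in> below r \<or> w = x"
    using below_split[of x y r] below_split[of y x r] xy assms(2) by (auto simp: inf.commute)
  then show ?thesis
    using xy assms(2) top_below[of r] inf_top_left[of w] inf_top_right[of w] top_greatest by metis
qed

text \<open>Two applications of \<open>solves_extend\<close>. In the first the mixed types, although
  negative, play the role of \<open>Ct\<close> and \<open>Cf\<close> is empty: under
  \<open>ext1\<close> they occur in one another only to the right of an arrow, so no conflict of
  polarities arises. The second adds the positive and the remaining negative types.\<close>

lemma solves_stratum:
  assumes X: "solves ext0 (below r) X"
  shows "\<exists>Y. solves ext0 (below r \<union> stratum r) Y \<and> (\<forall>a\<in>below r. Y a = X a)"
proof -
  let ?M = "mixed r" and ?T = "positives r" and ?F = "{a \<in> stratum r. \<not> V a} - mixed r"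
  have W: "below r \<union> ?M \<union> ?T \<union> ?F = below r \<union> stratum r"
    using mixed_stratum by (auto simp: positives_def)
  have dist: "inf (inf a g) (inf b g) = inf (inf a b) g" for a b g :: 'd
    by (simp add: inf_left_commute inf.assoc inf.commute)
  have cl0: "closed_under (ext1 r) (below r)"
    using closed_under_below mixed_stratum below_stratum_disjoint by (intro closed_under_ext1) blast+
  have clM: "closed_under (ext1 r) (below r \<union> ?M)"
    using inf_below_mixed ext1_mixed cl0 unfolding closed_under_def by (blast intro: subset_trans)
  have clW: "closed_under (ext1 r) (below r \<union> stratum r)"
    using closed_under_stratum mixed_stratum by (intro closed_under_ext1) auto
  have "solves (ext1 r) (below r) X"
    using solves_change[OF represents_ext0 closed_under_below represents_ext1 cl0 X] .
  then have "\<exists>Y. solves (ext1 r) (below r \<union> ?M \<union> {}) Y \<and> (\<forall>a\<in>below r. Y a = X a)"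
  proof (rule solves_extend[OF represents_ext1 _ cl0])
    show "below r \<inter> (?M \<union> {}) = {}" using below_stratum_disjoint mixed_stratum by blast
    show "closed_under (ext1 r) (below r \<union> ?M \<union> {})" using clM by simp
    show "inf a g \<in> below r \<or> inf b g \<in> below r \<or>
      (\<exists>x\<in>below r. \<exists>y\<in>below r. w = inf x y \<and> inf a g \<le> x \<and> inf b g \<le> y)"
      if "w \<in> below r" "inf (inf a b) g \<le> w" for a b g w
      using below_decompose[of "inf a g" "inf b g" w r] that unfolding dist by blast
    show "u \<notin> ?M \<and> v \<notin> {}" if "a \<in> ?M" "(u, v) \<in> ext1 r a" for a u v
      using ext1_mixed[OF that(1)] that(2) mixed_stratum below_stratum_disjoint by blast
  qed auto
  then obtain Y where Y: "solves (ext1 r) (below r \<union> ?M) Y" "\<forall>a\<in>below r. Y a = X a" by auto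
  have "\<exists>Z. solves (ext1 r) (below r \<union> ?M \<union> ?T \<union> ?F) Z \<and> (\<forall>a\<in>below r \<union> ?M. Z a = Y a)"
  proof (rule solves_extend[OF represents_ext1 Y(1) clM])
    show "(below r \<union> ?M) \<inter> (?T \<union> ?F) = {}"
      using below_stratum_disjoint by (auto simp: positives_def mixed_def)
    show "?T \<inter> ?F = {}" by (auto simp: positives_def)
    show "closed_under (ext1 r) (below r \<union> ?M \<union> ?T \<union> ?F)" using clW W by simp
    \<comment> \<open>The meet is not positive, being below a negative type of the stratum. If it is
      not lower, then it is mixed: this is the obstruction that forces the mixed types into the
      base.\<close>
    show "inf a b \<in> below r \<union> ?M" if "a \<in> ?T" "b \<in> below r \<union> ?M" "c \<in> ?F" "inf a b \<le> c" for a b c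
      using inf_positives_mixed[OF that(1,2)] V_mono[of "inf a b" r c] that(3,4)
      by (auto simp: positives_def)
    show "\<not> inf a b \<le> c" if "a \<in> ?T" "b \<in> ?T" "c \<in> ?F" for a b c
      using inf_positives[OF that(1,2)] V_mono[of "inf a b" r c] that(3) by (auto simp: positives_def)
    show "inf a g \<in> below r \<union> ?M \<or> inf b g \<in> below r \<union> ?M \<or>
      (\<exists>x\<in>below r \<union> ?M. \<exists>y\<in>below r \<union> ?M. w = inf x y \<and> inf a g \<le> x \<and> inf b g \<le> y)"
      if ab: "a \<in> ?T" "b \<in> ?T" and gw: "g \<in> below r \<union> ?M" "w \<in> below r \<union> ?M" and le: "inf (inf a b) g \<le> w"
      for a b g w
    proof (cases "w \<in> below r")
      case True
      then show ?thesis using below_decompose[of "inf a g" "inf b g" w r] le unfolding dist by blast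
    next
      case False
      then have "w \<in> stratum r" "\<not> V w" using gw by (auto simp: mixed_def)
      \<comment> \<open>A mixed \<open>w\<close> is negative, hence not above a positive type. Since
        positive types are closed under meets, one of \<open>inf a g\<close> and
        \<open>inf b g\<close> has left them and lies in the base.\<close>
      then have "inf (inf a g) (inf b g) \<notin> ?T"
        using V_mono[of "inf (inf a g) (inf b g)" r w] le unfolding dist by (auto simp: positives_def)
      then show ?thesis
        using inf_positives_mixed[OF ab(1) gw(1)] inf_positives_mixed[OF ab(2) gw(1)] inf_positives by blast
    qed
    show "u \<notin> ?T \<and> v \<notin> ?F" if "a \<in> ?T" "(u, v) \<in> ext1 r a" for a u v
    proof -
      have "a \<in> stratum r" "V a" "(u, v) \<in> ext a"
        using that by (auto simp: positives_def ext1_def ext0_def mixed_def split: if_splits)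
      then show ?thesis using ext_stratum[of a r u v] below_stratum_disjoint by (auto simp: positives_def)
    qed
    show "u \<notin> ?F \<and> v \<notin> ?T" if "a \<in> ?F" "(u, v) \<in> ext1 r a" for a u v
    proof -
      have "a \<in> stratum r" "\<not> V a" "(u, v) \<in> ext a"
        using that by (auto simp: ext1_def ext0_def split: if_splits)
      then show ?thesis using ext_stratum[of a r u v] below_stratum_disjoint by (auto simp: positives_def)
    qed
  qed
  then obtain Z where Z: "solves (ext1 r) (below r \<union> stratum r) Z" "\<forall>a\<in>below r \<union> ?M. Z a = Y a"
    unfolding W by blast
  have "solves ext0 (below r \<union> stratum r) Z"
    using solves_change[OF represents_ext1 clW represents_ext0 closed_under_stratum Z(1)] .
  moreover have "\<forall>a\<in>below r. Z a = X a" using Z(2) Y(2) by simp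
  ultimately show ?thesis by blast
qed

text \<open>\<open>top\<close> is the one member of \<open>below r\<close> that need not be strictly
  smaller than \<open>r\<close>, since \<open>r\<close> may be equivalent to it; its candidate is
  therefore supplied explicitly instead of being taken from the recursion.\<close>

definition strata_step :: "('d \<Rightarrow> 't set) \<Rightarrow> 'd \<Rightarrow> 't set" where
  "strata_step f r = (if r = top then UNIV
     else (SOME Y. solves ext0 (below r \<union> stratum r) Y \<and>
       (\<forall>a\<in>below r. Y a = (if a = top then UNIV else f a))) r)"

definition candidate :: "'d \<Rightarrow> 't set" where
  "candidate = wfrec {(a, b). le a b \<and> \<not> le b a} strata_step"

lemma candidate_top: "candidate top = UNIV"
  unfolding candidate_def
  by (subst wfrec) (use wf_lt in \<open>auto simp: strata_step_def wfp_def\<close>)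

lemma candidate_eq:
  assumes "r \<noteq> top"
  shows "candidate r = (SOME Y. solves ext0 (below r \<union> stratum r) Y \<and> (\<forall>a\<in>below r. Y a = candidate a)) r"
proof -
  let ?R = "{(a, b). le a b \<and> \<not> le b a}"
  have wf: "wf ?R" using wf_lt by (simp add: wfp_def)
  have "(if a = top then UNIV else cut candidate ?R r a) = candidate a" if "a \<in> below r" for a
    using that below_le[OF that] candidate_top by (auto simp: cut_def below_def)
  then have "solves ext0 (below r \<union> stratum r) Y \<and>
       (\<forall>a\<in>below r. Y a = (if a = top then UNIV else cut candidate ?R r a)) \<longleftrightarrow>
     solves ext0 (below r \<union> stratum r) Y \<and> (\<forall>a\<in>below r. Y a = candidate a)" for Y
    by simp
  then have "strata_step (cut candidate ?R r) r =
    (SOME Y. solves ext0 (below r \<union> stratum r) Y \<and> (\<forall>a\<in>below r. Y a = candidate a)) r"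
    using assms unfolding strata_step_def by simp
  then show ?thesis
    using wfrec[OF wf, of strata_step r] unfolding candidate_def by simp
qed

text \<open>Equivalent types see the same set in the choice made by \<open>candidate_eq\<close>, so
  all of them use one and the same solution on their stratum.\<close>

lemma stratum_eq:
  assumes "a \<in> stratum r"
  shows "stratum a = stratum r" "below a = below r"
  using assms le_trans unfolding stratum_def below_def by blast+

text \<open>Each condition on meets mentions at most three types, so it is enough that any three
  share a solved set. The triple made of \<open>top\<close> alone is treated directly, since it
  singles out no stratum.\<close>

lemma solves_directed:
  assumes dir: "\<And>a b c. a \<in> U \<Longrightarrow> b \<in> U \<Longrightarrow> c \<in> U \<Longrightarrow> \<not> (a = top \<and> b = top \<and> c = top) \<Longrightarrow>
    \<exists>W. solves ext0 W candidate \<and> a \<in> W \<and> b \<in> W \<and> c \<in> W"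
  shows "solves ext0 U candidate"
proof -
  have *: "\<exists>W. solves ext0 W candidate \<and> a \<in> W" if "a \<in> U" "a \<noteq> top" for a
    using dir[of a a a] that by blast
  have "M \<in> candidate c" if abc: "a \<in> U" "b \<in> U" "c \<in> U" "inf a b \<le> c"
    and M: "M \<in> candidate a" "M \<in> candidate b" for a b c M
  proof (cases "a = top \<and> b = top \<and> c = top")
    case False
    then show ?thesis using dir[OF abc(1-3)] abc(4) M family_inf unfolding solves_def by blast
  qed (use candidate_top in auto)
  moreover have "Sp a \<inter> Neut \<subseteq> candidate a \<and> candidate a \<subseteq> Sp a" if "a \<in> U" for a
  proof (cases "a = top")
    case False
    then show ?thesis using *[OF that] family_lower family_upper unfolding solves_def by blast
  qed (simp add: candidate_top Sp_top)
  moreover have "M \<in> candidate a \<longleftrightarrow> M' \<in> candidate a" if aU: "a \<in> U" and st: "step M M'" for a M M'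
  proof (cases "a = top")
    case False
    then obtain W where W: "family W candidate" "a \<in> W" using *[OF aU] by (auto simp: solves_def)
    show ?thesis using family_step[OF W st] .
  qed (simp add: candidate_top)
  ultimately have "family U candidate"
    unfolding family_def using candidate_top by blast
  moreover have "candidate a = unfold_arrows ext0 candidate a" if "a \<in> U" for a
  proof (cases "a = top")
    case False
    then show ?thesis using *[OF that] by (auto simp: solves_def)
  qed (simp add: candidate_top unfold_arrows_def ext0_def)
  ultimately show ?thesis by (simp add: solves_def)
qed

lemma max_of_three:
  assumes "\<not> (a = top \<and> b = top \<and> c = top)"
  shows "\<exists>m\<in>{a, b, c}. m \<noteq> top \<and> le a m \<and> le b m \<and> le c m"
  using assms le_total le_trans le_top by (smt (verit) insertCI)

lemma solves_up_to: "r \<noteq> top \<Longrightarrow> solves ext0 (below r \<union> stratum r) candidate"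
proof (induction r rule: wfp_induct_rule[OF wf_lt])
  case (1 r)
  let ?P = "\<lambda>Y. solves ext0 (below r \<union> stratum r) Y \<and> (\<forall>a\<in>below r. Y a = candidate a)"
  have "solves ext0 (below r) candidate"
  proof (rule solves_directed)
    fix a b c assume abc: "a \<in> below r" "b \<in> below r" "c \<in> below r" "\<not> (a = top \<and> b = top \<and> c = top)"
    then obtain m where m: "m \<in> below r" "m \<noteq> top" "le a m" "le b m" "le c m"
      using max_of_three[of a b c] by blast
    then have "solves ext0 (below m \<union> stratum m) candidate"
      using 1 below_le[OF m(1)] by (auto simp: below_def)
    then show "\<exists>W. solves ext0 W candidate \<and> a \<in> W \<and> b \<in> W \<and> c \<in> W"
      using m below_or_stratum by blast
  qed
  define Y where "Y = (SOME Y. ?P Y)"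
  have Y: "?P Y"
    unfolding Y_def using solves_stratum[OF \<open>solves ext0 (below r) candidate\<close>] by (rule someI_ex)
  have "Y a = candidate a" if "a \<in> below r \<union> stratum r" for a
  proof (cases "a \<in> below r")
    case False
    then have a: "a \<in> stratum r" using that by blast
    then have "a \<noteq> top" by (simp add: stratum_def)
    show ?thesis by (subst candidate_eq[OF \<open>a \<noteq> top\<close>]) (simp only: stratum_eq[OF a] Y_def)
  qed (use Y in blast)
  then show ?case using solves_cong[OF _ closed_under_stratum] Y by blast
qed

lemma candidate_solves: "solves ext UNIV candidate"
proof -
  have "solves ext0 UNIV candidate"
  proof (rule solves_directed)
    fix a b c :: 'd assume "\<not> (a = top \<and> b = top \<and> c = top)"
    then obtain m where "m \<noteq> top" "le a m" "le b m" "le c m"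
      using max_of_three[of a b c] by blast
    then show "\<exists>W. solves ext0 W candidate \<and> a \<in> W \<and> b \<in> W \<and> c \<in> W"
      using solves_up_to[of m] below_or_stratum by blast
  qed
  then show ?thesis
    using solves_change[OF represents_ext0 _ ext] by (simp add: closed_under_def)
qed

end

section \<open>Simultaneous induction on terms and tests\<close>

lemma tm_test_induct [case_names Var Lam App TSum QSum QProd Tau]:
  assumes "\<And>i. P (Var i)"
    and "\<And>M. P M \<Longrightarrow> P (Lam M)"
    and "\<And>M N. P M \<Longrightarrow> P N \<Longrightarrow> P (App M N)"
    and "\<And>ps. (\<And>\<alpha> Q. (\<alpha>, Q) \<in> set ps \<Longrightarrow> R Q) \<Longrightarrow> P (TSum ps)"
    and "\<And>Qs. (\<And>Q. Q \<in> set Qs \<Longrightarrow> R Q) \<Longrightarrow> R (QSum Qs)"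
    and "\<And>Qs. (\<And>Q. Q \<in> set Qs \<Longrightarrow> R Q) \<Longrightarrow> R (QProd Qs)"
    and "\<And>\<alpha> M. P M \<Longrightarrow> R (Tau \<alpha> M)"
  shows "P (M :: 'd tm)" "R (Q :: 'd test)"
proof (induction M and Q)
  case (TSum ps)
  then show ?case by (intro assms(4)) (metis snds.intros snd_conv)
qed (use assms in blast)+

lemma tm_in_TSum [simp]: "tm_in n (TSum ps) \<longleftrightarrow> (\<forall>(\<alpha>, Q) \<in> set ps. \<alpha> \<noteq> top \<and> test_in n Q)"
  by (fastforce simp: case_prod_beta)

declare tm_in.simps(4) [simp del]

section \<open>Parallel substitution\<close>

definition up :: "(nat \<Rightarrow> 'd tm) \<Rightarrow> nat \<Rightarrow> 'd tm" where
  "up \<sigma> = case_nat (Var 0) (\<lambda>i. lift 0 (\<sigma> i))"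

lemma up_simps [simp]: "up \<sigma> 0 = Var 0" "up \<sigma> (Suc i) = lift 0 (\<sigma> i)"
  by (simp_all add: up_def)

primrec psubst :: "(nat \<Rightarrow> 'd tm) \<Rightarrow> 'd tm \<Rightarrow> 'd tm"
  and psubst_test :: "(nat \<Rightarrow> 'd tm) \<Rightarrow> 'd test \<Rightarrow> 'd test" where
  "psubst \<sigma> (Var i) = \<sigma> i"
| "psubst \<sigma> (Lam M) = Lam (psubst (up \<sigma>) M)"
| "psubst \<sigma> (App M N) = App (psubst \<sigma> M) (psubst \<sigma> N)"
| "psubst \<sigma> (TSum ps) = TSum (map (map_prod id (\<lambda>Q. psubst_test \<sigma> Q)) ps)"
| "psubst_test \<sigma> (QSum Qs) = QSum (map (\<lambda>Q. psubst_test \<sigma> Q) Qs)"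
| "psubst_test \<sigma> (QProd Qs) = QProd (map (\<lambda>Q. psubst_test \<sigma> Q) Qs)"
| "psubst_test \<sigma> (Tau \<alpha> M) = Tau \<alpha> (psubst \<sigma> M)"

abbreviation rename :: "(nat \<Rightarrow> nat) \<Rightarrow> 'd tm \<Rightarrow> 'd tm" where
  "rename \<xi> \<equiv> psubst (\<lambda>i. Var (\<xi> i))"

definition up_ren :: "(nat \<Rightarrow> nat) \<Rightarrow> nat \<Rightarrow> nat" where
  "up_ren \<xi> = case_nat 0 (\<lambda>i. Suc (\<xi> i))"

lemma up_ren_simps [simp]: "up_ren \<xi> 0 = 0" "up_ren \<xi> (Suc i) = Suc (\<xi> i)"
  by (simp_all add: up_ren_def)

lemma up_rename: "up (\<lambda>i. Var (\<xi> i)) = (\<lambda>i. Var (up_ren \<xi> i))"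
  by (rule HOL.ext) (simp add: up_def up_ren_def split: nat.split)

lemma lift_rename:
  fixes M :: "'d tm" and Q :: "'d test"
  shows   "lift k M = rename (\<lambda>i. if i < k then i else Suc i) M"
  "lift_test k Q = psubst_test (\<lambda>i. Var (if i < k then i else Suc i)) Q"
proof (induction M and Q arbitrary: k and k rule: tm_test_induct)
  case (Lam M)
  have "up_ren (\<lambda>i. if i < k then i else Suc i) = (\<lambda>i. if i < Suc k then i else Suc i)"
    by (rule HOL.ext) (simp add: up_ren_def split: nat.split)
  then show ?case using Lam by (simp add: up_rename)
qed (auto simp: id_def)

lemma psubst_rename:
  fixes M :: "'d tm" and Q :: "'d test"
  shows   "psubst \<sigma> (rename \<xi> M) = psubst (\<lambda>i. \<sigma> (\<xi> i)) M"
  "psubst_test \<sigma> (psubst_test (\<lambda>i. Var (\<xi> i)) Q) = psubst_test (\<lambda>i. \<sigma> (\<xi> i)) Q"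
proof (induction M and Q arbitrary: \<sigma> \<xi> and \<sigma> \<xi> rule: tm_test_induct)
  case (Lam M)
  have "(\<lambda>i. up \<sigma> (up_ren \<xi> i)) = up (\<lambda>i. \<sigma> (\<xi> i))"
    by (rule HOL.ext) (simp add: up_def up_ren_def split: nat.split)
  then show ?case using Lam by (simp add: up_rename)
qed auto

lemma lift_0: "lift 0 M = rename Suc M"
  by (simp add: lift_rename)

lemma rename_psubst:
  fixes M :: "'d tm" and Q :: "'d test"
  shows   "rename \<xi> (psubst \<sigma> M) = psubst (\<lambda>i. rename \<xi> (\<sigma> i)) M"
  "psubst_test (\<lambda>i. Var (\<xi> i)) (psubst_test \<sigma> Q) = psubst_test (\<lambda>i. rename \<xi> (\<sigma> i)) Q"
proof (induction M and Q arbitrary: \<sigma> \<xi> and \<sigma> \<xi> rule: tm_test_induct)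
  case (Lam M)
  have "(\<lambda>i. rename (up_ren \<xi>) (up \<sigma> i)) = up (\<lambda>i. rename \<xi> (\<sigma> i))"
    by (rule HOL.ext) (simp add: up_def lift_0 psubst_rename split: nat.split)
  then show ?case using Lam by (simp add: up_rename)
qed auto

lemma psubst_psubst:
  fixes M :: "'d tm" and Q :: "'d test"
  shows   "psubst \<tau> (psubst \<sigma> M) = psubst (\<lambda>i. psubst \<tau> (\<sigma> i)) M"
  "psubst_test \<tau> (psubst_test \<sigma> Q) = psubst_test (\<lambda>i. psubst \<tau> (\<sigma> i)) Q"
proof (induction M and Q arbitrary: \<sigma> \<tau> and \<sigma> \<tau> rule: tm_test_induct)
  case (Lam M)
  have "(\<lambda>i. psubst (up \<tau>) (up \<sigma> i)) = up (\<lambda>i. psubst \<tau> (\<sigma> i))"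
    by (rule HOL.ext) (simp add: up_def lift_0 psubst_rename rename_psubst split: nat.split)
  then show ?case using Lam by simp
qed auto

lemma psubst_Var:
  fixes M :: "'d tm" and Q :: "'d test"
  shows "psubst Var M = M" "psubst_test Var Q = Q"
proof (induction M and Q rule: tm_test_induct)
  case (Lam M)
  have "up Var i = (Var i :: 'd tm)" for i by (cases i) auto
  then have "up Var = (Var :: nat \<Rightarrow> 'd tm)" by (rule HOL.ext)
  then show ?case using Lam by simp
next
  case (TSum ps)
  then have "map (map_prod id (psubst_test Var)) ps = map id ps" by (intro map_cong) auto
  then show ?case by simp
qed (auto simp: map_idI)

lemma subst_psubst:
  fixes M :: "'d tm" and Q :: "'d test"
  shows   "subst k N M = psubst (\<lambda>i. if i < k then Var i else if i = k then N else Var (i - 1)) M"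
  "subst_test k N Q = psubst_test (\<lambda>i. if i < k then Var i else if i = k then N else Var (i - 1)) Q"
proof (induction M and Q arbitrary: k N and k N rule: tm_test_induct)
  case (Lam M)
  have "up (\<lambda>i. if i < k then Var i else if i = k then N else Var (i - 1)) =
    (\<lambda>i. if i < Suc k then Var i else if i = Suc k then lift 0 N else Var (i - 1))"
    by (rule HOL.ext) (auto simp: up_def split: nat.split)
  then show ?case using Lam by simp
qed auto

lemma subst_0: "subst 0 N M = psubst (case_nat N Var) M"
proof -
  have "(\<lambda>i. if i < 0 then Var i else if i = 0 then N else Var (i - 1)) = case_nat N Var"
    by (rule HOL.ext) (simp split: nat.split)
  then show ?thesis using subst_psubst(1)[of 0 N M] by simp
qed

text \<open>Contracting an instantiated abstraction is again a parallel instance, with one more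
  entry; the abstraction case of the fundamental lemma and the extraction of approximants rest on
  this.\<close>

lemma subst_up: "subst 0 N (psubst (up \<sigma>) M) = psubst (case_nat N \<sigma>) M"
proof -
  have "(\<lambda>i. psubst (case_nat N Var) (up \<sigma> i)) = case_nat N \<sigma>"
    by (rule HOL.ext) (simp add: up_def lift_0 psubst_rename psubst_Var split: nat.split)
  then show ?thesis by (simp add: subst_0 psubst_psubst)
qed

lemma psubst_subst: "psubst \<sigma> (subst 0 N M) = subst 0 (psubst \<sigma> N) (psubst (up \<sigma>) M)"
proof -
  have "(\<lambda>i. psubst \<sigma> (case_nat N Var i)) = case_nat (psubst \<sigma> N) \<sigma>"
    by (rule HOL.ext) (simp split: nat.split)
  then show ?thesis unfolding subst_up by (simp add: subst_0 psubst_psubst)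
qed

lemma tm_in_psubst:
  fixes M :: "'d::bounded_semilattice_inf_top tm" and Q :: "'d test"
  shows   "tm_in m M \<Longrightarrow> (\<And>i. i < m \<Longrightarrow> tm_in n (\<sigma> i)) \<Longrightarrow> tm_in n (psubst \<sigma> M)"
  "test_in m Q \<Longrightarrow> (\<And>i. i < m \<Longrightarrow> tm_in n (\<sigma> i)) \<Longrightarrow> test_in n (psubst_test \<sigma> Q)"
proof -
  \<comment> \<open>Renamings come first because \<open>up\<close> applies one to the substituted
    terms.\<close>
  have ren: "tm_in m M \<Longrightarrow> (\<And>i. i < m \<Longrightarrow> \<xi> i < n) \<Longrightarrow> tm_in n (rename \<xi> M)"
    "test_in m Q \<Longrightarrow> (\<And>i. i < m \<Longrightarrow> \<xi> i < n) \<Longrightarrow> test_in n (psubst_test (\<lambda>i. Var (\<xi> i)) Q)"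
    for \<xi> m n and M :: "'d tm" and Q :: "'d test"
  proof (induction M and Q arbitrary: m n \<xi> and m n \<xi> rule: tm_test_induct)
    case (Lam M)
    have "up_ren \<xi> i < Suc n" if "i < Suc m" for i using that Lam.prems(2) by (cases i) auto
    then show ?case using Lam.IH[of "Suc m" "up_ren \<xi>" "Suc n"] Lam.prems(1) by (simp add: up_rename)
  next
    case (TSum ps)
    have "test_in n (psubst_test (\<lambda>i. Var (\<xi> i)) Q)" if "(\<alpha>, Q) \<in> set ps" for \<alpha> Q
      using TSum.IH[OF that] TSum.prems that by fastforce
    then show ?case using TSum.prems(1) by fastforce
  qed (auto split: prod.splits)
  show "tm_in m M \<Longrightarrow> (\<And>i. i < m \<Longrightarrow> tm_in n (\<sigma> i)) \<Longrightarrow> tm_in n (psubst \<sigma> M)"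
    "test_in m Q \<Longrightarrow> (\<And>i. i < m \<Longrightarrow> tm_in n (\<sigma> i)) \<Longrightarrow> test_in n (psubst_test \<sigma> Q)"
  proof (induction M and Q arbitrary: m n \<sigma> and m n \<sigma> rule: tm_test_induct)
    case (Lam M)
    have "tm_in (Suc n) (up \<sigma> i)" if "i < Suc m" for i
      using that Lam.prems(2) ren(1)[of n _ Suc "Suc n"] by (cases i) (auto simp: lift_0)
    then show ?case using Lam.IH[of "Suc m" "Suc n" "up \<sigma>"] Lam.prems(1) by simp
  next
    case (TSum ps)
    have "test_in n (psubst_test \<sigma> Q)" if "(\<alpha>, Q) \<in> set ps" for \<alpha> Q
      using TSum.IH[OF that] TSum.prems that by fastforce
    then show ?case using TSum.prems(1) by fastforce
  qed (auto split: prod.splits)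
qed

lemma tm_in_subst: "tm_in (Suc n) M \<Longrightarrow> tm_in n N \<Longrightarrow> tm_in n (subst 0 N M)"
  unfolding subst_0 by (rule tm_in_psubst(1)) (auto split: nat.split)

section \<open>The interpretation\<close>

lemma interp_TSum:
  "(\<Gamma>, \<alpha>) \<in> interp arr n (TSum ps) \<longleftrightarrow>
   length \<Gamma> = n \<and> meet {\<beta>. \<exists>Q. (\<beta>, Q) \<in> set ps \<and> \<Gamma> \<in> interp_test arr n Q} \<le> \<alpha>"
proof -
  have "{\<beta>. \<exists>R. (\<beta>, R) \<in> set (map (map_prod id (interp_test arr n)) ps) \<and> \<Gamma> \<in> R} =
    {\<beta>. \<exists>Q. (\<beta>, Q) \<in> set ps \<and> \<Gamma> \<in> interp_test arr n Q}"
    by force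
  then show ?thesis by (simp add: sem_taubar_sum_def)
qed

lemma finite_summands: "finite {\<beta>. \<exists>Q. (\<beta>, Q) \<in> set ps \<and> P \<beta> Q}"
  by (rule finite_subset[of _ "fst ` set ps"]) force+

declare interp.simps(4) [simp del]

lemma interp_QSum: "\<Gamma> \<in> interp_test arr n (QSum Qs) \<longleftrightarrow> (\<exists>Q\<in>set Qs. \<Gamma> \<in> interp_test arr n Q)"
  by auto

lemma interp_QProd:
  "\<Gamma> \<in> interp_test arr n (QProd Qs) \<longleftrightarrow> length \<Gamma> = n \<and> (\<forall>Q\<in>set Qs. \<Gamma> \<in> interp_test arr n Q)"
  by auto

lemma meet_antimono: "finite B \<Longrightarrow> A \<subseteq> B \<Longrightarrow> meet B \<le> meet A"
  by (subst le_meet_iff) (auto intro: meet_lower finite_subset)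

locale extensional_arrow_model = arrow_model arr
  for arr :: "'d::bounded_semilattice_inf_top \<Rightarrow> 'd \<Rightarrow> 'd" +
  fixes ext :: "'d \<Rightarrow> ('d \<times> 'd) set"
  assumes ext: "represents ext"
begin

lemma finite_ext [simp]: "finite (ext a)"
  using ext by (rule represents_finite)

lemma set_ext_list [simp]: "set (ext_list ext a) = ext a"
  by (simp add: ext_list)

lemma sem_lam_iff:
  "(\<Gamma>, \<alpha>) \<in> sem_lam arr n X \<longleftrightarrow> length \<Gamma> = n \<and>
     (\<exists>F. finite F \<and> (\<forall>(\<beta>, \<gamma>) \<in> F. (\<beta> # \<Gamma>, \<gamma>) \<in> X) \<and> meet (arrows F) \<le> \<alpha>)"
  by (simp add: sem_lam_def arrows_def)

lemma sem_app_iff: "(\<Gamma>, \<alpha>) \<in> sem_app arr X Y \<longleftrightarrow> (\<exists>\<beta>. (\<Gamma>, arr \<beta> \<alpha>) \<in> X \<and> (\<Gamma>, \<beta>) \<in> Y)"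
  by (simp add: sem_app_def)

lemma interp_length:
  fixes M :: "'d tm" and Q :: "'d test"
  shows "(\<Gamma>, \<alpha>) \<in> interp arr n M \<Longrightarrow> length \<Gamma> = n"
    and "\<Gamma> \<in> interp_test arr n Q \<Longrightarrow> length \<Gamma> = n"
proof (induction M and Q arbitrary: \<Gamma> \<alpha> n and \<Gamma> n rule: tm_test_induct)
  case (App M N)
  then show ?case by (auto simp: sem_app_iff)
qed (auto simp: sem_var_def sem_lam_iff interp_TSum)

lemma interp_up:
  fixes M :: "'d tm" and Q :: "'d test"
  shows "(\<Gamma>, \<alpha>) \<in> interp arr n M \<Longrightarrow> \<alpha> \<le> \<beta> \<Longrightarrow> (\<Gamma>, \<beta>) \<in> interp arr n M" and True
proof (induction M and Q arbitrary: \<Gamma> \<alpha> \<beta> n rule: tm_test_induct)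
  case (App M N)
  then show ?case using arr_mono[OF order_refl \<open>\<alpha> \<le> \<beta>\<close>] unfolding interp.simps sem_app_iff by blast
next
  case (Lam M)
  then show ?case unfolding interp.simps sem_lam_iff by (blast intro: order.trans)
qed (auto simp: sem_var_def interp_TSum)

lemma interp_down:
  fixes M :: "'d tm" and Q :: "'d test"
  shows "(\<Gamma>, \<alpha>) \<in> interp arr n M \<Longrightarrow> list_all2 (\<le>) \<Delta> \<Gamma> \<Longrightarrow> (\<Delta>, \<alpha>) \<in> interp arr n M"
    and "\<Gamma> \<in> interp_test arr n Q \<Longrightarrow> list_all2 (\<le>) \<Delta> \<Gamma> \<Longrightarrow> \<Delta> \<in> interp_test arr n Q"
proof (induction M and Q arbitrary: \<Gamma> \<Delta> \<alpha> n and \<Gamma> \<Delta> n rule: tm_test_induct)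
  case (Var i)
  then show ?case by (auto simp: sem_var_def list_all2_conv_all_nth)
next
  case (Lam M)
  obtain F where F: "finite F" "\<forall>(\<beta>, \<gamma>)\<in>F. (\<beta> # \<Gamma>, \<gamma>) \<in> interp arr (Suc n) M" "meet (arrows F) \<le> \<alpha>"
    using Lam.prems(1) by (auto simp: sem_lam_iff)
  have "\<forall>(\<beta>, \<gamma>)\<in>F. (\<beta> # \<Delta>, \<gamma>) \<in> interp arr (Suc n) M"
    using F(2) Lam.IH Lam.prems(2) by fastforce
  moreover have "length \<Delta> = n"
    using interp_length(1)[OF Lam.prems(1)] list_all2_lengthD[OF Lam.prems(2)] by simp
  ultimately show ?case using F(1,3) by (auto simp: sem_lam_iff)
next
  case (App M N)
  then show ?case by (auto simp: sem_app_iff) blast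
next
  case (TSum ps)
  have "{\<beta>. \<exists>Q. (\<beta>, Q) \<in> set ps \<and> \<Gamma> \<in> interp_test arr n Q} \<subseteq>
    {\<beta>. \<exists>Q. (\<beta>, Q) \<in> set ps \<and> \<Delta> \<in> interp_test arr n Q}"
    using TSum.IH TSum.prems(2) by blast
  then have le: "meet {\<beta>. \<exists>Q. (\<beta>, Q) \<in> set ps \<and> \<Delta> \<in> interp_test arr n Q} \<le>
    meet {\<beta>. \<exists>Q. (\<beta>, Q) \<in> set ps \<and> \<Gamma> \<in> interp_test arr n Q}"
    by (rule meet_antimono[OF finite_summands])
  show ?case
    unfolding interp_TSum
  proof
    show "length \<Delta> = n"
      using interp_length(1)[OF TSum.prems(1)] list_all2_lengthD[OF TSum.prems(2)] by simp
    have "meet {\<beta>. \<exists>Q. (\<beta>, Q) \<in> set ps \<and> \<Gamma> \<in> interp_test arr n Q} \<le> \<alpha>"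
      using TSum.prems(1) unfolding interp_TSum by (rule conjunct2)
    with le show "meet {\<beta>. \<exists>Q. (\<beta>, Q) \<in> set ps \<and> \<Delta> \<in> interp_test arr n Q} \<le> \<alpha>"
      by (rule order.trans)
  qed
next
  case (QProd Qs)
  then show ?case using list_all2_lengthD[OF QProd.prems(2)] by (auto simp: interp_QProd)
next
  case (QSum Qs)
  then show ?case unfolding interp_QSum by blast
qed auto

lemma interp_top: "tm_in n M \<Longrightarrow> length \<Gamma> = n \<Longrightarrow> (\<Gamma>, top) \<in> interp arr n M" and True
  for M :: "'d tm" and Q :: "'d test"
proof (induction M and Q arbitrary: \<Gamma> n rule: tm_test_induct)
  case (Lam M)
  then show ?case by (auto simp: sem_lam_iff)
next
  case (App M N)
  have top: "arr top top = top" by simp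
  have "(\<Gamma>, arr top top) \<in> interp arr n M" "(\<Gamma>, top) \<in> interp arr n N"
    unfolding top using App by simp_all
  then show ?case unfolding interp.simps sem_app_iff by blast
qed (auto simp: sem_var_def interp_TSum)

lemma interp_inf:
  fixes M :: "'d tm" and Q :: "'d test"
  shows "(\<Gamma>, \<alpha>) \<in> interp arr n M \<Longrightarrow> (\<Gamma>, \<beta>) \<in> interp arr n M \<Longrightarrow> (\<Gamma>, inf \<alpha> \<beta>) \<in> interp arr n M"
    and True
proof (induction M and Q arbitrary: \<Gamma> \<alpha> \<beta> n rule: tm_test_induct)
  case (Lam M)
  obtain F G where F: "finite F" "\<forall>(\<beta>, \<gamma>)\<in>F. (\<beta> # \<Gamma>, \<gamma>) \<in> interp arr (Suc n) M" "meet (arrows F) \<le> \<alpha>"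
    and G: "finite G" "\<forall>(\<beta>, \<gamma>)\<in>G. (\<beta> # \<Gamma>, \<gamma>) \<in> interp arr (Suc n) M" "meet (arrows G) \<le> \<beta>"
    using Lam.prems by (auto simp: sem_lam_iff)
  have "meet (arrows (F \<union> G)) \<le> inf \<alpha> \<beta>"
    using F(1,3) G(1,3) by (simp add: arrows_Un meet_union le_infI1 le_infI2)
  moreover have "finite (F \<union> G)" "\<forall>(\<beta>, \<gamma>)\<in>F \<union> G. (\<beta> # \<Gamma>, \<gamma>) \<in> interp arr (Suc n) M"
    using F(1,2) G(1,2) by auto
  ultimately show ?case
    using interp_length(1)[OF Lam.prems(1)] unfolding interp.simps sem_lam_iff by blast
next
  case (App M N)
  obtain \<gamma> \<delta> where "(\<Gamma>, arr \<gamma> \<alpha>) \<in> interp arr n M" "(\<Gamma>, \<gamma>) \<in> interp arr n N"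
    "(\<Gamma>, arr \<delta> \<beta>) \<in> interp arr n M" "(\<Gamma>, \<delta>) \<in> interp arr n N"
    using App.prems by (auto simp: sem_app_iff)
  then have "(\<Gamma>, inf (arr \<gamma> \<alpha>) (arr \<delta> \<beta>)) \<in> interp arr n M" "(\<Gamma>, inf \<gamma> \<delta>) \<in> interp arr n N"
    using App.IH by blast+
  then show ?case using interp_up(1)[OF _ inf_arr_le] unfolding interp.simps sem_app_iff by blast
qed (auto simp: sem_var_def interp_TSum)

lemma interp_meet:
  assumes "tm_in n M" "length \<Gamma> = n" "finite A" "\<And>a. a \<in> A \<Longrightarrow> (\<Gamma>, a) \<in> interp arr n M"
  shows "(\<Gamma>, meet A) \<in> interp arr n M"
  using assms(3,4) by (induction A rule: finite_induct) (auto intro: interp_top(1) interp_inf(1) assms)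

text \<open>Inversion is where the filter-model axiom is needed: it puts \<gamma> above the meet of
  the results of \<open>F\<close> at \<beta>, and each of these results holds for the body under
  \<beta> because its left component is above \<beta>.\<close>

lemma interp_Lam_arr:
  assumes "tm_in (Suc n) M" "length \<Gamma> = n"
  shows "(\<Gamma>, arr \<beta> \<gamma>) \<in> interp arr n (Lam M) \<longleftrightarrow> (\<beta> # \<Gamma>, \<gamma>) \<in> interp arr (Suc n) M"
proof
  assume "(\<Gamma>, arr \<beta> \<gamma>) \<in> interp arr n (Lam M)"
  then obtain F where F: "finite F" "\<forall>(\<beta>, \<gamma>)\<in>F. (\<beta> # \<Gamma>, \<gamma>) \<in> interp arr (Suc n) M"
    and "meet (arrows F) \<le> arr \<beta> \<gamma>"
    by (auto simp: sem_lam_iff)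
  then have le: "meet (results F \<beta>) \<le> \<gamma>" using meet_arrows_le by blast
  have "(\<beta> # \<Gamma>, c) \<in> interp arr (Suc n) M" if "c \<in> results F \<beta>" for c
  proof -
    obtain b where b: "(b, c) \<in> F" "\<beta> \<le> b" using \<open>c \<in> results F \<beta>\<close> by (auto simp: results_def)
    then have "(b # \<Gamma>, c) \<in> interp arr (Suc n) M" using F(2) by blast
    then show ?thesis by (rule interp_down(1)) (simp add: b(2) list_all2_refl)
  qed
  then have "(\<beta> # \<Gamma>, meet (results F \<beta>)) \<in> interp arr (Suc n) M"
    using assms F(1) by (intro interp_meet) auto
  then show "(\<beta> # \<Gamma>, \<gamma>) \<in> interp arr (Suc n) M" using le interp_up(1) by blast
next
  assume "(\<beta> # \<Gamma>, \<gamma>) \<in> interp arr (Suc n) M"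
  then have "\<forall>(b, c)\<in>{(\<beta>, \<gamma>)}. (b # \<Gamma>, c) \<in> interp arr (Suc n) M" by simp
  moreover have "meet (arrows {(\<beta>, \<gamma>)}) \<le> arr \<beta> \<gamma>" by (simp add: arrows_image)
  ultimately show "(\<Gamma>, arr \<beta> \<gamma>) \<in> interp arr n (Lam M)"
    using assms(2) unfolding interp.simps sem_lam_iff by blast
qed

lemma interp_ext:
  assumes "tm_in n M" "length \<Gamma> = n"
  shows "(\<Gamma>, \<alpha>) \<in> interp arr n M \<longleftrightarrow> (\<forall>(u, v) \<in> ext \<alpha>. (\<Gamma>, arr u v) \<in> interp arr n M)"
proof
  show "(\<Gamma>, \<alpha>) \<in> interp arr n M \<Longrightarrow> \<forall>(u, v) \<in> ext \<alpha>. (\<Gamma>, arr u v) \<in> interp arr n M"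
    using interp_up(1) represents_mem[OF ext] by blast
  assume "\<forall>(u, v) \<in> ext \<alpha>. (\<Gamma>, arr u v) \<in> interp arr n M"
  then have "(\<Gamma>, meet (arrows (ext \<alpha>))) \<in> interp arr n M"
    using assms by (intro interp_meet) (auto simp: arrows_image)
  then show "(\<Gamma>, \<alpha>) \<in> interp arr n M" by (simp add: represents_eq[OF ext])
qed

lemma interp_Lam:
  assumes "tm_in (Suc n) M" "length \<Gamma> = n"
  shows "(\<Gamma>, \<alpha>) \<in> interp arr n (Lam M) \<longleftrightarrow> (\<forall>(u, v) \<in> ext \<alpha>. (u # \<Gamma>, v) \<in> interp arr (Suc n) M)"
  using assms interp_ext[of n "Lam M" \<Gamma> \<alpha>] by (simp add: interp_Lam_arr del: interp.simps)

end

section \<open>Renaming, substitution and the interpretation\<close>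

lemma summands_map:
  "{\<beta>. \<exists>Q. (\<beta>, Q) \<in> set (map (map_prod id f) ps) \<and> P Q} = {\<beta>. \<exists>Q. (\<beta>, Q) \<in> set ps \<and> P (f Q)}"
  by force

lemma list_all2_map2_inf:
  fixes \<Gamma> \<Delta> :: "'d::semilattice_inf list"
  assumes "length \<Gamma> = length \<Delta>"
  shows "list_all2 (\<le>) (map2 inf \<Gamma> \<Delta>) \<Gamma>" "list_all2 (\<le>) (map2 inf \<Gamma> \<Delta>) \<Delta>"
  using assms by (auto simp: list_all2_conv_all_nth)

text \<open>Take the pointwise meet of the finitely many contexts: by \<open>down\<close>, each
  requirement survives the passage to a smaller context.\<close>

lemma common_context:
  fixes P :: "'x \<Rightarrow> 'd::bounded_semilattice_inf_top list \<Rightarrow> bool"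
  assumes fin: "finite S"
    and C_top: "C (replicate n top)" and C_inf: "\<And>\<Gamma> \<Delta>. C \<Gamma> \<Longrightarrow> C \<Delta> \<Longrightarrow> C (map2 inf \<Gamma> \<Delta>)"
    and C_length: "\<And>\<Gamma>. C \<Gamma> \<Longrightarrow> length \<Gamma> = n"
    and ex: "\<And>x. x \<in> S \<Longrightarrow> \<exists>\<Gamma>. C \<Gamma> \<and> P x \<Gamma>"
    and down: "\<And>x \<Gamma> \<Delta>. P x \<Gamma> \<Longrightarrow> list_all2 (\<le>) \<Delta> \<Gamma> \<Longrightarrow> P x \<Delta>"
  shows "\<exists>\<Gamma>. C \<Gamma> \<and> (\<forall>x\<in>S. P x \<Gamma>)"
  using fin ex
proof (induction S rule: finite_induct)
  case empty
  then show ?case using C_top by blast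
next
  case (insert x S)
  obtain \<Gamma> \<Delta> where G: "C \<Gamma>" "P x \<Gamma>" and D: "C \<Delta>" "\<forall>x\<in>S. P x \<Delta>"
    using insert.IH insert.prems by (meson insertCI)
  have len: "length \<Gamma> = length \<Delta>" using C_length G D by simp
  have "P x (map2 inf \<Gamma> \<Delta>)" using down[OF G(2) list_all2_map2_inf(1)[OF len]] .
  moreover have "\<forall>y\<in>S. P y (map2 inf \<Gamma> \<Delta>)"
    using down[OF _ list_all2_map2_inf(2)[OF len]] D(2) by blast
  ultimately show ?case using C_inf[OF G(1) D(1)] by blast
qed

text \<open>Semantic justification for discarding the summands annotated with \<omega> in
  \<open>taubar_sum\<close>.\<close>

lemma meet_without_top:
  assumes "finite A" shows "meet {a \<in> A. a \<noteq> top} = meet A"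
proof (rule order.antisym)
  have "meet {a \<in> A. a \<noteq> top} \<le> a" if "a \<in> A" for a
    using assms that by (cases "a = top") (auto intro!: meet_lower)
  then show "meet {a \<in> A. a \<noteq> top} \<le> meet A" using assms by (simp add: le_meet_iff)
qed (use assms in \<open>auto intro: meet_antimono\<close>)

context extensional_arrow_model
begin

lemma interp_rename:
  fixes M :: "'d tm" and Q :: "'d test"
  shows "tm_in m M \<Longrightarrow> (\<And>i. i < m \<Longrightarrow> \<xi> i < n) \<Longrightarrow> length \<Gamma> = n \<Longrightarrow>
      (\<Gamma>, \<alpha>) \<in> interp arr n (rename \<xi> M) \<longleftrightarrow> (map (\<lambda>i. \<Gamma> ! \<xi> i) [0..<m], \<alpha>) \<in> interp arr m M"
    and "test_in m Q \<Longrightarrow> (\<And>i. i < m \<Longrightarrow> \<xi> i < n) \<Longrightarrow> length \<Gamma> = n \<Longrightarrow>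
      \<Gamma> \<in> interp_test arr n (psubst_test (\<lambda>i. Var (\<xi> i)) Q) \<longleftrightarrow>
      map (\<lambda>i. \<Gamma> ! \<xi> i) [0..<m] \<in> interp_test arr m Q"
proof (induction M and Q arbitrary: m n \<xi> \<Gamma> \<alpha> and m n \<xi> \<Gamma> rule: tm_test_induct)
  case (Var i)
  then show ?case by (auto simp: sem_var_def)
next
  case (Lam M)
  have \<xi>: "up_ren \<xi> i < Suc n" if "i < Suc m" for i using that Lam.prems(2) by (cases i) auto
  have "map (\<lambda>i. (\<beta> # \<Gamma>) ! up_ren \<xi> i) [0..<Suc m] = \<beta> # map (\<lambda>i. \<Gamma> ! \<xi> i) [0..<m]" for \<beta>
    unfolding map_upt_Suc by simp
  then have "(\<beta> # \<Gamma>, \<gamma>) \<in> interp arr (Suc n) (rename (up_ren \<xi>) M) \<longleftrightarrow>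
    (\<beta> # map (\<lambda>i. \<Gamma> ! \<xi> i) [0..<m], \<gamma>) \<in> interp arr (Suc m) M" for \<beta> \<gamma>
    using Lam.IH[of "Suc m" "up_ren \<xi>" "Suc n" "\<beta> # \<Gamma>" \<gamma>] \<xi> Lam.prems by simp
  then show ?case using Lam.prems(3) by (simp add: sem_lam_iff up_rename)
next
  case (App M N)
  have "(\<Gamma>, \<beta>) \<in> interp arr n (rename \<xi> M) \<longleftrightarrow> (map (\<lambda>i. \<Gamma> ! \<xi> i) [0..<m], \<beta>) \<in> interp arr m M"
    "(\<Gamma>, \<beta>) \<in> interp arr n (rename \<xi> N) \<longleftrightarrow> (map (\<lambda>i. \<Gamma> ! \<xi> i) [0..<m], \<beta>) \<in> interp arr m N" for \<beta>
    using App.IH(1)[of m \<xi> n \<Gamma> \<beta>] App.IH(2)[of m \<xi> n \<Gamma> \<beta>] App.prems by simp_all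
  then show ?case by (simp add: sem_app_iff)
next
  case (TSum ps)
  have "{\<beta>. \<exists>Q. (\<beta>, Q) \<in> set ps \<and> \<Gamma> \<in> interp_test arr n (psubst_test (\<lambda>i. Var (\<xi> i)) Q)} =
    {\<beta>. \<exists>Q. (\<beta>, Q) \<in> set ps \<and> map (\<lambda>i. \<Gamma> ! \<xi> i) [0..<m] \<in> interp_test arr m Q}"
    using TSum.IH[OF _ _ TSum.prems(2,3)] TSum.prems(1) by fastforce
  then show ?case using TSum.prems(3) by (simp add: interp_TSum summands_map del: set_map)
next
  case (QSum Qs)
  have "\<Gamma> \<in> interp_test arr n (psubst_test (\<lambda>i. Var (\<xi> i)) Q) \<longleftrightarrow>
      map (\<lambda>i. \<Gamma> ! \<xi> i) [0..<m] \<in> interp_test arr m Q" if "Q \<in> set Qs" for Q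
    using QSum.IH[OF that _ QSum.prems(2,3)] QSum.prems(1) that by simp
  then show ?case by simp
next
  case (QProd Qs)
  have "\<Gamma> \<in> interp_test arr n (psubst_test (\<lambda>i. Var (\<xi> i)) Q) \<longleftrightarrow>
      map (\<lambda>i. \<Gamma> ! \<xi> i) [0..<m] \<in> interp_test arr m Q" if "Q \<in> set Qs" for Q
    using QProd.IH[OF that _ QProd.prems(2,3)] QProd.prems(1) that by simp
  then show ?case using QProd.prems(3) by simp
qed simp

lemma interp_lift:
  assumes "tm_in n M" "length \<Gamma> = n"
  shows "(\<beta> # \<Gamma>, \<alpha>) \<in> interp arr (Suc n) (lift 0 M) \<longleftrightarrow> (\<Gamma>, \<alpha>) \<in> interp arr n M"
proof -
  have "map (\<lambda>i. (\<beta> # \<Gamma>) ! Suc i) [0..<n] = \<Gamma>"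
    using map_nth[of \<Gamma>] assms(2) by simp
  then show ?thesis
    using interp_rename(1)[OF assms(1), of Suc "Suc n" "\<beta> # \<Gamma>" \<alpha>] assms(2) by (simp add: lift_0)
qed

definition instance_of :: "nat \<Rightarrow> (nat \<Rightarrow> 'd tm) \<Rightarrow> 'd list \<Rightarrow> nat \<Rightarrow> 'd list \<Rightarrow> bool" where
  "instance_of n \<sigma> \<Gamma> m \<Delta> \<longleftrightarrow> length \<Delta> = m \<and> (\<forall>i<m. (\<Gamma>, \<Delta> ! i) \<in> interp arr n (\<sigma> i))"

lemma instance_of_replicate:
  "length \<Gamma> = n \<Longrightarrow> (\<And>i. i < m \<Longrightarrow> tm_in n (\<sigma> i)) \<Longrightarrow> instance_of n \<sigma> \<Gamma> m (replicate m top)"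
  by (auto simp: instance_of_def interp_top)

lemma instance_of_inf:
  "instance_of n \<sigma> \<Gamma> m \<Delta> \<Longrightarrow> instance_of n \<sigma> \<Gamma> m \<Delta>' \<Longrightarrow> instance_of n \<sigma> \<Gamma> m (map2 inf \<Delta> \<Delta>')"
  by (auto simp: instance_of_def interp_inf)

lemma instance_of_length: "instance_of n \<sigma> \<Gamma> m \<Delta> \<Longrightarrow> length \<Delta> = m"
  by (simp add: instance_of_def)

lemma instance_of_up:
  assumes "\<And>i. i < m \<Longrightarrow> tm_in n (\<sigma> i)" "length \<Gamma> = n"
  shows "instance_of (Suc n) (up \<sigma>) (\<beta> # \<Gamma>) (Suc m) \<Delta>' \<longleftrightarrow>
    (\<exists>b \<Delta>. \<Delta>' = b # \<Delta> \<and> \<beta> \<le> b \<and> instance_of n \<sigma> \<Gamma> m \<Delta>)"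
proof (cases \<Delta>')
  case (Cons b \<Delta>)
  have "(\<beta> # \<Gamma>, \<alpha>) \<in> interp arr (Suc n) (lift 0 (\<sigma> i)) \<longleftrightarrow> (\<Gamma>, \<alpha>) \<in> interp arr n (\<sigma> i)" if "i < m" for i \<alpha>
    using interp_lift assms that by blast
  then show ?thesis using assms(2) Cons
    by (auto simp: instance_of_def All_less_Suc2 sem_var_def)
qed (simp add: instance_of_def)

lemma common_instance:
  assumes "finite S" "length \<Gamma> = n" "\<And>i. i < m \<Longrightarrow> tm_in n (\<sigma> i)"
    and "\<And>x. x \<in> S \<Longrightarrow> \<exists>\<Delta>. instance_of n \<sigma> \<Gamma> m \<Delta> \<and> P x \<Delta>"
    and "\<And>x \<Delta> \<Delta>'. P x \<Delta> \<Longrightarrow> list_all2 (\<le>) \<Delta>' \<Delta> \<Longrightarrow> P x \<Delta>'"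
  shows "\<exists>\<Delta>. instance_of n \<sigma> \<Gamma> m \<Delta> \<and> (\<forall>x\<in>S. P x \<Delta>)"
  using assms by (intro common_context[where n = m and C = "instance_of n \<sigma> \<Gamma> m"])
    (auto intro: instance_of_replicate instance_of_inf dest: instance_of_length)

text \<open>The right-hand side asks for a single context of types for the substituted terms.
  Abstractions, applications, sums and products provide several of them, which are merged by taking
  meets.\<close>

lemma interp_psubst:
  fixes M :: "'d tm" and Q :: "'d test"
  shows "tm_in m M \<Longrightarrow> (\<And>i. i < m \<Longrightarrow> tm_in n (\<sigma> i)) \<Longrightarrow> length \<Gamma> = n \<Longrightarrow>
      (\<Gamma>, \<alpha>) \<in> interp arr n (psubst \<sigma> M) \<longleftrightarrow> (\<exists>\<Delta>. instance_of n \<sigma> \<Gamma> m \<Delta> \<and> (\<Delta>, \<alpha>) \<in> interp arr m M)"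
    and "test_in m Q \<Longrightarrow> (\<And>i. i < m \<Longrightarrow> tm_in n (\<sigma> i)) \<Longrightarrow> length \<Gamma> = n \<Longrightarrow>
      \<Gamma> \<in> interp_test arr n (psubst_test \<sigma> Q) \<longleftrightarrow> (\<exists>\<Delta>. instance_of n \<sigma> \<Gamma> m \<Delta> \<and> \<Delta> \<in> interp_test arr m Q)"
proof (induction M and Q arbitrary: m n \<sigma> \<Gamma> \<alpha> and m n \<sigma> \<Gamma> rule: tm_test_induct)
  case (Var i)
  show ?case
  proof
    assume i: "(\<Gamma>, \<alpha>) \<in> interp arr n (psubst \<sigma> (Var i))"
    \<comment> \<open>The weakest context that types the variable: every other entry is \<omega>,
      which any term has.\<close>
    have "instance_of n \<sigma> \<Gamma> m ((replicate m top)[i := \<alpha>])"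
      using i Var.prems by (auto simp: instance_of_def nth_list_update intro: interp_top(1))
    moreover have "((replicate m top)[i := \<alpha>], \<alpha>) \<in> interp arr m (Var i)"
      using Var.prems(1) by (simp add: sem_var_def)
    ultimately show "\<exists>\<Delta>. instance_of n \<sigma> \<Gamma> m \<Delta> \<and> (\<Delta>, \<alpha>) \<in> interp arr m (Var i)" by blast
  next
    assume "\<exists>\<Delta>. instance_of n \<sigma> \<Gamma> m \<Delta> \<and> (\<Delta>, \<alpha>) \<in> interp arr m (Var i)"
    then show "(\<Gamma>, \<alpha>) \<in> interp arr n (psubst \<sigma> (Var i))"
      using Var.prems(1) interp_up(1) by (auto simp: instance_of_def sem_var_def)
  qed
next
  case (Lam M)
  have up: "tm_in (Suc n) (up \<sigma> i)" if "i < Suc m" for i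
    using that Lam.prems(2) tm_in_psubst(1)[of n _ "Suc n" "\<lambda>i. Var (Suc i)"] by (cases i) (auto simp: lift_0)
  have IH: "(\<beta> # \<Gamma>, \<gamma>) \<in> interp arr (Suc n) (psubst (up \<sigma>) M) \<longleftrightarrow>
    (\<exists>\<Delta>. instance_of n \<sigma> \<Gamma> m \<Delta> \<and> (\<beta> # \<Delta>, \<gamma>) \<in> interp arr (Suc m) M)" for \<beta> \<gamma>
  proof -
    have "(\<beta> # \<Gamma>, \<gamma>) \<in> interp arr (Suc n) (psubst (up \<sigma>) M) \<longleftrightarrow>
      (\<exists>b \<Delta>. \<beta> \<le> b \<and> instance_of n \<sigma> \<Gamma> m \<Delta> \<and> (b # \<Delta>, \<gamma>) \<in> interp arr (Suc m) M)"
      using Lam.IH[of "Suc m" "Suc n" "up \<sigma>" "\<beta> # \<Gamma>" \<gamma>] up Lam.prems(1,3) instance_of_up[OF Lam.prems(2,3)] by auto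
    also have "\<dots> \<longleftrightarrow> (\<exists>\<Delta>. instance_of n \<sigma> \<Gamma> m \<Delta> \<and> (\<beta> # \<Delta>, \<gamma>) \<in> interp arr (Suc m) M)"
      using interp_down(1)[of "_ # _" \<gamma> "Suc m" M "\<beta> # _"] by (auto simp: list_all2_refl)
    finally show ?thesis .
  qed
  show ?case
  proof
    assume "(\<Gamma>, \<alpha>) \<in> interp arr n (psubst \<sigma> (Lam M))"
    then obtain F where F: "finite F" "meet (arrows F) \<le> \<alpha>"
      "\<forall>(\<beta>, \<gamma>)\<in>F. (\<beta> # \<Gamma>, \<gamma>) \<in> interp arr (Suc n) (psubst (up \<sigma>) M)"
      by (auto simp: sem_lam_iff)
    have "\<exists>\<Delta>. instance_of n \<sigma> \<Gamma> m \<Delta> \<and> (\<forall>p\<in>F. (fst p # \<Delta>, snd p) \<in> interp arr (Suc m) M)"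
    proof (rule common_instance[OF F(1) Lam.prems(3,2)])
      show "\<exists>\<Delta>. instance_of n \<sigma> \<Gamma> m \<Delta> \<and> (fst p # \<Delta>, snd p) \<in> interp arr (Suc m) M" if "p \<in> F" for p
        using that F(3) IH[of "fst p" "snd p"] by auto
      show "(fst p # \<Delta>', snd p) \<in> interp arr (Suc m) M"
        if "(fst p # \<Delta>, snd p) \<in> interp arr (Suc m) M" "list_all2 (\<le>) \<Delta>' \<Delta>" for p \<Delta> \<Delta>'
        using interp_down(1)[OF that(1)] that(2) by simp
    qed
    then obtain \<Delta> where D: "instance_of n \<sigma> \<Gamma> m \<Delta>" "\<forall>(\<beta>, \<gamma>)\<in>F. (\<beta> # \<Delta>, \<gamma>) \<in> interp arr (Suc m) M"
      by (auto simp: case_prod_beta)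
    then have "(\<Delta>, \<alpha>) \<in> interp arr m (Lam M)"
      using F(1,2) instance_of_length[OF D(1)] unfolding interp.simps sem_lam_iff by blast
    then show "\<exists>\<Delta>. instance_of n \<sigma> \<Gamma> m \<Delta> \<and> (\<Delta>, \<alpha>) \<in> interp arr m (Lam M)"
      using D(1) by blast
  next
    assume "\<exists>\<Delta>. instance_of n \<sigma> \<Gamma> m \<Delta> \<and> (\<Delta>, \<alpha>) \<in> interp arr m (Lam M)"
    then obtain \<Delta> F where D: "instance_of n \<sigma> \<Gamma> m \<Delta>" and F: "finite F" "meet (arrows F) \<le> \<alpha>"
      and M: "\<forall>(\<beta>, \<gamma>)\<in>F. (\<beta> # \<Delta>, \<gamma>) \<in> interp arr (Suc m) M"
      by (auto simp: sem_lam_iff)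
    have "(\<beta> # \<Gamma>, \<gamma>) \<in> interp arr (Suc n) (psubst (up \<sigma>) M)" if "(\<beta>, \<gamma>) \<in> F" for \<beta> \<gamma>
      unfolding IH using D M that by blast
    then have "\<forall>(\<beta>, \<gamma>)\<in>F. (\<beta> # \<Gamma>, \<gamma>) \<in> interp arr (Suc n) (psubst (up \<sigma>) M)" by blast
    then show "(\<Gamma>, \<alpha>) \<in> interp arr n (psubst \<sigma> (Lam M))"
      using F Lam.prems(3) unfolding psubst.simps interp.simps sem_lam_iff by blast
  qed
next
  case (App M N)
  show ?case
  proof
    assume "(\<Gamma>, \<alpha>) \<in> interp arr n (psubst \<sigma> (App M N))"
    then obtain \<beta> where "(\<Gamma>, arr \<beta> \<alpha>) \<in> interp arr n (psubst \<sigma> M)" "(\<Gamma>, \<beta>) \<in> interp arr n (psubst \<sigma> N)"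
      by (auto simp: sem_app_iff)
    then obtain \<Delta> \<Delta>' where D: "instance_of n \<sigma> \<Gamma> m \<Delta>" "(\<Delta>, arr \<beta> \<alpha>) \<in> interp arr m M"
      "instance_of n \<sigma> \<Gamma> m \<Delta>'" "(\<Delta>', \<beta>) \<in> interp arr m N"
      using App.IH App.prems by auto
    then have len: "length \<Delta> = length \<Delta>'" by (simp add: instance_of_def)
    have "(map2 inf \<Delta> \<Delta>', arr \<beta> \<alpha>) \<in> interp arr m M" "(map2 inf \<Delta> \<Delta>', \<beta>) \<in> interp arr m N"
      using interp_down(1) list_all2_map2_inf[OF len] D by blast+
    then show "\<exists>\<Delta>. instance_of n \<sigma> \<Gamma> m \<Delta> \<and> (\<Delta>, \<alpha>) \<in> interp arr m (App M N)"
      using instance_of_inf[OF D(1,3)] by (auto simp: sem_app_iff)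
  next
    assume "\<exists>\<Delta>. instance_of n \<sigma> \<Gamma> m \<Delta> \<and> (\<Delta>, \<alpha>) \<in> interp arr m (App M N)"
    then obtain \<Delta> \<beta> where "instance_of n \<sigma> \<Gamma> m \<Delta>" "(\<Delta>, arr \<beta> \<alpha>) \<in> interp arr m M"
      "(\<Delta>, \<beta>) \<in> interp arr m N"
      by (auto simp: sem_app_iff)
    then have "(\<Gamma>, arr \<beta> \<alpha>) \<in> interp arr n (psubst \<sigma> M)" "(\<Gamma>, \<beta>) \<in> interp arr n (psubst \<sigma> N)"
      using App.IH(1)[of m n \<sigma> \<Gamma>] App.IH(2)[of m n \<sigma> \<Gamma>] App.prems by auto
    then show "(\<Gamma>, \<alpha>) \<in> interp arr n (psubst \<sigma> (App M N))"
      by (auto simp: sem_app_iff)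
  qed
next
  case (TSum ps)
  have IH: "\<Gamma> \<in> interp_test arr n (psubst_test \<sigma> Q) \<longleftrightarrow> (\<exists>\<Delta>. instance_of n \<sigma> \<Gamma> m \<Delta> \<and> \<Delta> \<in> interp_test arr m Q)"
    if "(\<beta>, Q) \<in> set ps" for \<beta> Q
  proof -
    have "test_in m Q" using TSum.prems(1) that by auto
    then show ?thesis by (rule TSum.IH[OF that _ TSum.prems(2,3)])
  qed
  let ?S = "\<lambda>\<Delta>. {\<beta>. \<exists>Q. (\<beta>, Q) \<in> set ps \<and> \<Delta> \<in> interp_test arr m Q}"
  let ?T = "{\<beta>. \<exists>Q. (\<beta>, Q) \<in> set ps \<and> \<Gamma> \<in> interp_test arr n (psubst_test \<sigma> Q)}"
  have T: "(\<Gamma>, \<alpha>) \<in> interp arr n (psubst \<sigma> (TSum ps)) \<longleftrightarrow> meet ?T \<le> \<alpha>"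
    using TSum.prems(3) by (simp add: interp_TSum summands_map del: set_map)
  show ?case
    unfolding T
  proof
    assume le: "meet ?T \<le> \<alpha>"
    let ?F = "{p \<in> set ps. \<Gamma> \<in> interp_test arr n (psubst_test \<sigma> (snd p))}"
    have "\<exists>\<Delta>. instance_of n \<sigma> \<Gamma> m \<Delta> \<and> (\<forall>p\<in>?F. \<Delta> \<in> interp_test arr m (snd p))"
    proof (rule common_instance[OF _ TSum.prems(3,2)])
      show "\<exists>\<Delta>. instance_of n \<sigma> \<Gamma> m \<Delta> \<and> \<Delta> \<in> interp_test arr m (snd p)" if "p \<in> ?F" for p
        using that IH[of "fst p" "snd p"] by simp
    qed (auto intro: interp_down(2))
    then obtain \<Delta> where D: "instance_of n \<sigma> \<Gamma> m \<Delta>" "\<forall>p\<in>?F. \<Delta> \<in> interp_test arr m (snd p)" by blast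
    have "?T \<subseteq> ?S \<Delta>" using D(2) by force
    then have "meet (?S \<Delta>) \<le> \<alpha>"
      using le by (rule order.trans[OF meet_antimono[OF finite_summands]])
    then show "\<exists>\<Delta>. instance_of n \<sigma> \<Gamma> m \<Delta> \<and> (\<Delta>, \<alpha>) \<in> interp arr m (TSum ps)"
      using D(1) by (auto simp: interp_TSum instance_of_def)
  next
    assume "\<exists>\<Delta>. instance_of n \<sigma> \<Gamma> m \<Delta> \<and> (\<Delta>, \<alpha>) \<in> interp arr m (TSum ps)"
    then obtain \<Delta> where D: "instance_of n \<sigma> \<Gamma> m \<Delta>" "meet (?S \<Delta>) \<le> \<alpha>" by (auto simp: interp_TSum)
    have "?S \<Delta> \<subseteq> ?T"
    proof
      fix \<beta> assume "\<beta> \<in> ?S \<Delta>"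
      then obtain Q where Q: "(\<beta>, Q) \<in> set ps" "\<Delta> \<in> interp_test arr m Q" by blast
      then show "\<beta> \<in> ?T" using IH[OF Q(1)] D(1) by blast
    qed
    then show "meet ?T \<le> \<alpha>" using D(2) by (rule order.trans[OF meet_antimono[OF finite_summands]])
  qed
next
  case (QSum Qs)
  have IH: "\<Gamma> \<in> interp_test arr n (psubst_test \<sigma> Q) \<longleftrightarrow> (\<exists>\<Delta>. instance_of n \<sigma> \<Gamma> m \<Delta> \<and> \<Delta> \<in> interp_test arr m Q)"
    if "Q \<in> set Qs" for Q
  proof -
    have "test_in m Q" using QSum.prems(1) that by auto
    then show ?thesis by (rule QSum.IH[OF that _ QSum.prems(2,3)])
  qed
  then show ?case unfolding psubst_test.simps interp_QSum by simp blast
next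
  case (QProd Qs)
  have IH: "\<Gamma> \<in> interp_test arr n (psubst_test \<sigma> Q) \<longleftrightarrow> (\<exists>\<Delta>. instance_of n \<sigma> \<Gamma> m \<Delta> \<and> \<Delta> \<in> interp_test arr m Q)"
    if "Q \<in> set Qs" for Q
  proof -
    have "test_in m Q" using QProd.prems(1) that by auto
    then show ?thesis by (rule QProd.IH[OF that _ QProd.prems(2,3)])
  qed
  show ?case
  proof
    assume "\<Gamma> \<in> interp_test arr n (psubst_test \<sigma> (QProd Qs))"
    then have G: "\<forall>Q\<in>set Qs. \<Gamma> \<in> interp_test arr n (psubst_test \<sigma> Q)" by simp
    have "\<exists>\<Delta>. instance_of n \<sigma> \<Gamma> m \<Delta> \<and> (\<forall>Q\<in>set Qs. \<Delta> \<in> interp_test arr m Q)"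
    proof (rule common_instance[OF _ QProd.prems(3,2)])
      show "\<exists>\<Delta>. instance_of n \<sigma> \<Gamma> m \<Delta> \<and> \<Delta> \<in> interp_test arr m Q" if "Q \<in> set Qs" for Q
        using G IH[OF that] that by blast
    qed (auto intro: interp_down(2))
    then show "\<exists>\<Delta>. instance_of n \<sigma> \<Gamma> m \<Delta> \<and> \<Delta> \<in> interp_test arr m (QProd Qs)"
      unfolding interp_QProd using instance_of_length by blast
  next
    assume "\<exists>\<Delta>. instance_of n \<sigma> \<Gamma> m \<Delta> \<and> \<Delta> \<in> interp_test arr m (QProd Qs)"
    then show "\<Gamma> \<in> interp_test arr n (psubst_test \<sigma> (QProd Qs))"
      using IH QProd.prems(3) by auto
  qed
qed simp

lemma interp_subst:
  assumes "tm_in (Suc n) M" "tm_in n N" "length \<Gamma> = n"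
  shows "(\<Gamma>, \<alpha>) \<in> interp arr n (subst 0 N M) \<longleftrightarrow>
    (\<exists>\<beta>. (\<Gamma>, \<beta>) \<in> interp arr n N \<and> (\<beta> # \<Gamma>, \<alpha>) \<in> interp arr (Suc n) M)"
proof -
  have in_n: "tm_in n (case_nat N Var i)" if "i < Suc n" for i
    using that assms(2) by (auto split: nat.split)
  have inst: "instance_of n (case_nat N Var) \<Gamma> (Suc n) \<Delta>' \<longleftrightarrow>
    (\<exists>\<beta> \<Delta>. \<Delta>' = \<beta> # \<Delta> \<and> (\<Gamma>, \<beta>) \<in> interp arr n N \<and> list_all2 (\<le>) \<Gamma> \<Delta>)" for \<Delta>'
    using assms(3) by (cases \<Delta>')
      (auto simp: instance_of_def All_less_Suc2 list_all2_conv_all_nth sem_var_def)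
  have "(\<beta> # \<Gamma>, \<alpha>) \<in> interp arr (Suc n) M" if "list_all2 (\<le>) \<Gamma> \<Delta>" "(\<beta> # \<Delta>, \<alpha>) \<in> interp arr (Suc n) M" for \<beta> \<Delta>
    using interp_down(1)[OF that(2), of "\<beta> # \<Gamma>"] that(1) by simp
  moreover have "list_all2 (\<le>) \<Gamma> \<Gamma>" by (simp add: list_all2_refl)
  ultimately show ?thesis
    using interp_psubst(1)[where m = "Suc n" and \<sigma> = "case_nat N Var" and \<alpha> = \<alpha>, OF assms(1) in_n assms(3)]
    unfolding subst_0 inst by blast
qed

section \<open>Invariance of the interpretation under reduction\<close>

lemma interp_taubar_sum: "interp arr n (taubar_sum ps) = interp arr n (TSum ps)"
proof -
  have "meet {\<beta>. \<exists>Q. (\<beta>, Q) \<in> set (filter (\<lambda>(\<alpha>, Q). \<alpha> \<noteq> top) ps) \<and> \<Gamma> \<in> interp_test arr n Q} =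
    meet {\<beta>. \<exists>Q. (\<beta>, Q) \<in> set ps \<and> \<Gamma> \<in> interp_test arr n Q}" for \<Gamma>
    by (subst meet_without_top[OF finite_summands, symmetric]) (auto intro: arg_cong[of _ _ meet])
  then show ?thesis
    by (intro set_eqI) (simp only: taubar_sum_def interp_TSum split_paired_all)
qed

lemma interp_tau: "tm_in n M \<Longrightarrow> \<Gamma> \<in> interp_test arr n (tau \<alpha> M) \<longleftrightarrow> length \<Gamma> = n \<and> (\<Gamma>, \<alpha>) \<in> interp arr n M"
  using interp_length(1)[of \<Gamma> \<alpha> n M] by (auto simp: tau_def interp_top(1))

lemma interp_epsbar: "(\<Gamma>, \<alpha>) \<in> interp arr n (epsbar \<beta>) \<longleftrightarrow> length \<Gamma> = n \<and> \<beta> \<le> \<alpha>"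
proof (cases "length \<Gamma> = n")
  case True
  then have "{b. \<exists>Q. (b, Q) \<in> set [(\<beta>, QProd [])] \<and> \<Gamma> \<in> interp_test arr n Q} = {\<beta>}" by auto
  then show ?thesis unfolding epsbar_def interp_taubar_sum interp_TSum by simp
qed (use interp_length(1) in blast)

lemma meet_UN_ext: "finite A \<Longrightarrow> meet (arrows (\<Union>a\<in>A. ext a)) = meet A"
  by (induction A rule: finite_induct)
    (simp_all add: arrows_Un meet_union represents_eq[OF ext], simp add: arrows_def)

lemma set_applied_sum:
  "(c, Q') \<in> set [(\<gamma>, QProd [Q, tau \<beta> N]). (\<alpha>, Q) \<leftarrow> ps, (\<beta>, \<gamma>) \<leftarrow> ext_list ext \<alpha>] \<longleftrightarrow>
    (\<exists>a Q b. (a, Q) \<in> set ps \<and> (b, c) \<in> ext a \<and> Q' = QProd [Q, tau b N])"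
proof (induction ps)
  case (Cons p ps)
  obtain a Q where p: "p = (a, Q)" by (cases p)
  have "(c, Q') \<in> set [(\<gamma>, QProd [Q, tau \<beta> N]). (\<beta>, \<gamma>) \<leftarrow> ext_list ext a] \<longleftrightarrow>
    (\<exists>b. (b, c) \<in> ext a \<and> Q' = QProd [Q, tau b N])"
    by (force simp: image_iff)
  then show ?case using Cons.IH unfolding p by (simp del: set_map) blast
qed simp

lemma interp_sum_app:
  assumes "tm_in n N"
    and qs: "\<And>c Q'. (c, Q') \<in> set qs \<longleftrightarrow> (\<exists>a Q b. (a, Q) \<in> set ps \<and> (b, c) \<in> ext a \<and> Q' = QProd [Q, tau b N])"
  shows "interp arr n (App (TSum ps) N) = interp arr n (TSum qs)"
proof -
  have "(\<Gamma>, \<alpha>) \<in> interp arr n (App (TSum ps) N) \<longleftrightarrow> (\<Gamma>, \<alpha>) \<in> interp arr n (TSum qs)"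
    if len: "length \<Gamma> = n" for \<Gamma> \<alpha>
  proof -
    let ?A = "{\<beta>. \<exists>Q. (\<beta>, Q) \<in> set ps \<and> \<Gamma> \<in> interp_test arr n Q}"
    let ?S = "\<Union>a\<in>?A. ext a"
    let ?T = "{c. \<exists>b. (b, c) \<in> ?S \<and> (\<Gamma>, b) \<in> interp arr n N}"
    have finS: "finite ?S" by (simp add: finite_summands)
    have finT: "finite ?T" by (rule finite_subset[of _ "snd ` ?S"]) (use finS in force)+
    have T: "{c. \<exists>Q. (c, Q) \<in> set qs \<and> \<Gamma> \<in> interp_test arr n Q} = ?T"
    proof -
      have "\<Gamma> \<in> interp_test arr n (QProd [Q, tau b N]) \<longleftrightarrow>
        \<Gamma> \<in> interp_test arr n Q \<and> (\<Gamma>, b) \<in> interp arr n N" for Q b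
        using len interp_tau[OF assms(1), of \<Gamma> b] by (simp only: interp_QProd) auto
      then show ?thesis unfolding qs by blast
    qed
    have "(\<Gamma>, \<alpha>) \<in> interp arr n (App (TSum ps) N) \<longleftrightarrow>
      (\<exists>\<beta>. meet (results ?S \<beta>) \<le> \<alpha> \<and> (\<Gamma>, \<beta>) \<in> interp arr n N)"
      using len meet_arrows_le[OF finS] by (simp add: sem_app_iff interp_TSum meet_UN_ext[OF finite_summands])
    also have "\<dots> \<longleftrightarrow> meet ?T \<le> \<alpha>"
    proof
      assume "\<exists>\<beta>. meet (results ?S \<beta>) \<le> \<alpha> \<and> (\<Gamma>, \<beta>) \<in> interp arr n N"
      then obtain \<beta> where b: "meet (results ?S \<beta>) \<le> \<alpha>" "(\<Gamma>, \<beta>) \<in> interp arr n N" by blast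
      have "results ?S \<beta> \<subseteq> ?T" using interp_up(1)[OF b(2)] unfolding results_def by blast
      then show "meet ?T \<le> \<alpha>" using b(1) by (rule order.trans[OF meet_antimono[OF finT]])
    next
      assume le: "meet ?T \<le> \<alpha>"
      \<comment> \<open>Only the finitely many left components of \<open>?S\<close> can matter, so
        the meet of those that \<open>N\<close> has is the best possible argument type.\<close>
      let ?B = "{b \<in> fst ` ?S. (\<Gamma>, b) \<in> interp arr n N}"
      have finB: "finite ?B" using finS by simp
      have "?T \<subseteq> results ?S (meet ?B)"
      proof
        fix c assume "c \<in> ?T"
        then obtain b where b: "(b, c) \<in> ?S" "(\<Gamma>, b) \<in> interp arr n N" by blast
        then have "meet ?B \<le> b" by (intro meet_lower[OF finB]) force
        then show "c \<in> results ?S (meet ?B)"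
        unfolding results_def using b(1) by (intro CollectI exI[of _ b] conjI)
      qed
      then have "meet (results ?S (meet ?B)) \<le> \<alpha>"
        using le by (rule order.trans[OF meet_antimono[OF finite_results[OF finS]]])
      moreover have "(\<Gamma>, meet ?B) \<in> interp arr n N"
        using finB by (intro interp_meet[OF assms(1) len]) auto
      ultimately show "\<exists>\<beta>. meet (results ?S \<beta>) \<le> \<alpha> \<and> (\<Gamma>, \<beta>) \<in> interp arr n N" by blast
    qed
    also have "\<dots> \<longleftrightarrow> (\<Gamma>, \<alpha>) \<in> interp arr n (TSum qs)" using len by (simp only: interp_TSum T simp_thms)
    finally show ?thesis .
  qed
  then show ?thesis using interp_length(1) by fast
qed

text \<open>The types of \<open>epsbar \<beta>\<close> are exactly those above \<beta>, so
  substituting it amounts to assuming \<beta> for the bound variable.\<close>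

lemma interp_tau_lam:
  assumes "tm_in (Suc n) M"
  shows "interp_test arr n (Tau \<alpha> (Lam M)) =
    interp_test arr n (QProd [tau \<gamma> (subst 0 (epsbar \<beta>) M). (\<beta>, \<gamma>) \<leftarrow> ext_list ext \<alpha>])"
proof -
  have in_n: "tm_in n (epsbar \<beta>)" for \<beta> :: 'd by (simp add: epsbar_def taubar_sum_def)
  have "\<Gamma> \<in> interp_test arr n (tau \<gamma> (subst 0 (epsbar \<beta>) M)) \<longleftrightarrow> (\<beta> # \<Gamma>, \<gamma>) \<in> interp arr (Suc n) M"
    if len: "length \<Gamma> = n" for \<Gamma> \<beta> \<gamma>
  proof -
    have "(\<beta> # \<Gamma>, \<gamma>) \<in> interp arr (Suc n) M" if "\<beta> \<le> b" "(b # \<Gamma>, \<gamma>) \<in> interp arr (Suc n) M" for b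
      using interp_down(1)[OF that(2), of "\<beta> # \<Gamma>"] that(1) by (simp add: list_all2_refl)
    then show ?thesis
      using len by (auto simp: interp_tau[OF tm_in_subst[OF assms in_n]] interp_subst[OF assms in_n]
          interp_epsbar)
  qed
  then have "\<Gamma> \<in> interp_test arr n (QProd [tau \<gamma> (subst 0 (epsbar \<beta>) M). (\<beta>, \<gamma>) \<leftarrow> ext_list ext \<alpha>]) \<longleftrightarrow>
    length \<Gamma> = n \<and> (\<forall>(\<beta>, \<gamma>) \<in> ext \<alpha>. (\<beta> # \<Gamma>, \<gamma>) \<in> interp arr (Suc n) M)" for \<Gamma>
    by (auto simp: interp_QProd case_prod_beta simp del: interp_test.simps)
  moreover have "\<Gamma> \<in> interp_test arr n (Tau \<alpha> (Lam M)) \<longleftrightarrow>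
    length \<Gamma> = n \<and> (\<forall>(\<beta>, \<gamma>) \<in> ext \<alpha>. (\<beta> # \<Gamma>, \<gamma>) \<in> interp arr (Suc n) M)" for \<Gamma>
    using interp_Lam[OF assms, of \<Gamma> \<alpha>] interp_length(1)[of \<Gamma> \<alpha> n "Lam M"] by auto
  ultimately show ?thesis by blast
qed

lemma interp_tau_sum:
  "interp_test arr n (Tau \<alpha> (TSum ps)) =
    interp_test arr n (QSum [QProd (map snd J). J \<leftarrow> subseqs ps, meet (fst ` set J) \<le> \<alpha>])"
proof -
  let ?A = "\<lambda>\<Gamma>. {\<beta>. \<exists>Q. (\<beta>, Q) \<in> set ps \<and> \<Gamma> \<in> interp_test arr n Q}"
  have "meet (?A \<Gamma>) \<le> \<alpha> \<longleftrightarrow>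
    (\<exists>J\<in>set (subseqs ps). meet (fst ` set J) \<le> \<alpha> \<and> (\<forall>Q\<in>snd ` set J. \<Gamma> \<in> interp_test arr n Q))" for \<Gamma>
  proof
    assume le: "meet (?A \<Gamma>) \<le> \<alpha>"
    let ?J = "{p \<in> set ps. \<Gamma> \<in> interp_test arr n (snd p)}"
    obtain J where J: "J \<in> set (subseqs ps)" "set J = ?J"
      using subseqs_powset[of ps] by (metis (no_types, lifting) Pow_iff image_iff mem_Collect_eq subsetI)
    have "fst ` ?J = ?A \<Gamma>" by force
    then show "\<exists>J\<in>set (subseqs ps). meet (fst ` set J) \<le> \<alpha> \<and> (\<forall>Q\<in>snd ` set J. \<Gamma> \<in> interp_test arr n Q)"
      using J le by (intro bexI[of _ J]) auto
  next
    assume "\<exists>J\<in>set (subseqs ps). meet (fst ` set J) \<le> \<alpha> \<and> (\<forall>Q\<in>snd ` set J. \<Gamma> \<in> interp_test arr n Q)"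
    then obtain J where J: "J \<in> set (subseqs ps)" "meet (fst ` set J) \<le> \<alpha>"
      "\<forall>Q\<in>snd ` set J. \<Gamma> \<in> interp_test arr n Q" by blast
    have "set J \<subseteq> set ps" using J(1) subseqs_powset[of ps] by blast
    then have "fst ` set J \<subseteq> ?A \<Gamma>" using J(3) by force
    then show "meet (?A \<Gamma>) \<le> \<alpha>" using J(2) by (rule order.trans[OF meet_antimono[OF finite_summands]])
  qed
  then show ?thesis by (auto simp: interp_TSum)
qed

lemma hstep_sound:
  shows "hstep ext M M' \<Longrightarrow> tm_in n M \<Longrightarrow> tm_in n M' \<and> interp arr n M' = interp arr n M"
    and "hstep_test ext Q Q' \<Longrightarrow> test_in n Q \<Longrightarrow>
      test_in n Q' \<and> interp_test arr n Q' = interp_test arr n Q"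
proof (induction arbitrary: n and n rule: hstep_hstep_test.inducts)
  case (beta M N)
  then have MN: "tm_in (Suc n) M" "tm_in n N" by auto
  have "(\<Gamma>, \<alpha>) \<in> interp arr n (subst 0 N M) \<longleftrightarrow> (\<Gamma>, \<alpha>) \<in> interp arr n (App (Lam M) N)"
    if "length \<Gamma> = n" for \<Gamma> \<alpha>
    using interp_subst[OF MN that] interp_Lam_arr[OF MN(1) that]
    unfolding interp.simps(3) sem_app_iff by blast
  then show ?case using interp_length(1) tm_in_subst[OF MN] by fast
next
  case (sum_app ps N)
  have "tm_in n (taubar_sum [(\<gamma>, QProd [Q, tau \<beta> N]). (\<alpha>, Q) \<leftarrow> ps, (\<beta>, \<gamma>) \<leftarrow> ext_list ext \<alpha>])"
    using sum_app unfolding taubar_sum_def by (fastforce simp: tau_def)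
  then show ?case
    using interp_sum_app[of n N, OF _ set_applied_sum] sum_app unfolding interp_taubar_sum by simp
next
  case (tau_lam \<alpha> M)
  then have M: "tm_in (Suc n) M" "\<alpha> \<noteq> top" by auto
  have "tm_in n (epsbar \<beta>)" for \<beta> :: 'd by (simp add: epsbar_def taubar_sum_def)
  then have "tm_in n (subst 0 (epsbar \<beta>) M)" for \<beta> using tm_in_subst M by blast
  then show ?case using interp_tau_lam[OF M(1)] by (auto simp: tau_def simp del: interp_test.simps)
next
  case (tau_sum \<alpha> ps)
  have "test_in n Q" if "J \<in> set (subseqs ps)" "Q \<in> snd ` set J" for J Q
  proof -
    have "set J \<subseteq> set ps" using that(1) subseqs_powset[of ps] by blast
    then show ?thesis using that(2) tau_sum by auto
  qed
  then show ?case using interp_tau_sum by (auto simp del: interp_test.simps)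
next
  case (prod_distr Ps Qs Rs)
  then show ?case by auto
next
  case (taubar_distr ps \<alpha> Qs rs)
  have "{\<beta>. \<exists>Q. (\<beta>, Q) \<in> set (ps @ map (Pair \<alpha>) Qs @ rs) \<and> \<Gamma> \<in> interp_test arr n Q} =
    {\<beta>. \<exists>Q. (\<beta>, Q) \<in> set (ps @ (\<alpha>, QSum Qs) # rs) \<and> \<Gamma> \<in> interp_test arr n Q}" for \<Gamma>
  proof -
    have "(\<exists>Q. (\<beta>, Q) \<in> set (ps @ map (Pair \<alpha>) Qs @ rs) \<and> P Q) \<longleftrightarrow> (\<exists>Q. (\<beta>, Q) \<in> set ps \<and> P Q) \<or>
        (\<beta> = \<alpha> \<and> (\<exists>Q\<in>set Qs. P Q)) \<or> (\<exists>Q. (\<beta>, Q) \<in> set rs \<and> P Q)"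
      "(\<exists>Q. (\<beta>, Q) \<in> set (ps @ (\<alpha>, QSum Qs) # rs) \<and> P Q) \<longleftrightarrow> (\<exists>Q. (\<beta>, Q) \<in> set ps \<and> P Q) \<or>
        (\<beta> = \<alpha> \<and> P (QSum Qs)) \<or> (\<exists>Q. (\<beta>, Q) \<in> set rs \<and> P Q)" for \<beta> P
      by auto
    then show ?thesis by (simp only: interp_QSum)
  qed
  then have "interp arr n (TSum (ps @ map (Pair \<alpha>) Qs @ rs)) = interp arr n (TSum (ps @ (\<alpha>, QSum Qs) # rs))"
    by (intro set_eqI) (simp only: interp_TSum split_paired_all)
  then show ?case using taubar_distr by auto
next
  case (ctx_lam M M')
  then show ?case using ctx_lam.IH(2)[of "Suc n"] by simp
next
  case (ctx_taubar Q Q' ps \<alpha> rs)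
  have IH: "test_in n Q'" "interp_test arr n Q' = interp_test arr n Q"
    using ctx_taubar.IH(2)[of n] ctx_taubar.prems by auto
  have "interp arr n (TSum (ps @ (\<alpha>, Q') # rs)) = interp arr n (TSum (ps @ (\<alpha>, Q) # rs))"
    using IH(2) unfolding interp.simps(4) by simp
  then show ?case using ctx_taubar.prems IH(1) by auto
qed auto

lemma hsteps_sound:
  "(hstep ext)\<^sup>*\<^sup>* M M' \<Longrightarrow> tm_in n M \<Longrightarrow> tm_in n M' \<and> interp arr n M' = interp arr n M"
  by (induction rule: rtranclp_induct) (use hstep_sound(1) in blast)+

lemma hsteps_test_sound:
  "(hstep_test ext)\<^sup>*\<^sup>* Q Q' \<Longrightarrow> test_in n Q \<Longrightarrow> test_in n Q' \<and> interp_test arr n Q' = interp_test arr n Q"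
  by (induction rule: rtranclp_induct) (use hstep_sound(2) in blast)+

section \<open>Head-normal forms have a non-trivial interpretation\<close>

text \<open>Every argument is given the type \<omega>, and the head variable the arrow type from
  \<omega> to \<alpha> iterated along the spine.\<close>

lemma var_headed_interp:
  "var_headed M \<Longrightarrow> tm_in n M \<Longrightarrow> \<exists>\<Gamma>. length \<Gamma> = n \<and> (\<Gamma>, \<alpha>) \<in> interp arr n M"
proof (induction M arbitrary: \<alpha> rule: var_headed.induct)
  case (1 i)
  then show ?case by (intro exI[of _ "replicate n \<alpha>"]) (simp add: sem_var_def)
next
  case (2 M N)
  then obtain \<Gamma> where "length \<Gamma> = n" "(\<Gamma>, arr top \<alpha>) \<in> interp arr n M" by fastforce
  moreover from this have "(\<Gamma>, top) \<in> interp arr n N" using 2(3) interp_top(1) by simp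
  ultimately show ?case by (auto simp: sem_app_iff)
qed auto

lemma test_hnf_interp: "test_hnf Q \<Longrightarrow> test_in n Q \<Longrightarrow> \<exists>\<Gamma>. length \<Gamma> = n \<and> \<Gamma> \<in> interp_test arr n Q"
proof (induction Q rule: test_hnf.induct)
  case (1 M \<alpha>)
  then show ?case using var_headed_interp by simp
next
  case (2 Qs)
  have "\<exists>\<Gamma>. length \<Gamma> = n \<and> (\<forall>Q\<in>set Qs. \<Gamma> \<in> interp_test arr n Q)"
    by (rule common_context[where n = n]) (use 2 interp_down(2) in auto)
  then show ?case by (auto simp: interp_QProd)
qed

lemma test_mhnf_interp: "test_mhnf Q \<Longrightarrow> test_in n Q \<Longrightarrow> interp_test arr n Q \<noteq> {}"
proof (induction Q rule: test_mhnf.induct)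
  case (1 Q)
  then show ?case using test_hnf_interp by blast
next
  case (2 Q Qs)
  then have "interp_test arr n Q \<noteq> {}" by simp
  then show ?case using 2(1) by auto
qed

lemma tm_mhnf_interp:
  "tm_mhnf M \<Longrightarrow> tm_in n M \<Longrightarrow> \<exists>\<alpha>::'d. \<alpha> \<noteq> top \<Longrightarrow> \<exists>\<Gamma> \<alpha>. \<alpha> \<noteq> top \<and> (\<Gamma>, \<alpha>) \<in> interp arr n M"
proof (induction M arbitrary: n rule: tm_mhnf.induct)
  case (1 M)
  then show ?case using var_headed_interp by blast
next
  case (2 M)
  then obtain \<Gamma>' \<alpha> where G: "\<alpha> \<noteq> top" "(\<Gamma>', \<alpha>) \<in> interp arr (Suc n) M" by fastforce
  then obtain \<beta> \<Gamma> where "\<Gamma>' = \<beta> # \<Gamma>" "length \<Gamma> = n"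
    using interp_length(1)[OF G(2)] by (cases \<Gamma>') auto
  then have "(\<Gamma>, arr \<beta> \<alpha>) \<in> interp arr n (Lam M)" using interp_Lam_arr[of n M \<Gamma> \<beta> \<alpha>] 2(3) G(2) by simp
  moreover have "arr \<beta> \<alpha> \<noteq> top" using G(1) by simp
  ultimately show ?case by blast
next
  case (3 \<alpha> Q ps)
  then have "test_in n Q" "\<alpha> \<noteq> top" by auto
  then obtain \<Gamma> where "length \<Gamma> = n" "\<Gamma> \<in> interp_test arr n Q" using test_hnf_interp 3(2) by blast
  then have "(\<Gamma>, \<alpha>) \<in> interp arr n (TSum ps)"
    using 3(1) by (auto simp: interp_TSum intro!: meet_lower finite_summands)
  then show ?case using \<open>\<alpha> \<noteq> top\<close> by blast
qed

lemma converges_interp: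
  assumes "converges ext M" "tm_in n M" "\<exists>\<alpha>::'d. \<alpha> \<noteq> top"
  shows "interp arr n M \<noteq> sem_bot n"
proof -
  obtain N where "(hstep ext)\<^sup>*\<^sup>* M N" "tm_mhnf N" using assms(1) by (auto simp: converges_def)
  then show ?thesis
    using hsteps_sound[of M N n] tm_mhnf_interp[of N n] assms(2,3) by (auto simp: sem_bot_def)
qed

lemma test_converges_interp:
  assumes "test_converges ext Q" "test_in n Q"
  shows "interp_test arr n Q \<noteq> {}"
  using assms hsteps_test_sound[of Q _ n] test_mhnf_interp[of _ n] unfolding test_converges_def by metis

end

section \<open>Weak head reduction\<close>

definition applied_sum ::
  "('d::bounded_semilattice_inf_top \<Rightarrow> ('d \<times> 'd) set) \<Rightarrow> ('d \<times> 'd test) list \<Rightarrow> 'd tm \<Rightarrow> ('d \<times> 'd test) list"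
  where
  "applied_sum ext ps N = filter (\<lambda>(\<alpha>, Q). \<alpha> \<noteq> top)
     [(\<gamma>, QProd [Q, tau \<beta> N]). (\<alpha>, Q) \<leftarrow> ps, (\<beta>, \<gamma>) \<leftarrow> ext_list ext \<alpha>]"

text \<open>The part of \<open>hstep\<close> that acts on the spine of an application, neither under
  abstractions nor inside tests. Unlike full head reduction, which may choose among summands and
  factors, it is deterministic.\<close>

inductive wstep :: "('d::bounded_semilattice_inf_top \<Rightarrow> ('d \<times> 'd) set) \<Rightarrow> 'd tm \<Rightarrow> 'd tm \<Rightarrow> bool"
  for ext where
  wbeta: "wstep ext (App (Lam M) N) (subst 0 N M)"
| wsum: "wstep ext (App (TSum ps) N) (TSum (applied_sum ext ps N))"
| wapp: "wstep ext M M' \<Longrightarrow> wstep ext (App M N) (App M' N)"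

lemma wstep_hstep: "wstep ext M M' \<Longrightarrow> hstep ext M M'"
  and wstep_App: "wstep ext M M' \<Longrightarrow> \<exists>P N. M = App P N"
proof -
  have "hstep ext M M' \<and> (\<exists>P N. M = App P N)" if "wstep ext M M'"
    using that
  proof (induction rule: wstep.induct)
    case (wsum ps N)
    then show ?case
      using sum_app[of ext ps N] by (simp only: taubar_sum_def applied_sum_def[symmetric]) blast
  qed (auto intro: beta ctx_app)
  then show "wstep ext M M' \<Longrightarrow> hstep ext M M'" "wstep ext M M' \<Longrightarrow> \<exists>P N. M = App P N" by blast+
qed

inductive_cases wstep_AppE: "wstep ext (App M N) L"
inductive_cases wstep_LamE [elim!]: "wstep ext (Lam M) L"
inductive_cases wstep_TSumE [elim!]: "wstep ext (TSum ps) L"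
inductive_cases wstep_VarE [elim!]: "wstep ext (Var i) L"

lemma wstep_deterministic: "wstep ext M L \<Longrightarrow> wstep ext M L' \<Longrightarrow> L = L'"
proof (induction arbitrary: L' rule: wstep.induct)
  case (wbeta M N)
  then show ?case by (rule wstep_AppE) auto
next
  case (wsum ps N)
  then show ?case by (rule wstep_AppE) auto
next
  case (wapp M M' N)
  from wapp.prems show ?case
  proof (rule wstep_AppE)
    show ?thesis if "L' = App P N" "wstep ext M P" for P
      using that wapp.IH by blast
  qed (use wapp.hyps in auto)
qed

lemma var_headed_not_wstep: "var_headed M \<Longrightarrow> \<not> wstep ext M L"
proof (induction M arbitrary: L rule: var_headed.induct)
  case (2 M N)
  then show ?case by (auto elim!: wstep_AppE)
qed auto

definition whnf :: "'d tm \<Rightarrow> bool" where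
  "whnf M \<longleftrightarrow> var_headed M \<or> (\<exists>N. M = Lam N) \<or> (\<exists>ps. M = TSum ps)"

lemma whnf_simps [simp]: "whnf (Lam M)" "whnf (TSum ps)" "var_headed M \<Longrightarrow> whnf M"
  by (auto simp: whnf_def)

lemma whnf_not_wstep: "whnf M \<Longrightarrow> \<not> wstep ext M L"
  by (auto simp: whnf_def var_headed_not_wstep)

lemma whnf_or_wstep: "whnf M \<or> (\<exists>L. wstep ext M L)"
  using wbeta wsum wapp by (induction M) (unfold whnf_def, fastforce+)

abbreviation wsteps :: "('d::bounded_semilattice_inf_top \<Rightarrow> ('d \<times> 'd) set) \<Rightarrow> 'd tm \<Rightarrow> 'd tm \<Rightarrow> bool" where
  "wsteps ext \<equiv> (wstep ext)\<^sup>*\<^sup>*"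

lemma whnf_wsteps: "wsteps ext M L \<Longrightarrow> whnf M \<Longrightarrow> L = M"
  by (metis converse_rtranclpE whnf_not_wstep)

lemma wsteps_join: "wsteps ext M W \<Longrightarrow> whnf W \<Longrightarrow> wsteps ext M L \<Longrightarrow> wsteps ext L W"
proof (induction rule: converse_rtranclp_induct)
  case base
  then show ?case using whnf_wsteps by blast
next
  case (step M M')
  from step.prems(2) show ?case
  proof (cases rule: converse_rtranclpE)
    case base
    then show ?thesis using step.hyps by (auto intro: converse_rtranclp_into_rtranclp)
  next
    case (step M'')
    then show ?thesis using wstep_deterministic \<open>wstep ext M M'\<close> step.IH \<open>whnf W\<close> by metis
  qed
qed

lemma wsteps_unique: "wsteps ext M W \<Longrightarrow> whnf W \<Longrightarrow> wsteps ext M W' \<Longrightarrow> whnf W' \<Longrightarrow> W = W'"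
  using wsteps_join whnf_wsteps by metis

lemma wsteps_app: "wsteps ext M M' \<Longrightarrow> wsteps ext (App M N) (App M' N)"
  by (induction rule: rtranclp_induct) (auto intro: wapp rtranclp.rtrancl_into_rtrancl)

lemma psubst_applied_sum:
  "applied_sum ext (map (map_prod id (psubst_test \<sigma>)) ps) (psubst \<sigma> N) =
   map (map_prod id (psubst_test \<sigma>)) (applied_sum ext ps N)"
proof (induction ps)
  case (Cons p ps)
  have tau: "psubst_test \<sigma> (tau \<beta> N) = tau \<beta> (psubst \<sigma> N)" for \<beta> by (simp add: tau_def)
  have "filter (\<lambda>(\<alpha>, Q). \<alpha> \<noteq> top) (map (\<lambda>(\<beta>, \<gamma>). (\<gamma>, QProd [psubst_test \<sigma> Q, tau \<beta> (psubst \<sigma> N)])) xs) =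
    map (map_prod id (psubst_test \<sigma>)) (filter (\<lambda>(\<alpha>, Q). \<alpha> \<noteq> top) (map (\<lambda>(\<beta>, \<gamma>). (\<gamma>, QProd [Q, tau \<beta> N])) xs))"
    for Q xs
    by (induction xs) (auto simp: tau)
  then show ?case using Cons unfolding applied_sum_def by (cases p) (simp add: id_def)
qed (simp add: applied_sum_def)

lemma wstep_psubst: "wstep ext M M' \<Longrightarrow> wstep ext (psubst \<sigma> M) (psubst \<sigma> M')"
proof (induction rule: wstep.induct)
  case (wbeta M N)
  then show ?case using wstep.wbeta by (auto simp: psubst_subst)
next
  case (wsum ps N)
  then show ?case
    using wstep.wsum[of ext "map (map_prod id (psubst_test \<sigma>)) ps" "psubst \<sigma> N"]
    by (simp add: psubst_applied_sum)
qed (auto intro: wapp)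

lemma wsteps_psubst: "wsteps ext M M' \<Longrightarrow> wsteps ext (psubst \<sigma> M) (psubst \<sigma> M')"
  by (induction rule: rtranclp_induct) (auto intro: wstep_psubst rtranclp.rtrancl_into_rtrancl)

text \<open>By determinism the reduction of the instance copies that of \<open>M\<close> until
  \<open>M\<close> is weak head normal. From then on only a head variable of \<open>M\<close> can
  make the instance reduce further.\<close>

lemma wsteps_reflect:
  "wsteps ext (psubst \<sigma> M) W \<Longrightarrow> whnf W \<Longrightarrow>
   \<exists>M'. wsteps ext M M' \<and> whnf M' \<and> wsteps ext (psubst \<sigma> M') W \<and> (var_headed M' \<or> psubst \<sigma> M' = W)"
proof (induction "psubst \<sigma> M" arbitrary: M rule: converse_rtranclp_induct)
  case base
  have "whnf M" using whnf_or_wstep[of M ext] whnf_not_wstep[OF base.prems] wstep_psubst base(1) by metis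
  then show ?case using base by blast
next
  case (step Y)
  show ?case
  proof (cases "whnf M")
    case True
    have "var_headed M \<or> psubst \<sigma> M = W"
      using True step.hyps whnf_not_wstep[of "psubst \<sigma> M"] by (auto simp: whnf_def)
    moreover have "wsteps ext (psubst \<sigma> M) W"
      using step.hyps(1,2) by (rule converse_rtranclp_into_rtranclp)
    ultimately show ?thesis using True by blast
  next
    case False
    then obtain L where L: "wstep ext M L" using whnf_or_wstep by blast
    then have "Y = psubst \<sigma> L" using wstep_psubst wstep_deterministic step.hyps(1) by metis
    from step.hyps(3)[OF this step.prems] show ?thesis
      using converse_rtranclp_into_rtranclp[of "wstep ext", OF L] by blast
  qed
qed

text \<open>The terms with a weak head normal form that is not an abstraction. Sums are included
  because a sum applied to an argument becomes a sum again.\<close>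

definition neutral :: "('d::bounded_semilattice_inf_top \<Rightarrow> ('d \<times> 'd) set) \<Rightarrow> 'd tm \<Rightarrow> bool" where
  "neutral ext M \<longleftrightarrow> (\<exists>H. wsteps ext M H \<and> (var_headed H \<or> (\<exists>ps. H = TSum ps)))"

lemma neutral_wsteps: "wsteps ext M M' \<Longrightarrow> neutral ext M \<longleftrightarrow> neutral ext M'"
  unfolding neutral_def using wsteps_join whnf_simps(2,3) by (metis rtranclp_trans)

lemma neutral_App:
  assumes "neutral ext M" shows "neutral ext (App M N)"
proof -
  obtain H where H: "wsteps ext M H" "var_headed H \<or> (\<exists>ps. H = TSum ps)"
    using assms by (auto simp: neutral_def)
  have "neutral ext (App H N)"
    using H(2) wsum unfolding neutral_def by (metis r_into_rtranclp rtranclp.rtrancl_refl var_headed.simps(2))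
  then show ?thesis using neutral_wsteps[OF wsteps_app[OF H(1)]] by blast
qed

lemma neutral_simps [simp]: "neutral ext (TSum ps)" "var_headed M \<Longrightarrow> neutral ext M"
  unfolding neutral_def by blast+

text \<open>\<open>hconv k M\<close> bounds the number of abstractions of the head-normal form of \<open>M\<close>; arbitrary sums are
  accepted as heads.\<close>

inductive hconv :: "('d::bounded_semilattice_inf_top \<Rightarrow> ('d \<times> 'd) set) \<Rightarrow> nat \<Rightarrow> 'd tm \<Rightarrow> bool"
  for ext where
  hconv_neutral: "neutral ext M \<Longrightarrow> hconv ext k M"
| hconv_Lam: "wsteps ext M (Lam N) \<Longrightarrow> hconv ext k N \<Longrightarrow> hconv ext (Suc k) M"

lemma hconv_wsteps: "wsteps ext M M' \<Longrightarrow> hconv ext k M \<longleftrightarrow> hconv ext k M'"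
proof
  assume M: "wsteps ext M M'"
  show "hconv ext k M'" if "hconv ext k M"
    using that
  proof cases
    case hconv_neutral
    then show ?thesis using neutral_wsteps[OF M] hconv.hconv_neutral by blast
  next
    case (hconv_Lam N k)
    then show ?thesis using wsteps_join[OF _ whnf_simps(1) M] hconv.hconv_Lam by blast
  qed
  show "hconv ext k M" if "hconv ext k M'"
    using that
  proof cases
    case hconv_neutral
    then show ?thesis using neutral_wsteps[OF M] hconv.hconv_neutral by blast
  next
    case (hconv_Lam N k)
    then show ?thesis using rtranclp_trans[OF M] hconv.hconv_Lam by blast
  qed
qed

section \<open>Head convergence of instances and of applied terms\<close>

definition sum_subst :: "(nat \<Rightarrow> 'd tm) \<Rightarrow> bool" where
  "sum_subst \<sigma> \<longleftrightarrow> (\<forall>i. (\<exists>j. \<sigma> i = Var j) \<or> (\<exists>ps. \<sigma> i = TSum ps))"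

lemma sum_subst_up: "sum_subst \<sigma> \<Longrightarrow> sum_subst (up \<sigma>)"
  unfolding sum_subst_def
proof (intro allI)
  fix i assume "\<forall>i. (\<exists>j. \<sigma> i = Var j) \<or> (\<exists>ps. \<sigma> i = TSum ps)"
  then show "(\<exists>j. up \<sigma> i = Var j) \<or> (\<exists>ps. up \<sigma> i = TSum ps)"
    by (cases i) (auto, metis lift.simps(1,4))
qed

lemma neutral_psubst: "sum_subst \<sigma> \<Longrightarrow> var_headed M \<Longrightarrow> neutral ext (psubst \<sigma> M)"
proof (induction M rule: var_headed.induct)
  case (1 i)
  then have "(\<exists>j. \<sigma> i = Var j) \<or> (\<exists>ps. \<sigma> i = TSum ps)" by (simp add: sum_subst_def)
  then show ?case by auto
qed (auto intro: neutral_App)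

text \<open>A sum or a variable put in place of a head variable produces no abstraction, so the same
  bound \<open>k\<close> holds.\<close>

lemma hconv_psubst: "hconv ext k M \<Longrightarrow> sum_subst \<sigma> \<Longrightarrow> hconv ext k (psubst \<sigma> M)"
proof (induction arbitrary: \<sigma> rule: hconv.induct)
  case (hconv_neutral M k)
  then obtain H where H: "wsteps ext M H" "var_headed H \<or> (\<exists>ps. H = TSum ps)"
    by (auto simp: neutral_def)
  then have "neutral ext (psubst \<sigma> H)" using neutral_psubst[OF hconv_neutral.prems] by auto
  then show ?case using neutral_wsteps[OF wsteps_psubst[OF H(1)]] hconv.hconv_neutral by blast
next
  case (hconv_Lam M N k)
  then show ?case
    using wsteps_psubst[OF hconv_Lam.hyps(1), of \<sigma>] sum_subst_up hconv.hconv_Lam by fastforce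
qed

text \<open>An abstraction exposed by \<open>M\<close> is also exposed by its instance and is
  counted there; if a head variable is reached, \<open>M\<close> is neutral, whatever the instance
  does afterwards.\<close>

lemma hconv_reflect: "hconv ext k (psubst \<sigma> M) \<Longrightarrow> hconv ext k M"
proof (induction k "psubst \<sigma> M" arbitrary: \<sigma> M rule: hconv.induct)
  case (hconv_neutral k)
  then obtain H where H: "wsteps ext (psubst \<sigma> M) H" "var_headed H \<or> (\<exists>ps. H = TSum ps)"
    by (auto simp: neutral_def)
  then obtain M' where M': "wsteps ext M M'" "whnf M'" "var_headed M' \<or> psubst \<sigma> M' = H"
    using wsteps_reflect[OF H(1)] whnf_simps(2,3) by metis
  then have "neutral ext M'" using H(2) by (auto simp: whnf_def)
  then show ?case using neutral_wsteps[OF M'(1)] hconv.hconv_neutral by blast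
next
  case (hconv_Lam N k)
  then obtain M' where M': "wsteps ext M M'" "whnf M'" "var_headed M' \<or> psubst \<sigma> M' = Lam N"
    using wsteps_reflect[OF hconv_Lam.hyps(1)] whnf_simps(1) by metis
  show ?case
  proof (cases "var_headed M'")
    case True
    then show ?thesis using neutral_wsteps[OF M'(1)] hconv.hconv_neutral neutral_simps(2) by blast
  next
    case False
    then obtain N' where "M' = Lam N'" "N = psubst (up \<sigma>) N'" using M'(2,3) by (auto simp: whnf_def)
    then show ?thesis using hconv_Lam.hyps(3) M'(1) hconv.hconv_Lam by blast
  qed
qed

lemma wsteps_App_whnf: "wsteps ext (App M N) W \<Longrightarrow> whnf W \<Longrightarrow> \<exists>M'. wsteps ext M M' \<and> whnf M'"
proof (induction "App M N" arbitrary: M rule: converse_rtranclp_induct)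
  case base
  then have "whnf M" by (auto simp: whnf_def)
  then show ?case by blast
next
  case (step Y)
  show ?case
  proof (cases "whnf M")
    case False
    then obtain L where L: "wstep ext M L" using whnf_or_wstep by blast
    then have "Y = App L N" using wapp wstep_deterministic step.hyps(1) by metis
    from step.hyps(3)[OF this step.prems] show ?thesis
      using converse_rtranclp_into_rtranclp[of "wstep ext", OF L] by blast
  qed blast
qed

text \<open>If \<open>M\<close> reduces to an abstraction, the application reduces to an instance of
  its body, and convergence is reflected from the instance to the body.\<close>

lemma hconv_App:
  assumes "hconv ext k (App M N)" shows "\<exists>k. hconv ext k M"
proof -
  have "\<exists>W. wsteps ext (App M N) W \<and> whnf W"
    using assms by cases (auto simp: neutral_def)
  then obtain M' where M': "wsteps ext M M'" "whnf M'" using wsteps_App_whnf by blast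
  show ?thesis
  proof (cases "\<exists>L. M' = Lam L")
    case True
    then obtain L where L: "M' = Lam L" by blast
    have "wsteps ext (App M N) (subst 0 N L)"
      using wsteps_app[OF M'(1), of N] wbeta unfolding L by (metis rtranclp.rtrancl_into_rtrancl)
    then have "hconv ext k L" using assms hconv_wsteps hconv_reflect unfolding subst_0 by metis
    then show ?thesis using M'(1) hconv_Lam unfolding L by blast
  next
    case False
    then have "neutral ext M'" using M'(2) by (auto simp: whnf_def)
    then show ?thesis using neutral_wsteps[OF M'(1)] hconv_neutral by blast
  qed
qed

section \<open>Good tests\<close>

text \<open>A big-step form of may-convergence based on weak head reduction. Its derivations are
  finite, and rule induction on them is what later produces approximants.\<close>

inductive good :: "('d::bounded_semilattice_inf_top \<Rightarrow> ('d \<times> 'd) set) \<Rightarrow> 'd test \<Rightarrow> bool"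
  for ext where
  good_var: "wsteps ext M H \<Longrightarrow> var_headed H \<Longrightarrow> good ext (Tau \<alpha> M)"
| good_lam: "wsteps ext M (Lam N) \<Longrightarrow> (\<And>u v. (u, v) \<in> ext \<alpha> \<Longrightarrow> good ext (tau v (subst 0 (epsbar u) N))) \<Longrightarrow>
    good ext (Tau \<alpha> M)"
| good_sum: "wsteps ext M (TSum ps) \<Longrightarrow> J \<subseteq> set ps \<Longrightarrow> meet (fst ` J) \<le> \<alpha> \<Longrightarrow>
    (\<And>p. p \<in> J \<Longrightarrow> good ext (snd p)) \<Longrightarrow> good ext (Tau \<alpha> M)"
| good_QProd: "(\<And>Q. Q \<in> set Qs \<Longrightarrow> good ext Q) \<Longrightarrow> good ext (QProd Qs)"
| good_QSum: "Q \<in> set Qs \<Longrightarrow> good ext Q \<Longrightarrow> good ext (QSum Qs)"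

inductive_cases good_QProdE: "good ext (QProd Qs)"
lemma good_QProd_iff: "good ext (QProd Qs) \<longleftrightarrow> (\<forall>Q\<in>set Qs. good ext Q)"
  by (auto elim: good_QProdE intro: good_QProd)

lemma test_converges_step:
  "(hstep_test ext)\<^sup>*\<^sup>* Q Q' \<Longrightarrow> test_converges ext Q' \<Longrightarrow> test_converges ext Q"
  unfolding test_converges_def by (meson rtranclp_trans)

lemma QSum_steps:
  "(hstep_test ext)\<^sup>*\<^sup>* Q Q' \<Longrightarrow> (hstep_test ext)\<^sup>*\<^sup>* (QSum (Ps @ Q # Rs)) (QSum (Ps @ Q' # Rs))"
  by (induction rule: rtranclp_induct) (auto intro: ctx_sum rtranclp.rtrancl_into_rtrancl)

lemma QProd_steps:
  "(hstep_test ext)\<^sup>*\<^sup>* Q Q' \<Longrightarrow> (hstep_test ext)\<^sup>*\<^sup>* (QProd (Ps @ Q # Rs)) (QProd (Ps @ Q' # Rs))"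
  by (induction rule: rtranclp_induct) (auto intro: ctx_prod rtranclp.rtrancl_into_rtrancl)

lemma test_converges_QSum:
  assumes "Q \<in> set Qs" "test_converges ext Q" shows "test_converges ext (QSum Qs)"
proof -
  obtain P where P: "(hstep_test ext)\<^sup>*\<^sup>* Q P" "test_mhnf P" using assms(2) by (auto simp: test_converges_def)
  obtain Ps Rs where Qs: "Qs = Ps @ Q # Rs" using assms(1) by (meson split_list)
  have "test_mhnf (QSum (Ps @ P # Rs))" using P(2) by (intro test_mhnf.intros(2)[of P]) auto
  then show ?thesis using QSum_steps[OF P(1)] unfolding test_converges_def Qs by blast
qed

text \<open>Sums are distributed over the product one factor at a time, from left to right, keeping
  the convergent summand; \<open>Ps\<close> collects the factors that are already free of
  sums.\<close>

lemma test_converges_QProd_mhnf: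
  "\<forall>P\<in>set Ps. test_hnf P \<Longrightarrow> \<forall>R\<in>set Rs. test_mhnf R \<Longrightarrow> test_converges ext (QProd (Ps @ Rs))"
proof (induction Rs arbitrary: Ps)
  case Nil
  then have "test_mhnf (QProd Ps)" by (intro test_mhnf.intros(1) test_hnf.intros(2)) simp
  then show ?case by (auto simp: test_converges_def)
next
  case (Cons R Rs)
  have "test_mhnf R" using Cons.prems(2) by simp
  then show ?case
  proof (induction R rule: test_mhnf.induct)
    case (1 Q)
    then show ?case using Cons.IH[of "Ps @ [Q]"] Cons.prems by simp
  next
    case (2 Q Qs)
    have "test_converges ext (QSum [QProd (Ps @ Q # Rs). Q \<leftarrow> Qs])"
      by (rule test_converges_QSum[of "QProd (Ps @ Q # Rs)"]) (use 2 in auto)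
    then show ?case using test_converges_step[OF r_into_rtranclp[of "hstep_test ext", OF prod_distr]] by blast
  qed
qed

lemma test_converges_QProd:
  assumes "\<forall>Q\<in>set Qs. test_converges ext Q" shows "test_converges ext (QProd Qs)"
proof -
  have "\<forall>P\<in>set Ps. test_mhnf P \<Longrightarrow> \<forall>Q\<in>set Qs. test_converges ext Q \<Longrightarrow> test_converges ext (QProd (Ps @ Qs))"
    for Ps
  proof (induction Qs arbitrary: Ps)
    case Nil
    then show ?case using test_converges_QProd_mhnf[of "[]" Ps] by simp
  next
    case (Cons Q Qs)
    then obtain P where P: "(hstep_test ext)\<^sup>*\<^sup>* Q P" "test_mhnf P" by (auto simp: test_converges_def)
    then have "test_converges ext (QProd (Ps @ P # Qs))"
      using Cons.IH[of "Ps @ [P]"] Cons.prems by simp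
    then show ?case using test_converges_step[OF QProd_steps[OF P(1)]] by blast
  qed
  from this[of "[]"] show ?thesis using assms by simp
qed

lemma Tau_steps: "wsteps ext M M' \<Longrightarrow> (hstep_test ext)\<^sup>*\<^sup>* (Tau \<alpha> M) (Tau \<alpha> M')"
proof (induction rule: rtranclp_induct)
  case (step M' M'')
  then have "hstep_test ext (Tau \<alpha> M') (Tau \<alpha> M'')"
    using wstep_hstep wstep_App ctx_tau by metis
  then show ?case using step.IH by simp
qed simp

context extensional_arrow_model
begin

lemma good_test_converges: "good ext Q \<Longrightarrow> test_converges ext Q"
proof (induction rule: good.induct)
  case (good_var M H \<alpha>)
  then have "test_mhnf (Tau \<alpha> H)" by (intro test_mhnf.intros(1) test_hnf.intros(1))
  then show ?case using Tau_steps[OF good_var(1), of \<alpha>] unfolding test_converges_def by blast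
next
  case (good_lam M N \<alpha>)
  have "test_converges ext (QProd [tau \<gamma> (subst 0 (epsbar \<beta>) N). (\<beta>, \<gamma>) \<leftarrow> ext_list ext \<alpha>])"
    by (rule test_converges_QProd) (use good_lam.IH in auto)
  then have "test_converges ext (Tau \<alpha> (Lam N))"
    using test_converges_step[OF r_into_rtranclp[of "hstep_test ext", OF tau_lam]] by blast
  then show ?case using test_converges_step[OF Tau_steps[OF good_lam(1)]] by blast
next
  case (good_sum M ps J \<alpha>)
  obtain K where K: "K \<in> set (subseqs ps)" "set K = J"
    using good_sum(2) subseqs_powset[of ps] by (metis Pow_iff image_iff)
  have "test_converges ext (QProd (map snd K))"
    by (rule test_converges_QProd) (use good_sum.IH K(2) in auto)
  then have "test_converges ext (QSum [QProd (map snd J). J \<leftarrow> subseqs ps, meet (fst ` set J) \<le> \<alpha>])"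
    by (rule test_converges_QSum[rotated]) (use K good_sum(3) in auto)
  then have "test_converges ext (Tau \<alpha> (TSum ps))"
    using test_converges_step[OF r_into_rtranclp[of "hstep_test ext", OF tau_sum]] by blast
  then show ?case using test_converges_step[OF Tau_steps[OF good_sum(1)]] by blast
qed (auto intro: test_converges_QProd test_converges_QSum)

section \<open>The upper bound of the candidates\<close>

definition good_types :: "('d \<times> 'd test) list \<Rightarrow> 'd set" where
  "good_types ps = {\<beta>. \<exists>Q. (\<beta>, Q) \<in> set ps \<and> good ext Q}"

lemma finite_good_types [simp]: "finite (good_types ps)"
  unfolding good_types_def by (rule finite_summands)

text \<open>For fixed \<open>M\<close>, the types at which \<open>\<tau>\<^sub>\<alpha>(M)\<close> is good do not obviously form a filter, as the rule
  for abstractions instantiates the variable with \<open>epsbar u\<close> for \<open>u\<close> depending on \<open>\<alpha>\<close>. The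
  relation \<open>accepts\<close> quantifies over all \<open>u' \<le> u\<close> instead.\<close>

coinductive accepts :: "'d tm \<Rightarrow> 'd \<Rightarrow> bool" where
  "\<alpha> = top \<or> (\<exists>k. hconv ext k M) \<Longrightarrow>
   (\<And>ps. wsteps ext M (TSum ps) \<Longrightarrow> meet (good_types ps) \<le> \<alpha>) \<Longrightarrow>
   (\<And>N u v u'. wsteps ext M (Lam N) \<Longrightarrow> (u, v) \<in> ext \<alpha> \<Longrightarrow> u' \<le> u \<Longrightarrow> accepts (subst 0 (epsbar u') N) v) \<Longrightarrow>
   accepts M \<alpha>"

lemma accepts_hconv: "accepts M \<alpha> \<Longrightarrow> \<alpha> \<noteq> top \<Longrightarrow> \<exists>k. hconv ext k M"
  by (erule accepts.cases) simp

lemma accepts_TSum: "accepts M \<alpha> \<Longrightarrow> wsteps ext M (TSum ps) \<Longrightarrow> meet (good_types ps) \<le> \<alpha>"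
  by (erule accepts.cases) blast

lemma accepts_Lam:
  "accepts M \<alpha> \<Longrightarrow> wsteps ext M (Lam N) \<Longrightarrow> (u, v) \<in> ext \<alpha> \<Longrightarrow> u' \<le> u \<Longrightarrow> accepts (subst 0 (epsbar u') N) v"
  by (erule accepts.cases) blast

lemma meet_UN_ext_le: "finite B \<Longrightarrow> meet B \<le> arr u v \<longleftrightarrow> meet (results (\<Union>b\<in>B. ext b) u) \<le> v"
  using meet_arrows_le[of "\<Union>b\<in>B. ext b" u v] by (simp add: meet_UN_ext)

lemma accepts_meet:
  assumes "finite B" "\<forall>b\<in>B. accepts M b" "meet B \<le> \<alpha>"
  shows "accepts M \<alpha>"
proof -
  \<comment> \<open>The coinduction invariant: \<alpha> is above a finite meet of accepted types. It
    is inherited by the body of an abstraction, with the results of these types as the new finite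
    set.\<close>
  have "\<exists>B. finite B \<and> (\<forall>b\<in>B. accepts M b) \<and> meet B \<le> \<alpha>" using assms by blast
  then show ?thesis
  proof (coinduction arbitrary: M \<alpha>)
    case accepts
    then obtain B where B: "finite B" "\<forall>b\<in>B. accepts M b" "meet B \<le> \<alpha>" by blast
    have "\<alpha> = top \<or> (\<exists>k. hconv ext k M)"
    proof (cases "\<exists>b\<in>B. b \<noteq> top")
      case False
      then have "top \<le> b" if "b \<in> B" for b using that by auto
      then have "top \<le> meet B" using B(1) le_meet_iff by blast
      then show ?thesis using B(3) by (simp add: top_unique)
    qed (use B(2) accepts_hconv in blast)
    moreover have "meet (good_types ps) \<le> \<alpha>" if "wsteps ext M (TSum ps)" for ps
    proof -
      have "meet (good_types ps) \<le> b" if "b \<in> B" for b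
        using accepts_TSum[of M b ps] B(2) that \<open>wsteps ext M (TSum ps)\<close> by blast
      then have "meet (good_types ps) \<le> meet B" using B(1) le_meet_iff by blast
      then show ?thesis using B(3) by (rule order.trans)
    qed
    moreover have "\<exists>B'. finite B' \<and> (\<forall>b\<in>B'. accepts (subst 0 (epsbar u') N) b) \<and> meet B' \<le> v"
      if "wsteps ext M (Lam N)" "(u, v) \<in> ext \<alpha>" "u' \<le> u" for N u v u'
    proof (intro exI conjI ballI)
      \<comment> \<open>A pair from some \<open>ext b\<close> has a left component above
        \<open>u\<close>, hence above \<open>u'\<close>. The quantification over smaller instances
        in \<open>accepts\<close> is made for this step.\<close>
      let ?R = "results (\<Union>b\<in>B. ext b) u"
      show "finite ?R" using B(1) by simp
      show "meet ?R \<le> v"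
        using order.trans[OF B(3) represents_mem[OF ext that(2)]] meet_UN_ext_le[OF B(1)] by blast
      fix w assume "w \<in> ?R"
      then obtain b x where "b \<in> B" "(x, w) \<in> ext b" "u \<le> x" by (auto simp: results_def)
      then show "accepts (subst 0 (epsbar u') N) w"
        using accepts_Lam[of M b N x w u'] B(2) that(1,3) by (meson order.trans)
    qed
    ultimately show ?case
    proof (intro exI[of _ M] exI[of _ \<alpha>] conjI refl, goal_cases)
      case 3
      then show ?case by fast
    qed blast+
  qed
qed

lemma accepts_top: "accepts M top"
  by (rule accepts_meet[of "{}"]) auto

lemma accepts_inf: "inf a b \<le> c \<Longrightarrow> accepts M a \<Longrightarrow> accepts M b \<Longrightarrow> accepts M c"
  by (rule accepts_meet[of "{a, b}"]) auto

lemma accepts_mono: "accepts M a \<Longrightarrow> a \<le> b \<Longrightarrow> accepts M b"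
  using accepts_inf[of a a b] by simp

lemma accepts_wsteps:
  assumes "wsteps ext M M'" shows "accepts M \<alpha> \<longleftrightarrow> accepts M' \<alpha>"
proof -
  have *: "accepts M' \<alpha>"
    if M: "accepts M \<alpha>" and eq: "\<And>W. whnf W \<Longrightarrow> wsteps ext M W \<longleftrightarrow> wsteps ext M' W"
      "\<And>k. hconv ext k M \<longleftrightarrow> hconv ext k M'" for M M'
  proof (rule accepts.intros)
    show "\<alpha> = top \<or> (\<exists>k. hconv ext k M')" using accepts_hconv[OF M] eq(2) by blast
    show "meet (good_types ps) \<le> \<alpha>" if "wsteps ext M' (TSum ps)" for ps
      using accepts_TSum[OF M] that eq(1)[OF whnf_simps(2)] by blast
    show "accepts (subst 0 (epsbar u') N) v" if "wsteps ext M' (Lam N)" "(u, v) \<in> ext \<alpha>" "u' \<le> u" for N u v u'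
      using accepts_Lam[OF M _ that(2,3)] that(1) eq(1)[OF whnf_simps(1)] by blast
  qed
  have "wsteps ext M W \<longleftrightarrow> wsteps ext M' W" if "whnf W" for W
    using wsteps_join[OF _ that assms] rtranclp_trans[OF assms] by blast
  then show ?thesis using *[of M M'] *[of M' M] hconv_wsteps[OF assms] by blast
qed

lemma accepts_var_headed:
  assumes M: "var_headed M" shows "accepts M \<alpha>"
proof (rule accepts.intros)
  show "\<alpha> = top \<or> (\<exists>k. hconv ext k M)" using hconv_neutral[of ext M 0] M by auto
  have eq: "W = M" if "wsteps ext M W" for W using whnf_wsteps[OF that] M by simp
  show "meet (good_types ps) \<le> \<alpha>" if "wsteps ext M (TSum ps)" for ps
    using eq[OF that] M by auto
  show "accepts (subst 0 (epsbar u') N) v" if "wsteps ext M (Lam N)" for N u' v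
    using eq[OF that] M by auto
qed

lemma accepts_TSum_iff: "accepts (TSum ps) \<alpha> \<longleftrightarrow> meet (good_types ps) \<le> \<alpha>"
proof
  assume le: "meet (good_types ps) \<le> \<alpha>"
  show "accepts (TSum ps) \<alpha>"
  proof (rule accepts.intros)
    show "\<alpha> = top \<or> (\<exists>k. hconv ext k (TSum ps))" using hconv_neutral[OF neutral_simps(1)] by blast
    have eq: "W = TSum ps" if "wsteps ext (TSum ps) W" for W using whnf_wsteps[OF that] by simp
    show "meet (good_types ps') \<le> \<alpha>" if "wsteps ext (TSum ps) (TSum ps')" for ps'
      using eq[OF that] le by simp
    show "accepts (subst 0 (epsbar u') N) v" if "wsteps ext (TSum ps) (Lam N)" for N u' v
      using eq[OF that] by simp
  qed
qed (rule accepts_TSum, auto)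

lemma accepts_epsbar: "accepts (epsbar u) v \<longleftrightarrow> u \<le> v"
proof -
  have "good_types [(u, QProd [])] = {u}" by (auto simp: good_types_def good_QProd_iff)
  moreover have "good_types [] = {}" by (simp add: good_types_def)
  ultimately show ?thesis by (simp add: epsbar_def taubar_sum_def accepts_TSum_iff)
qed

lemma neutral_epsbar: "neutral ext (epsbar u)"
  by (simp add: epsbar_def taubar_sum_def)

lemma sum_subst_epsbar: "sum_subst (case_nat (epsbar u) Var)"
  by (auto simp: sum_subst_def epsbar_def taubar_sum_def split: nat.split)

text \<open>Passage from the coinductive to the inductive notion by induction on the bound
  \<open>k\<close>: each use of the abstraction clause consumes one abstraction, and by
  \<open>hconv_psubst\<close> the substituted \<open>epsbar\<close> adds none.\<close>

lemma accepts_good: "accepts M \<alpha> \<Longrightarrow> good ext (tau \<alpha> M)"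
proof (cases "\<alpha> = top")
  case False
  have "hconv ext k M \<Longrightarrow> accepts M \<alpha> \<Longrightarrow> \<alpha> \<noteq> top \<Longrightarrow> good ext (Tau \<alpha> M)" for k
  proof (induction k arbitrary: M \<alpha> rule: less_induct)
    case (less k)
    from less.prems(1) show ?case
    proof cases
      case hconv_neutral
      then obtain H where H: "wsteps ext M H" "var_headed H \<or> (\<exists>ps. H = TSum ps)" by (auto simp: neutral_def)
      show ?thesis
      proof (cases "var_headed H")
        case False
        then obtain ps where ps: "wsteps ext M (TSum ps)" using H by auto
        have "fst ` {p \<in> set ps. good ext (snd p)} = good_types ps" by (force simp: good_types_def)
        then have "meet (fst ` {p \<in> set ps. good ext (snd p)}) \<le> \<alpha>"
          using accepts_TSum[OF less.prems(2) ps] by (simp only:)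
        then show ?thesis by (rule good_sum[OF ps, rotated]) auto
      qed (use H(1) good_var in blast)
    next
      case (hconv_Lam N k')
      have "good ext (tau v (subst 0 (epsbar u) N))" if uv: "(u, v) \<in> ext \<alpha>" for u v
      proof (cases "v = top")
        case False
        have "hconv ext k' (subst 0 (epsbar u) N)"
          unfolding subst_0 using hconv_psubst[OF hconv_Lam(3) sum_subst_epsbar] .
        then have "good ext (Tau v (subst 0 (epsbar u) N))"
          using less.IH[of k'] accepts_Lam[OF less.prems(2) hconv_Lam(2) uv order_refl] hconv_Lam(1) False by simp
        then show ?thesis using False by (simp add: tau_def)
      qed (simp add: tau_def good_QProd_iff)
      then show ?thesis using good_lam[OF hconv_Lam(2)] by blast
    qed
  qed
  then show "accepts M \<alpha> \<Longrightarrow> good ext (tau \<alpha> M)" using False accepts_hconv by (auto simp: tau_def)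
qed (simp add: tau_def good_QProd_iff)

lemma good_tau_epsbar:
  assumes "good ext (tau b (epsbar u))" shows "u \<le> b"
proof (cases "b = top")
  case False
  then have "good ext (Tau b (epsbar u))" using assms by (simp add: tau_def)
  then show ?thesis
  proof cases
    case (good_sum ps J)
    have "epsbar u = TSum (if u = top then [] else [(u, QProd [])])" by (simp add: epsbar_def taubar_sum_def)
    then have "ps = (if u = top then [] else [(u, QProd [])])"
      using whnf_wsteps[OF good_sum(1)] by simp
    then have "J \<subseteq> {(u, QProd [])}" using good_sum(2) by (auto split: if_splits)
    then consider "J = {}" | "J = {(u, QProd [])}" by blast
    then show ?thesis
    proof cases
      case 1
      then show ?thesis using good_sum(3) False by (simp add: top_unique)
    next
      case 2
      then show ?thesis using good_sum(3) by simp
    qed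
  next
    case (good_var H)
    then show ?thesis using whnf_wsteps[OF good_var(1)] by (simp add: epsbar_def taubar_sum_def)
  next
    case (good_lam N)
    then show ?thesis using whnf_wsteps[OF good_lam(1)] by (simp add: epsbar_def taubar_sum_def)
  qed
qed simp

lemma good_types_applied_sum:
  "c \<in> good_types (applied_sum ext ps N) \<longleftrightarrow>
   c \<noteq> top \<and> (\<exists>a \<in> good_types ps. \<exists>b. (b, c) \<in> ext a \<and> good ext (tau b N))"
proof -
  have "(c, Q') \<in> set (applied_sum ext ps N) \<longleftrightarrow>
    c \<noteq> top \<and> (\<exists>a Q b. (a, Q) \<in> set ps \<and> (b, c) \<in> ext a \<and> Q' = QProd [Q, tau b N])" for Q'
    using set_applied_sum[of c Q' N ps] unfolding applied_sum_def set_filter mem_Collect_eq prod.case by blast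
  moreover have "good ext (QProd [Q, Q']) \<longleftrightarrow> good ext Q \<and> good ext Q'" for Q Q'
    by (simp add: good_QProd_iff)
  ultimately show ?thesis unfolding good_types_def mem_Collect_eq Bex_def by metis
qed

lemma wsteps_App_TSum:
  "wsteps ext M (TSum ps) \<Longrightarrow> wsteps ext (App M N) (TSum (applied_sum ext ps N))"
  using wsteps_app[of ext M "TSum ps" N] wsum by (metis rtranclp.rtrancl_into_rtrancl)

lemma wsteps_App_Lam: "wsteps ext M (Lam L) \<Longrightarrow> wsteps ext (App M N) (subst 0 N L)"
  using wsteps_app[of ext M "Lam L" N] wbeta by (metis rtranclp.rtrancl_into_rtrancl)

text \<open>For a sum, every result at \<open>u\<close> other than \<omega> comes from a pair whose
  left component is above \<open>u\<close>; \<open>N\<close> is accepted there, so the test added to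
  the corresponding summand is good.\<close>

lemma accepts_app:
  assumes M: "accepts M a" "neutral ext M" and le: "a \<le> arr u v" and N: "accepts N u"
  shows "accepts (App M N) v"
proof -
  obtain H where H: "wsteps ext M H" "var_headed H \<or> (\<exists>ps. H = TSum ps)" using M(2) by (auto simp: neutral_def)
  show ?thesis
  proof (cases "var_headed H")
    case True
    then show ?thesis
      using accepts_wsteps[OF wsteps_app[OF H(1)]] accepts_var_headed[of "App H N"] by simp
  next
    case False
    then obtain ps where ps: "wsteps ext M (TSum ps)" using H by auto
    have "meet (good_types ps) \<le> arr u v" using accepts_TSum[OF M(1) ps] le by (rule order.trans)
    then have v: "meet (results (\<Union>b\<in>good_types ps. ext b) u) \<le> v" by (simp add: meet_UN_ext_le)
    have "meet (good_types (applied_sum ext ps N)) \<le> w" if w: "w \<in> results (\<Union>b\<in>good_types ps. ext b) u" for w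
    proof (cases "w = top")
      case False
      obtain a b where "a \<in> good_types ps" "(b, w) \<in> ext a" "u \<le> b" using w by (auto simp: results_def)
      then have "w \<in> good_types (applied_sum ext ps N)"
        using accepts_good[OF accepts_mono[OF N]] False by (auto simp: good_types_applied_sum)
      then show ?thesis by (intro meet_lower) auto
    qed simp
    then have "meet (good_types (applied_sum ext ps N)) \<le> meet (results (\<Union>b\<in>good_types ps. ext b) u)"
      by (simp add: le_meet_iff)
    then have "meet (good_types (applied_sum ext ps N)) \<le> v" using v by (rule order.trans)
    then show ?thesis
      using accepts_wsteps[OF wsteps_App_TSum[OF ps]] accepts_TSum_iff by blast
  qed
qed

text \<open>The arguments \<open>epsbar u'\<close> suffice: they are neutral, and they are accepted
  exactly at the types above \<open>u'\<close>. For a sum this makes the good summands of the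
  application results at \<open>u\<close>; convergence of \<open>M\<close> itself follows by
  \<open>hconv_App\<close>.\<close>

lemma accepts_abs:
  assumes "\<And>u v N. a \<le> arr u v \<Longrightarrow> accepts N u \<Longrightarrow> neutral ext N \<Longrightarrow> accepts (App M N) v"
  shows "accepts M a"
proof (rule accepts.intros)
  have eps: "accepts (App M (epsbar u')) v" if "(u, v) \<in> ext a" "u' \<le> u" for u v u'
    using assms[of u v "epsbar u'"] represents_mem[OF ext that(1)] that(2) neutral_epsbar accepts_epsbar by blast
  show "a = top \<or> (\<exists>k. hconv ext k M)"
  proof (cases "\<exists>(u, v) \<in> ext a. v \<noteq> top")
    case True
    then obtain u v where "(u, v) \<in> ext a" "v \<noteq> top" by blast
    then show ?thesis using accepts_hconv[OF eps] hconv_App by blast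
  next
    case False
    then have "\<forall>(u, v) \<in> ext a. top \<le> arr u v" by (auto simp: top_unique)
    then have "top \<le> a" using represents_le_iff[OF ext, of top a] by blast
    then show ?thesis by (simp add: top_unique)
  qed
  show "meet (good_types ps) \<le> a" if ps: "wsteps ext M (TSum ps)" for ps
  proof -
    have "meet (good_types ps) \<le> arr u v" if uv: "(u, v) \<in> ext a" for u v
    proof -
      have "meet (good_types (applied_sum ext ps (epsbar u))) \<le> v"
        using accepts_TSum[OF eps[OF uv order_refl] wsteps_App_TSum[OF ps]] .
      moreover have "good_types (applied_sum ext ps (epsbar u)) \<subseteq> results (\<Union>b\<in>good_types ps. ext b) u"
      proof
        fix c assume "c \<in> good_types (applied_sum ext ps (epsbar u))"
        then obtain a b where "a \<in> good_types ps" "(b, c) \<in> ext a" "u \<le> b"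
          using good_tau_epsbar by (auto simp: good_types_applied_sum)
        then show "c \<in> results (\<Union>b\<in>good_types ps. ext b) u" unfolding results_def by blast
      qed
      then have "meet (results (\<Union>b\<in>good_types ps. ext b) u) \<le> meet (good_types (applied_sum ext ps (epsbar u)))"
        by (intro meet_antimono) auto
      ultimately show ?thesis using order.trans meet_UN_ext_le[OF finite_good_types] by blast
    qed
    then have "\<forall>(u, v) \<in> ext a. meet (good_types ps) \<le> arr u v" by blast
    then show ?thesis using represents_le_iff[OF ext, of "meet (good_types ps)" a] by blast
  qed
  show "accepts (subst 0 (epsbar u') N) v" if "wsteps ext M (Lam N)" "(u, v) \<in> ext a" "u' \<le> u" for N u v u'
    using eps[OF that(2,3)] accepts_wsteps[OF wsteps_App_Lam[OF that(1)]] by blast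
qed

lemma candidates: "candidates arr App (wstep ext) (\<lambda>a. {M. accepts M a}) {M. neutral ext M}"
proof unfold_locales
  show "wstep ext M M' \<Longrightarrow> M \<in> {M. accepts M a} \<longleftrightarrow> M' \<in> {M. accepts M a}" for M M' a
    using accepts_wsteps[OF r_into_rtranclp[of "wstep ext"]] by simp
  show "wstep ext M M' \<Longrightarrow> M \<in> {M. neutral ext M} \<longleftrightarrow> M' \<in> {M. neutral ext M}" for M M'
    using neutral_wsteps[OF r_into_rtranclp[of "wstep ext"]] by simp
  show "M \<in> {M. accepts M a}"
    if "\<And>u v N. a \<le> arr u v \<Longrightarrow> N \<in> {M. accepts M u} \<Longrightarrow> N \<in> {M. neutral ext M} \<Longrightarrow> App M N \<in> {M. accepts M v}"
    for a M
    using accepts_abs[of a M] that by blast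
  show "M \<in> {M. accepts M c}" if "inf a b \<le> c" "M \<in> {M. accepts M a}" "M \<in> {M. accepts M b}" for a b c M
    using accepts_inf that by blast
  show "App M N \<in> {M. accepts M v} \<and> App M N \<in> {M. neutral ext M}"
    if "M \<in> {M. accepts M a}" "M \<in> {M. neutral ext M}" "a \<le> arr u v" "N \<in> {M. accepts M u}" for a M u v N
    using accepts_app[of M a u v N] neutral_App[of ext M N] that by simp
qed (auto simp: accepts_top wapp)

section \<open>The fundamental lemma\<close>

end

locale reducibility = extensional_arrow_model arr ext
  for arr :: "'d::bounded_semilattice_inf_top \<Rightarrow> 'd \<Rightarrow> 'd" and ext :: "'d \<Rightarrow> ('d \<times> 'd) set" +
  fixes R :: "'d \<Rightarrow> 'd tm set"
  assumes R_mono: "a \<le> b \<Longrightarrow> M \<in> R a \<Longrightarrow> M \<in> R b"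
    and R_abs: "(\<And>u v N. (u, v) \<in> ext a \<Longrightarrow> N \<in> R u \<Longrightarrow> App M N \<in> R v) \<Longrightarrow> M \<in> R a"
    and R_app: "a \<le> arr u v \<Longrightarrow> M \<in> R a \<Longrightarrow> N \<in> R u \<Longrightarrow> App M N \<in> R v"
    and R_neutral: "accepts M a \<Longrightarrow> neutral ext M \<Longrightarrow> M \<in> R a"
    and R_accepts: "M \<in> R a \<Longrightarrow> accepts M a"
    and R_expand: "wstep ext M M' \<Longrightarrow> M' \<in> R a \<Longrightarrow> M \<in> R a"

lemma (in extensional_arrow_model) solves_reducibility:
  assumes "candidates.solves App (wstep ext) (\<lambda>a. {M. accepts M a}) {M. neutral ext M} ext UNIV R"
  shows "reducibility arr ext R"
proof -
  interpret C: candidates arr App "wstep ext" "\<lambda>a. {M. accepts M a}" "{M. neutral ext M}"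
    by (rule candidates)
  have fam: "C.family UNIV R" and fix_R: "\<And>a. R a = C.unfold_arrows ext R a"
    using assms by (auto simp: C.solves_def)
  have cl: "C.closed_under ext UNIV" by (simp add: C.closed_under_def)
  \<comment> \<open>The equation for \<open>R\<close> covers only the pairs of \<open>ext a\<close>;
    any other arrow above \<open>a\<close> is reached through the meet of the results.\<close>
  have app: "App M N \<in> R v" if le: "a \<le> arr u v" and M: "M \<in> R a" and N: "N \<in> R u" for a u v M N
  proof (rule C.family_meet[OF fam cl])
    show "finite (results (ext a) u)" "meet (results (ext a) u) \<le> v"
      using le represents_le[OF ext] by auto
    have "App M N \<in> R w" if w: "w \<in> results (ext a) u" for w
    proof -
      obtain u' where u': "(u', w) \<in> ext a" "u \<le> u'" using w by (auto simp: results_def)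
      then have "N \<in> R u'" using C.family_mono[OF fam _ _ u'(2)] N by blast
      then show ?thesis using C.unfold_arrowsD[of M ext R a u' w N] u'(1) M fix_R by blast
    qed
    then show "\<forall>w\<in>results (ext a) u. App M N \<in> R w" by blast
  qed auto
  show ?thesis
  proof unfold_locales
    show "M \<in> R b" if "a \<le> b" "M \<in> R a" for a b M
      using C.family_mono[OF fam _ _ that] by blast
    show "M \<in> R a" if "\<And>u v N. (u, v) \<in> ext a \<Longrightarrow> N \<in> R u \<Longrightarrow> App M N \<in> R v" for a M
      using that fix_R[of a] unfolding C.unfold_arrows_def by blast
    show "App M N \<in> R v" if "a \<le> arr u v" "M \<in> R a" "N \<in> R u" for a u v M N
      using app[OF that] .
    show "M \<in> R a" if "accepts M a" "neutral ext M" for a M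
      using C.family_lower[OF fam, of a M] that by simp
    show "accepts M a" if "M \<in> R a" for a M
      using C.family_upper[OF fam _ that] by simp
    show "M \<in> R a" if "wstep ext M M'" "M' \<in> R a" for a M M'
      using C.family_step[OF fam _ that(1)] that(2) by blast
  qed
qed

context reducibility
begin

lemma fundamental:
  fixes M :: "'d tm" and Q :: "'d test"
  shows "(\<Gamma>, \<alpha>) \<in> interp arr n M \<Longrightarrow> tm_in n M \<Longrightarrow> (\<And>i. i < n \<Longrightarrow> \<sigma> i \<in> R (\<Gamma> ! i)) \<Longrightarrow> psubst \<sigma> M \<in> R \<alpha>"
    and "\<Gamma> \<in> interp_test arr n Q \<Longrightarrow> test_in n Q \<Longrightarrow> (\<And>i. i < n \<Longrightarrow> \<sigma> i \<in> R (\<Gamma> ! i)) \<Longrightarrow>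
      good ext (psubst_test \<sigma> Q)"
proof (induction M and Q arbitrary: n \<Gamma> \<alpha> \<sigma> and n \<Gamma> \<sigma> rule: tm_test_induct)
  case (Var i)
  then show ?case using R_mono by (auto simp: sem_var_def)
next
  case (Lam M)
  have len: "length \<Gamma> = n" using interp_length(1)[OF Lam.prems(1)] .
  have M: "tm_in (Suc n) M" using Lam.prems(2) by simp
  show ?case
  proof (rule R_abs)
    fix u v N assume uv: "(u, v) \<in> ext \<alpha>" and N: "N \<in> R u"
    have "(u # \<Gamma>, v) \<in> interp arr (Suc n) M" using Lam.prems(1) interp_Lam[OF M len] uv by blast
    moreover have "case_nat N \<sigma> i \<in> R ((u # \<Gamma>) ! i)" if "i < Suc n" for i
      using that N Lam.prems(3) by (cases i) auto
    ultimately have "psubst (case_nat N \<sigma>) M \<in> R v" using Lam.IH M by blast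
    then show "App (psubst \<sigma> (Lam M)) N \<in> R v"
      using R_expand[OF wbeta, of N "psubst (up \<sigma>) M"] by (simp add: subst_up)
  qed
next
  case (App M N)
  obtain \<beta> where "(\<Gamma>, arr \<beta> \<alpha>) \<in> interp arr n M" "(\<Gamma>, \<beta>) \<in> interp arr n N"
    using App.prems(1) by (auto simp: sem_app_iff)
  then have "psubst \<sigma> M \<in> R (arr \<beta> \<alpha>)" "psubst \<sigma> N \<in> R \<beta>"
    using App.IH(1)[of \<Gamma> "arr \<beta> \<alpha>" n \<sigma>] App.IH(2)[of \<Gamma> \<beta> n \<sigma>] App.prems(2,3) by auto
  then show ?case using R_app[OF order_refl] by simp
next
  case (TSum ps)
  have "good ext (psubst_test \<sigma> Q)" if "(\<beta>, Q) \<in> set ps" "\<Gamma> \<in> interp_test arr n Q" for \<beta> Q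
    using TSum.IH[OF that _ TSum.prems(3)] TSum.prems(2) that(1) by auto
  then have "{\<beta>. \<exists>Q. (\<beta>, Q) \<in> set ps \<and> \<Gamma> \<in> interp_test arr n Q} \<subseteq>
    good_types (map (map_prod id (psubst_test \<sigma>)) ps)"
    unfolding good_types_def summands_map by blast
  then have "meet (good_types (map (map_prod id (psubst_test \<sigma>)) ps)) \<le>
      meet {\<beta>. \<exists>Q. (\<beta>, Q) \<in> set ps \<and> \<Gamma> \<in> interp_test arr n Q}"
    by (rule meet_antimono[OF finite_good_types])
  also have "\<dots> \<le> \<alpha>" using TSum.prems(1) by (simp only: interp_TSum)
  finally show ?case by (auto intro!: R_neutral simp: accepts_TSum_iff)
next
  case (QSum Qs)
  obtain Q where Q: "Q \<in> set Qs" "\<Gamma> \<in> interp_test arr n Q" using QSum.prems(1) by auto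
  then have "good ext (psubst_test \<sigma> Q)" using QSum.IH[OF Q _ QSum.prems(3)] QSum.prems(2) by auto
  then show ?case using Q(1) good_QSum[of "psubst_test \<sigma> Q"] by simp
next
  case (QProd Qs)
  have "good ext (psubst_test \<sigma> Q)" if "Q \<in> set Qs" for Q
  proof -
    have "\<Gamma> \<in> interp_test arr n Q" "test_in n Q" using QProd.prems(1,2) that by auto
    then show ?thesis using QProd.IH[OF that _ _ QProd.prems(3)] by simp
  qed
  then show ?case by (simp add: good_QProd_iff)
next
  case (Tau \<alpha> M)
  have "(\<Gamma>, \<alpha>) \<in> interp arr n M" "tm_in n M" "\<alpha> \<noteq> top" using Tau.prems(1,2) by auto
  then have "psubst \<sigma> M \<in> R \<alpha>" using Tau.IH[OF _ _ Tau.prems(3)] by simp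
  then show ?case using accepts_good[OF R_accepts, of "psubst \<sigma> M" \<alpha>] \<open>\<alpha> \<noteq> top\<close> by (simp add: tau_def)
qed

lemma Var_R: "Var i \<in> R a"
  by (rule R_neutral) (simp_all add: accepts_var_headed)

lemma epsbar_R: "epsbar a \<in> R a"
  by (rule R_neutral) (simp_all add: accepts_epsbar neutral_epsbar)

text \<open>Variables are neutral and accepted at every type, so the identity is an admissible
  substitution for every context.\<close>

lemma interp_accepts: "(\<Gamma>, \<alpha>) \<in> interp arr n M \<Longrightarrow> tm_in n M \<Longrightarrow> accepts M \<alpha>"
  using fundamental(1)[of \<Gamma> \<alpha> n M Var] Var_R R_accepts by (simp add: psubst_Var)

lemma interp_good: "\<Gamma> \<in> interp_test arr n Q \<Longrightarrow> test_in n Q \<Longrightarrow> good ext Q"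
  using fundamental(2)[of \<Gamma> n Q Var] Var_R by (simp add: psubst_Var)

lemma interp_good_instance:
  assumes "(\<Gamma>, \<alpha>) \<in> interp arr n M" "tm_in n M"
  shows "good ext (tau \<alpha> (psubst (\<lambda>i. epsbar (\<Gamma> ! i)) M))"
  using fundamental(1)[OF assms, of "\<lambda>i. epsbar (\<Gamma> ! i)"] epsbar_R accepts_good[OF R_accepts] by blast

end

section \<open>Sensibility\<close>

lemma hsteps_Lam: "(hstep ext)\<^sup>*\<^sup>* M N \<Longrightarrow> (hstep ext)\<^sup>*\<^sup>* (Lam M) (Lam N)"
  by (induction rule: rtranclp_induct) (auto intro: ctx_lam rtranclp.rtrancl_into_rtrancl)

lemma hsteps_TSum:
  "(hstep_test ext)\<^sup>*\<^sup>* Q P \<Longrightarrow> (hstep ext)\<^sup>*\<^sup>* (TSum (ps @ (\<alpha>, Q) # rs)) (TSum (ps @ (\<alpha>, P) # rs))"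
  by (induction rule: rtranclp_induct) (auto intro: ctx_taubar rtranclp.rtrancl_into_rtrancl)

lemma converges_hsteps: "(hstep ext)\<^sup>*\<^sup>* M N \<Longrightarrow> converges ext N \<Longrightarrow> converges ext M"
  unfolding converges_def by (meson rtranclp_trans)

lemma converges_Lam: "converges ext M \<Longrightarrow> converges ext (Lam M)"
  unfolding converges_def using hsteps_Lam tm_mhnf.intros(2) by blast

text \<open>A summand of a normal sum must be in head-normal form, so the outer sums of its test are
  first moved out through the annotation.\<close>

lemma test_mhnf_converges: "test_mhnf P \<Longrightarrow> (\<beta>, P) \<in> set ps \<Longrightarrow> converges ext (TSum ps)"
proof (induction P arbitrary: ps rule: test_mhnf.induct)
  case (1 Q)
  have "tm_mhnf (TSum ps)" using tm_mhnf.intros(3)[OF 1(2,1)] .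
  then show ?case unfolding converges_def by (meson rtranclp.rtrancl_refl)
next
  case (2 Q Qs)
  obtain xs ys where ps: "ps = xs @ (\<beta>, QSum Qs) # ys" using 2(4) by (meson split_list)
  have "converges ext (TSum (xs @ [(\<beta>, Q). Q \<leftarrow> Qs] @ ys))" using 2(3)[of "xs @ [(\<beta>, Q). Q \<leftarrow> Qs] @ ys"] 2(1) by auto
  then show ?case
    unfolding ps using converges_hsteps[OF r_into_rtranclp[of "hstep ext", OF taubar_distr]] by blast
qed

lemma test_converges_TSum:
  assumes "test_converges ext Q" "(\<beta>, Q) \<in> set ps" shows "converges ext (TSum ps)"
proof -
  obtain P where P: "(hstep_test ext)\<^sup>*\<^sup>* Q P" "test_mhnf P" using assms(1) by (auto simp: test_converges_def)
  obtain xs ys where ps: "ps = xs @ (\<beta>, Q) # ys" using assms(2) by (meson split_list)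
  show ?thesis
    unfolding ps by (rule converges_hsteps[OF hsteps_TSum[OF P(1)]]) (rule test_mhnf_converges[OF P(2), of \<beta>], simp)
qed

lemma wsteps_hsteps: "wsteps ext M N \<Longrightarrow> (hstep ext)\<^sup>*\<^sup>* M N"
  by (induction rule: rtranclp_induct) (auto dest: wstep_hstep)

context extensional_arrow_model
begin

lemma wsteps_sound: "wsteps ext M M' \<Longrightarrow> tm_in n M \<Longrightarrow> tm_in n M' \<and> interp arr n M' = interp arr n M"
  using hsteps_sound wsteps_hsteps by blast

text \<open>Otherwise \<alpha> would be a meet of arrows into \<omega>, hence \<omega>
  itself.\<close>

lemma ext_nontrivial: "\<alpha> \<noteq> top \<Longrightarrow> \<exists>(u, v) \<in> ext \<alpha>. v \<noteq> top"
  using represents_le_iff[OF ext, of top \<alpha>] by (fastforce simp: top_unique)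

end

context reducibility
begin

text \<open>Since \<open>hconv\<close> accepts every sum as a head, the typing is needed: a type
  other than \<omega> forces a summand with a non-empty interpretation, whose test is good and so
  converges.\<close>

lemma hconv_converges:
  "hconv ext k M \<Longrightarrow> tm_in n M \<Longrightarrow> (\<Gamma>, \<alpha>) \<in> interp arr n M \<Longrightarrow> \<alpha> \<noteq> top \<Longrightarrow> converges ext M"
proof (induction arbitrary: n \<Gamma> \<alpha> rule: hconv.induct)
  case (hconv_neutral M k)
  then obtain H where H: "wsteps ext M H" "var_headed H \<or> (\<exists>ps. H = TSum ps)" by (auto simp: neutral_def)
  have HM: "tm_in n H" "(\<Gamma>, \<alpha>) \<in> interp arr n H" using wsteps_sound[OF H(1)] hconv_neutral.prems by auto
  have "converges ext H"
  proof (cases "var_headed H")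
    case True
    then show ?thesis using tm_mhnf.intros(1)[OF True] unfolding converges_def by (meson rtranclp.rtrancl_refl)
  next
    case False
    then obtain ps where ps: "H = TSum ps" using H(2) by blast
    have "\<exists>\<beta> Q. (\<beta>, Q) \<in> set ps \<and> \<Gamma> \<in> interp_test arr n Q"
    proof (rule ccontr)
      assume "\<nexists>\<beta> Q. (\<beta>, Q) \<in> set ps \<and> \<Gamma> \<in> interp_test arr n Q"
      then have none: "{\<beta>. \<exists>Q. (\<beta>, Q) \<in> set ps \<and> \<Gamma> \<in> interp_test arr n Q} = {}" by blast
      show False using HM(2) hconv_neutral.prems(3) unfolding ps interp_TSum none by (simp add: top_unique)
    qed
    then obtain \<beta> Q where Q: "(\<beta>, Q) \<in> set ps" "\<Gamma> \<in> interp_test arr n Q" by blast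
    have "test_in n Q" using HM(1) Q(1) ps by auto
    then have "test_converges ext Q" using good_test_converges interp_good Q(2) by blast
    then show ?thesis using test_converges_TSum Q(1) ps by blast
  qed
  then show ?case using converges_hsteps wsteps_hsteps[OF H(1)] by blast
next
  case (hconv_Lam M N k)
  have L: "tm_in n (Lam N)" "(\<Gamma>, \<alpha>) \<in> interp arr n (Lam N)"
    using wsteps_sound[OF hconv_Lam.hyps(1)] hconv_Lam.prems by blast+
  obtain u v where uv: "(u, v) \<in> ext \<alpha>" "v \<noteq> top" using ext_nontrivial hconv_Lam.prems(3) by blast
  have N: "tm_in (Suc n) N" using L(1) by simp
  have "(u # \<Gamma>, v) \<in> interp arr (Suc n) N"
    using L(2) interp_Lam[OF N interp_length(1)[OF L(2)]] uv(1) by blast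
  then have "converges ext N" using hconv_Lam.IH N uv(2) by blast
  then show ?case using converges_Lam converges_hsteps wsteps_hsteps[OF hconv_Lam.hyps(1)] by blast
qed

lemma sensible:
  assumes "\<exists>\<alpha>::'d. \<alpha> \<noteq> top"
  shows "sensible arr ext"
  unfolding sensible_def
proof (intro conjI allI impI)
  fix n and M :: "'d tm" assume M: "tm_in n M"
  have "sem_bot n \<subseteq> interp arr n M" using interp_top(1)[OF M] by (auto simp: sem_bot_def)
  moreover have "converges ext M" if "(\<Gamma>, \<alpha>) \<in> interp arr n M" "\<alpha> \<noteq> top" for \<Gamma> \<alpha>
    using accepts_hconv[OF interp_accepts[OF that(1) M] that(2)] hconv_converges[OF _ M that] by blast
  then have "interp arr n M \<subseteq> sem_bot n" if "\<not> converges ext M"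
    using that interp_length(1) unfolding sem_bot_def by fast
  ultimately show "(\<not> converges ext M) = (interp arr n M = sem_bot n)"
    using converges_interp[OF _ M assms] by blast
next
  fix n and Q :: "'d test" assume "test_in n Q"
  then show "(\<not> test_converges ext Q) = (interp_test arr n Q = {})"
    using test_converges_interp good_test_converges interp_good by blast
qed

end

section \<open>Finite approximants\<close>

text \<open>\<open>\<Omega>\<close> has the interpretation of the empty sum, so that facts about terms apply to
  approximants.\<close>

primrec embed :: "approximant \<Rightarrow> 'd tm" where
  "embed Omega = TSum []"
| "embed (AVar i) = Var i"
| "embed (ALam A) = Lam (embed A)"
| "embed (AApp A B) = App (embed A) (embed B)"

lemma interp_embed: "interp arr n (embed A) = interp_approx arr n A"
  by (induction A arbitrary: n) (auto simp: interp_zero)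

lemma tm_in_embed: "tm_in n M \<Longrightarrow> tm_in n (embed (direct_approx M))"
  by (induction M arbitrary: n rule: tm_test_induct(1)[where R = "\<lambda>_. True"]) auto

section \<open>Head reduction and confluent Boehm reduction of lambda-terms\<close>

lemma hstep_App_wstep: "hstep ext (App M N) L \<Longrightarrow> wstep ext (App M N) L"
proof -
  have "hstep ext M' L \<Longrightarrow> (\<forall>M N. M' = App M N \<longrightarrow> wstep ext (App M N) L)" and "hstep_test ext Q Q' \<Longrightarrow> True" for M' Q Q'
  proof (induction rule: hstep_hstep_test.inducts)
    case (sum_app ps N)
    then show ?case
      using wsum[of ext ps N] by (simp only: taubar_sum_def applied_sum_def[symmetric] tm.inject) simp
  qed (auto intro: wbeta wapp)
  then show "hstep ext (App M N) L \<Longrightarrow> wstep ext (App M N) L" by blast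
qed

lemma hstep_cases:
  assumes "hstep ext M L" "lambda_term M"
  shows "(\<exists>N N'. M = Lam N \<and> L = Lam N' \<and> hstep ext N N') \<or> (\<exists>P N. M = App P N \<and> wstep ext M L)"
proof (cases M)
  case (Lam N)
  then show ?thesis using assms(1) by (auto elim: hstep.cases)
next
  case (App P N)
  then show ?thesis using hstep_App_wstep assms(1) by blast
next
  case (Var i)
  then show ?thesis using assms(1) by (auto elim: hstep.cases)
qed (use assms(2) in auto)

lemma lambda_term_psubst: "lambda_term M \<Longrightarrow> (\<And>i. lambda_term (\<sigma> i)) \<Longrightarrow> lambda_term (psubst \<sigma> M)"
proof (induction M arbitrary: \<sigma> rule: lambda_term.induct)
  case (2 M)
  have ren: "lambda_term N \<Longrightarrow> lambda_term (rename \<xi> N)" for N :: "'a tm" and \<xi>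
    by (induction N arbitrary: \<xi> rule: lambda_term.induct) (auto simp: up_rename)
  have "lambda_term (up \<sigma> i)" for i using 2(3) ren by (cases i) (auto simp: lift_0)
  then show ?case using 2(1,2) by simp
qed auto

lemma wstep_lambda_term: "wstep ext M L \<Longrightarrow> lambda_term M \<Longrightarrow> lambda_term L \<and> has_head_redex M"
proof (induction rule: wstep.induct)
  case (wbeta M N)
  then show ?case unfolding subst_0 by (auto intro!: lambda_term_psubst split: nat.split)
next
  case (wapp M M' N)
  then show ?case using wstep_App[OF wapp.hyps] by auto
qed auto

lemma hstep_lambda_term: "hstep ext M L \<Longrightarrow> lambda_term M \<Longrightarrow> lambda_term L \<and> has_head_redex M"
proof (induction M arbitrary: L rule: lambda_term.induct)
  case (2 M)
  then show ?case using hstep_cases[OF 2(2,3)] by auto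
next
  case (3 M N)
  then show ?case using hstep_cases[OF 3(3,4)] wstep_lambda_term by blast
qed (use hstep_cases in fastforce)+

lemma var_headed_no_redex: "var_headed M \<Longrightarrow> \<not> has_head_redex M"
  by (induction M rule: has_head_redex.induct) auto

lemma head_redex_approx: "has_head_redex M \<Longrightarrow> direct_approx M = Omega"
  by (cases M) auto

lemma bohm_step_cases:
  assumes "bohm_step ext M L" "lambda_term M"
  shows "(\<exists>N N'. M = Lam N \<and> L = Lam N' \<and> bohm_step ext N N') \<or>
    (\<exists>P N. M = App P N \<and> \<not> var_headed P \<and> wstep ext M L) \<or>
    (\<exists>P N P'. M = App P N \<and> var_headed P \<and> L = App P' N \<and> bohm_step ext P P') \<or>
    (\<exists>P N N'. M = App P N \<and> var_headed P \<and> L = App P N' \<and> bohm_step ext N N')"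
  using assms(1)
proof cases
  case 1
  then show ?thesis
    using hstep_cases[OF 1 assms(2)] bohm_step.intros(1) var_headed_not_wstep[of M ext L]
    by (metis var_headed.simps(2))
qed blast+

lemma bohm_step_lambda_term: "bohm_step ext M L \<Longrightarrow> lambda_term M \<Longrightarrow> lambda_term L"
  by (induction rule: bohm_step.induct) (auto dest: hstep_lambda_term)

lemma bohm_step_var_headed: "bohm_step ext M L \<Longrightarrow> lambda_term M \<Longrightarrow> var_headed M \<Longrightarrow> var_headed L"
  by (induction rule: bohm_step.induct) (auto dest: hstep_lambda_term var_headed_no_redex)

text \<open>A head redex is contracted in only one way. Below a head variable, steps in the spine
  and in the last argument are independent and duplicate nothing of each other, so one step on each
  side closes the diagram.\<close>

lemma bohm_step_diamond:
  "lambda_term M \<Longrightarrow> bohm_step ext M A \<Longrightarrow> bohm_step ext M B \<Longrightarrow>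
   A = B \<or> (\<exists>C. bohm_step ext A C \<and> bohm_step ext B C)"
proof (induction M arbitrary: A B rule: lambda_term.induct)
  case (1 i)
  then show ?case using bohm_step_cases[OF 1(2)] by auto
next
  case (2 M)
  obtain A' B' where AB: "A = Lam A'" "bohm_step ext M A'" "B = Lam B'" "bohm_step ext M B'"
    using bohm_step_cases[OF 2(3,2)] bohm_step_cases[OF 2(4,2)] by auto
  then have "A' = B' \<or> (\<exists>C. bohm_step ext A' C \<and> bohm_step ext B' C)" using 2(1)[of A' B'] 2(2) by simp
  then show ?case using AB(1,3) bohm_step.intros(2)[of ext] by blast
next
  case (3 M N)
  show ?case
  proof (cases "var_headed M")
    case False
    then have "wstep ext (App M N) A" "wstep ext (App M N) B"
      using bohm_step_cases[OF 3(4,3)] bohm_step_cases[OF 3(5,3)] by auto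
    then show ?thesis using wstep_deterministic by blast
  next
    case True
    note vh = bohm_step_var_headed[of ext M]
    have "(\<exists>M'. A = App M' N \<and> bohm_step ext M M') \<or> (\<exists>N'. A = App M N' \<and> bohm_step ext N N')"
      "(\<exists>M'. B = App M' N \<and> bohm_step ext M M') \<or> (\<exists>N'. B = App M N' \<and> bohm_step ext N N')"
      using bohm_step_cases[OF 3(4,3)] bohm_step_cases[OF 3(5,3)] True by auto
    then show ?thesis
    proof (elim disjE exE conjE)
      fix M1 M2 assume "A = App M1 N" "bohm_step ext M M1" "B = App M2 N" "bohm_step ext M M2"
      then show ?thesis using 3(1)[of M1 M2] 3(3) True vh bohm_step.intros(3) by (metis lambda_term.simps(3))
    next
      fix M1 N2 assume "A = App M1 N" "bohm_step ext M M1" "B = App M N2" "bohm_step ext N N2"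
      then show ?thesis using 3(3) True vh bohm_step.intros(3,4) by (metis lambda_term.simps(3))
    next
      fix N1 M2 assume "A = App M N1" "bohm_step ext N N1" "B = App M2 N" "bohm_step ext M M2"
      then show ?thesis using 3(3) True vh bohm_step.intros(3,4) by (metis lambda_term.simps(3))
    next
      fix N1 N2 assume "A = App M N1" "bohm_step ext N N1" "B = App M N2" "bohm_step ext N N2"
      then show ?thesis using 3(2)[of N1 N2] 3(3) True bohm_step.intros(4) by (metis lambda_term.simps(3))
    qed
  qed
next
  case (4 ps)
  then show ?case by simp
qed

lemma bohm_steps_lambda_term: "(bohm_step ext)\<^sup>*\<^sup>* M L \<Longrightarrow> lambda_term M \<Longrightarrow> lambda_term L"
  by (induction rule: rtranclp_induct) (auto dest: bohm_step_lambda_term)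

lemma bohm_steps_var_headed:
  "(bohm_step ext)\<^sup>*\<^sup>* M L \<Longrightarrow> lambda_term M \<Longrightarrow> var_headed M \<Longrightarrow> var_headed L"
proof (induction rule: rtranclp_induct)
  case (step L L')
  then show ?case using bohm_step_var_headed bohm_steps_lambda_term by blast
qed

lemma bohm_strip:
  assumes "(bohm_step ext)\<^sup>*\<^sup>* M B" "bohm_step ext M A" "lambda_term M"
  shows "\<exists>C. (bohm_step ext)\<^sup>*\<^sup>* A C \<and> (B = C \<or> bohm_step ext B C)"
  using assms(1)
proof (induction rule: rtranclp_induct)
  case base
  then show ?case using assms(2) by blast
next
  case (step B' B)
  then obtain C' where C': "(bohm_step ext)\<^sup>*\<^sup>* A C'" "B' = C' \<or> bohm_step ext B' C'" by blast
  from C'(2) show ?case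
  proof
    assume "B' = C'"
    then have "(bohm_step ext)\<^sup>*\<^sup>* A B" using C'(1) step.hyps(2) by (simp add: rtranclp.rtrancl_into_rtrancl)
    then show ?thesis by blast
  next
    assume "bohm_step ext B' C'"
    then have "C' = B \<or> (\<exists>C. bohm_step ext C' C \<and> bohm_step ext B C)"
      using bohm_step_diamond step.hyps bohm_steps_lambda_term assms(3) by blast
    then show ?thesis
    proof (elim disjE exE conjE)
      fix C assume "bohm_step ext C' C" "bohm_step ext B C"
      then show ?thesis using rtranclp.rtrancl_into_rtrancl[OF C'(1)] by blast
    qed (use C'(1) in blast)
  qed
qed

lemma bohm_confluent:
  assumes "(bohm_step ext)\<^sup>*\<^sup>* M A" "(bohm_step ext)\<^sup>*\<^sup>* M B" "lambda_term M"
  shows "\<exists>C. (bohm_step ext)\<^sup>*\<^sup>* A C \<and> (bohm_step ext)\<^sup>*\<^sup>* B C"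
  using assms(1)
proof (induction rule: rtranclp_induct)
  case base
  then show ?case using assms(2) by blast
next
  case (step A' A)
  then obtain C' where C': "(bohm_step ext)\<^sup>*\<^sup>* A' C'" "(bohm_step ext)\<^sup>*\<^sup>* B C'" by blast
  obtain C where "(bohm_step ext)\<^sup>*\<^sup>* A C" "C' = C \<or> bohm_step ext C' C"
    using bohm_strip[OF C'(1) step.hyps(2)] bohm_steps_lambda_term[OF step.hyps(1) assms(3)] by blast
  then show ?case using C'(2) by (meson rtranclp.rtrancl_into_rtrancl)
qed

lemma bohm_steps_Lam: "(bohm_step ext)\<^sup>*\<^sup>* M N \<Longrightarrow> (bohm_step ext)\<^sup>*\<^sup>* (Lam M) (Lam N)"
  by (induction rule: rtranclp_induct) (auto intro: bohm_step.intros(2) rtranclp.rtrancl_into_rtrancl)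

lemma bohm_steps_App:
  assumes "var_headed M" "lambda_term M" "(bohm_step ext)\<^sup>*\<^sup>* M M'" "(bohm_step ext)\<^sup>*\<^sup>* N N'"
  shows "(bohm_step ext)\<^sup>*\<^sup>* (App M N) (App M' N')"
proof -
  have "(bohm_step ext)\<^sup>*\<^sup>* (App M N) (App M' N)"
    using assms(3)
  proof (induction rule: rtranclp_induct)
    case (step L L')
    then show ?case
      using bohm_steps_var_headed[OF step.hyps(1) assms(2,1)] bohm_step.intros(3)
      by (meson rtranclp.rtrancl_into_rtrancl)
  qed simp
  also have "(bohm_step ext)\<^sup>*\<^sup>* (App M' N) (App M' N')"
    using assms(4)
  proof (induction rule: rtranclp_induct)
    case (step L L')
    then show ?case
      using bohm_steps_var_headed[OF assms(3,2,1)] bohm_step.intros(4)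
      by (meson rtranclp.rtrancl_into_rtrancl)
  qed simp
  finally show ?thesis .
qed

lemma wsteps_bohm_steps: "wsteps ext M N \<Longrightarrow> (bohm_step ext)\<^sup>*\<^sup>* M N"
  by (induction rule: rtranclp_induct)
    (auto intro: bohm_step.intros(1) wstep_hstep rtranclp.rtrancl_into_rtrancl)

section \<open>Interpretation of approximants along Boehm reduction\<close>

context extensional_arrow_model
begin

text \<open>\<open>direct_approx\<close> collapses an abstraction over \<Omega> to \<Omega>; nothing
  is lost, because such an abstraction has no type but \<omega>.\<close>

lemma embed_Lam:
  assumes "tm_in (Suc n) M" "(\<Gamma>, \<alpha>) \<in> interp arr n (Lam (embed (direct_approx M)))"
  shows "(\<Gamma>, \<alpha>) \<in> interp arr n (embed (direct_approx (Lam M)))"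
proof (cases "has_head_redex M")
  case True
  have len: "length \<Gamma> = n" using interp_length(1)[OF assms(2)] .
  have "(\<Gamma>, \<alpha>) \<in> interp arr n (Lam (TSum []))" using assms(2) head_redex_approx[OF True] by simp
  then have "\<forall>(u, v) \<in> ext \<alpha>. (u # \<Gamma>, v) \<in> interp arr (Suc n) (TSum [])"
    using interp_Lam[of n "TSum []" \<Gamma> \<alpha>] len by simp
  then have "\<forall>(u, v) \<in> ext \<alpha>. v = top" by (auto simp: interp_zero sem_bot_def)
  then have "\<alpha> = top" using ext_nontrivial by blast
  then show ?thesis using True len by (simp add: interp_zero sem_bot_def)
qed (use assms(2) in simp)

lemma interp_Lam_mono:
  assumes "tm_in (Suc n) M" "tm_in (Suc n) N" "interp arr (Suc n) M \<subseteq> interp arr (Suc n) N"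
  shows "interp arr n (Lam M) \<subseteq> interp arr n (Lam N)"
proof clarify
  fix \<Gamma> \<alpha> assume "(\<Gamma>, \<alpha>) \<in> interp arr n (Lam M)"
  then show "(\<Gamma>, \<alpha>) \<in> interp arr n (Lam N)"
    using interp_Lam[OF assms(1), of \<Gamma> \<alpha>] interp_Lam[OF assms(2), of \<Gamma> \<alpha>] assms(3)
      interp_length(1)[of \<Gamma> \<alpha> n "Lam M"] by fast
qed

lemma interp_App_mono:
  "interp arr n M \<subseteq> interp arr n M' \<Longrightarrow> interp arr n N \<subseteq> interp arr n N' \<Longrightarrow>
   interp arr n (App M N) \<subseteq> interp arr n (App M' N')"
  unfolding interp.simps sem_app_def by fast

lemma interp_Omega_le: "tm_in n M \<Longrightarrow> interp arr n (TSum []) \<subseteq> interp arr n M"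
  unfolding interp_zero sem_bot_def using interp_top(1) by fast

lemma direct_approx_le: "tm_in n M \<Longrightarrow> interp arr n (embed (direct_approx M)) \<subseteq> interp arr n M"
proof (induction M arbitrary: n rule: lambda_term.induct)
  case (1 i)
  then show ?case by simp
next
  case (2 M)
  have M: "tm_in (Suc n) M" "tm_in (Suc n) (embed (direct_approx M))" using 2(2) tm_in_embed by auto
  have "interp arr n (Lam (embed (direct_approx M))) \<subseteq> interp arr n (Lam M)"
    using interp_Lam_mono[OF M(2,1)] 2(1) M(1) by blast
  then show ?case using interp_Omega_le[OF 2(2)] by simp
next
  case (3 M N)
  have "interp arr n (App (embed (direct_approx M)) (embed (direct_approx N))) \<subseteq> interp arr n (App M N)"
    using 3 by (intro interp_App_mono) auto
  then show ?case using interp_Omega_le[OF 3(3)] by (simp del: interp.simps)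
next
  case (4 ps)
  then show ?case using interp_Omega_le by simp
qed

lemma bohm_step_sound: "bohm_step ext M L \<Longrightarrow> tm_in n M \<Longrightarrow> tm_in n L \<and> interp arr n L = interp arr n M"
proof (induction arbitrary: n rule: bohm_step.induct)
  case (1 M M')
  then show ?case using hstep_sound(1) by blast
next
  case (2 M M')
  then show ?case using 2(2)[of "Suc n"] by simp
qed auto

lemma bohm_steps_sound:
  "(bohm_step ext)\<^sup>*\<^sup>* M L \<Longrightarrow> tm_in n M \<Longrightarrow> tm_in n L \<and> interp arr n L = interp arr n M"
  by (induction rule: rtranclp_induct) (use bohm_step_sound in blast)+

text \<open>Before a head step the approximant is \<Omega>, the least one; every other step takes
  place under an abstraction or next to a head variable, where the interpretation is
  monotone.\<close>

lemma direct_approx_mono: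
  "bohm_step ext M L \<Longrightarrow> lambda_term M \<Longrightarrow> tm_in n M \<Longrightarrow>
   interp arr n (embed (direct_approx M)) \<subseteq> interp arr n (embed (direct_approx L))"
proof (induction arbitrary: n rule: bohm_step.induct)
  case (1 M M')
  have "tm_in n (embed (direct_approx M'))" using hstep_sound(1)[OF 1(1,3)] tm_in_embed by blast
  then show ?case
    using hstep_lambda_term[OF 1(1,2)] head_redex_approx[of M] interp_Omega_le by simp
next
  case (2 M M')
  have M: "tm_in (Suc n) M" "lambda_term M" using 2(3,4) by auto
  then have M': "tm_in (Suc n) M'" using bohm_step_sound[OF 2(1)] by blast
  have "interp arr n (Lam (embed (direct_approx M))) \<subseteq> interp arr n (Lam (embed (direct_approx M')))"
    using interp_Lam_mono[OF tm_in_embed[OF M(1)] tm_in_embed[OF M']] 2(2) M by blast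
  then have "interp arr n (Lam (embed (direct_approx M))) \<subseteq> interp arr n (embed (direct_approx (Lam M')))"
    using embed_Lam[OF M'] by fast
  moreover have "interp arr n (TSum []) \<subseteq> interp arr n (embed (direct_approx (Lam M')))"
    using M' by (intro interp_Omega_le tm_in_embed) simp
  ultimately show ?case by (cases "has_head_redex M") (simp_all del: interp.simps)
next
  case (3 M M' N)
  have vh: "var_headed M'" using bohm_step_var_headed[OF 3(2) _ 3(1)] 3(4) by simp
  have "interp arr n (App (embed (direct_approx M)) (embed (direct_approx N))) \<subseteq>
    interp arr n (App (embed (direct_approx M')) (embed (direct_approx N)))"
    using 3 by (intro interp_App_mono) auto
  then show ?case
    using var_headed_no_redex[of "App M N"] var_headed_no_redex[of "App M' N"] 3(1) vh
    by (simp del: interp.simps)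
next
  case (4 M N N')
  have "interp arr n (App (embed (direct_approx M)) (embed (direct_approx N))) \<subseteq>
    interp arr n (App (embed (direct_approx M)) (embed (direct_approx N')))"
    using 4 by (intro interp_App_mono) auto
  then show ?case
    using var_headed_no_redex[of "App M N"] var_headed_no_redex[of "App M N'"] 4(1)
    by (simp del: interp.simps)
qed

lemma direct_approx_steps_mono:
  "(bohm_step ext)\<^sup>*\<^sup>* M L \<Longrightarrow> lambda_term M \<Longrightarrow> tm_in n M \<Longrightarrow>
   interp arr n (embed (direct_approx M)) \<subseteq> interp arr n (embed (direct_approx L))"
proof (induction rule: rtranclp_induct)
  case (step L L')
  then show ?case
    using direct_approx_mono[OF step.hyps(2)] bohm_steps_lambda_term[OF step.hyps(1)]
      bohm_steps_sound[OF step.hyps(1)] by blast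
qed simp

section \<open>Approximants obtained from good tests\<close>

definition approximated :: "'d tm \<Rightarrow> 'd list \<Rightarrow> 'd \<Rightarrow> bool" where
  "approximated M \<Gamma> \<alpha> \<longleftrightarrow> (\<exists>L. (bohm_step ext)\<^sup>*\<^sup>* M L \<and>
     (\<Gamma>, \<alpha>) \<in> interp arr (length \<Gamma>) (embed (direct_approx L)))"

lemma approximated_up: "approximated M \<Gamma> \<alpha> \<Longrightarrow> \<alpha> \<le> \<beta> \<Longrightarrow> approximated M \<Gamma> \<beta>"
  unfolding approximated_def using interp_up(1) by blast

text \<open>By confluence the finitely many reducts have a common reduct, and its approximant has
  all the types of theirs.\<close>

lemma approximated_common:
  assumes "finite S" "lambda_term M" "tm_in n M"
    and "\<And>\<Gamma> \<alpha>. (\<Gamma>, \<alpha>) \<in> S \<Longrightarrow> length \<Gamma> = n \<and> approximated M \<Gamma> \<alpha>"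
  shows "\<exists>L. (bohm_step ext)\<^sup>*\<^sup>* M L \<and> S \<subseteq> interp arr n (embed (direct_approx L))"
  using assms(1,4)
proof (induction S rule: finite_induct)
  case (insert p S)
  obtain \<Gamma> \<alpha> where p: "p = (\<Gamma>, \<alpha>)" by (cases p)
  obtain L where L: "(bohm_step ext)\<^sup>*\<^sup>* M L" "S \<subseteq> interp arr n (embed (direct_approx L))"
    using insert.IH insert.prems by blast
  obtain L' where L': "(bohm_step ext)\<^sup>*\<^sup>* M L'" "p \<in> interp arr n (embed (direct_approx L'))"
    using insert.prems[of \<Gamma> \<alpha>] p by (auto simp: approximated_def)
  obtain C where C: "(bohm_step ext)\<^sup>*\<^sup>* L C" "(bohm_step ext)\<^sup>*\<^sup>* L' C"
    using bohm_confluent[OF L(1) L'(1) assms(2)] by blast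
  have "interp arr n (embed (direct_approx L)) \<subseteq> interp arr n (embed (direct_approx C))"
    "interp arr n (embed (direct_approx L')) \<subseteq> interp arr n (embed (direct_approx C))"
    using C direct_approx_steps_mono L(1) L'(1) bohm_steps_lambda_term bohm_steps_sound assms(2,3) by blast+
  then show ?case using L L'(2) C(1) by (intro exI[of _ C]) auto
qed auto

lemma approximated_meet:
  assumes "finite B" "\<And>b. b \<in> B \<Longrightarrow> approximated M \<Gamma> b" "meet B \<le> \<alpha>" "lambda_term M" "tm_in (length \<Gamma>) M"
  shows "approximated M \<Gamma> \<alpha>"
proof -
  have "\<exists>L. (bohm_step ext)\<^sup>*\<^sup>* M L \<and> Pair \<Gamma> ` B \<subseteq> interp arr (length \<Gamma>) (embed (direct_approx L))"
    using assms by (intro approximated_common) auto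
  then obtain L where L: "(bohm_step ext)\<^sup>*\<^sup>* M L" "\<And>b. b \<in> B \<Longrightarrow> (\<Gamma>, b) \<in> interp arr (length \<Gamma>) (embed (direct_approx L))"
    by auto
  have "tm_in (length \<Gamma>) (embed (direct_approx L))" using bohm_steps_sound[OF L(1) assms(5)] tm_in_embed by blast
  then have "(\<Gamma>, meet B) \<in> interp arr (length \<Gamma>) (embed (direct_approx L))"
    using L(2) assms(1) by (intro interp_meet) auto
  then show ?thesis using L(1) assms(3) interp_up(1) unfolding approximated_def by blast
qed

lemma approximated_top: "lambda_term M \<Longrightarrow> tm_in (length \<Gamma>) M \<Longrightarrow> approximated M \<Gamma> top"
  by (rule approximated_meet[of "{}"]) auto

lemma approximated_steps: "(bohm_step ext)\<^sup>*\<^sup>* M L \<Longrightarrow> approximated L \<Gamma> \<alpha> \<Longrightarrow> approximated M \<Gamma> \<alpha>"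
  unfolding approximated_def by (meson rtranclp_trans)

lemma approximated_Lam:
  assumes M: "lambda_term M" "tm_in (Suc (length \<Gamma>)) M"
    and app: "\<And>u v. (u, v) \<in> ext \<alpha> \<Longrightarrow> approximated M (u # \<Gamma>) v"
  shows "approximated (Lam M) \<Gamma> \<alpha>"
proof -
  have "\<exists>L. (bohm_step ext)\<^sup>*\<^sup>* M L \<and>
    (\<lambda>(u, v). (u # \<Gamma>, v)) ` ext \<alpha> \<subseteq> interp arr (Suc (length \<Gamma>)) (embed (direct_approx L))"
    using M app by (intro approximated_common) auto
  then obtain L where L: "(bohm_step ext)\<^sup>*\<^sup>* M L"
    "\<forall>(u, v) \<in> ext \<alpha>. (u # \<Gamma>, v) \<in> interp arr (Suc (length \<Gamma>)) (embed (direct_approx L))"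
    by auto
  have "tm_in (Suc (length \<Gamma>)) L" using bohm_steps_sound[OF L(1) M(2)] by blast
  then have "(\<Gamma>, \<alpha>) \<in> interp arr (length \<Gamma>) (embed (direct_approx (Lam L)))"
    using embed_Lam interp_Lam[OF tm_in_embed refl] L(2) by blast
  then show ?thesis using bohm_steps_Lam[OF L(1)] unfolding approximated_def by blast
qed

lemma approximated_App:
  assumes M: "var_headed M" "lambda_term M" and app: "approximated M \<Gamma> (arr u v)" "approximated N \<Gamma> u"
  shows "approximated (App M N) \<Gamma> v"
proof -
  obtain L where L: "(bohm_step ext)\<^sup>*\<^sup>* M L" "(\<Gamma>, arr u v) \<in> interp arr (length \<Gamma>) (embed (direct_approx L))"
    using app(1) by (auto simp: approximated_def)
  obtain L' where L': "(bohm_step ext)\<^sup>*\<^sup>* N L'" "(\<Gamma>, u) \<in> interp arr (length \<Gamma>) (embed (direct_approx L'))"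
    using app(2) by (auto simp: approximated_def)
  have "var_headed L" using bohm_steps_var_headed[OF L(1) M(2,1)] .
  then have "embed (direct_approx (App L L')) = App (embed (direct_approx L)) (embed (direct_approx L'))"
    using var_headed_no_redex[of "App L L'"] by simp
  then have "(\<Gamma>, v) \<in> interp arr (length \<Gamma>) (embed (direct_approx (App L L')))"
    using L(2) L'(2) by (auto simp: sem_app_iff)
  then show ?thesis using bohm_steps_App[OF M L(1) L'(1)] unfolding approximated_def by blast
qed

abbreviation eps_subst :: "'d list \<Rightarrow> nat \<Rightarrow> 'd tm" where
  "eps_subst \<Gamma> \<equiv> \<lambda>i. epsbar (\<Gamma> ! i)"

text \<open>A derivation of \<open>good (\<tau>\<^sub>\<alpha>(M[\<epsilon>bar\<^sub>\<Gamma>]))\<close> inspects only finitely many head reductions of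
  subterms of \<open>M\<close>, and an approximant can be read off from them.\<close>

inductive yields_approximants :: "'d test \<Rightarrow> bool" where
  "(\<And>M \<Gamma>. lambda_term M \<Longrightarrow> tm_in (length \<Gamma>) M \<Longrightarrow> N = psubst (eps_subst \<Gamma>) M \<Longrightarrow> approximated M \<Gamma> \<alpha>) \<Longrightarrow>
   yields_approximants (Tau \<alpha> N)"
| "(\<And>Q. Q \<in> set Qs \<Longrightarrow> yields_approximants Q) \<Longrightarrow> yields_approximants (QProd Qs)"
| "yields_approximants (QSum Qs)"

inductive_cases yields_QProdE: "yields_approximants (QProd Qs)"
inductive_cases yields_TauE: "yields_approximants (Tau \<alpha> N)"

lemma yields_tau:
  assumes "yields_approximants (tau \<alpha> (psubst (eps_subst \<Gamma>) M))" "lambda_term M" "tm_in (length \<Gamma>) M"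
  shows "approximated M \<Gamma> \<alpha>"
proof (cases "\<alpha> = top")
  case False
  then have "yields_approximants (Tau \<alpha> (psubst (eps_subst \<Gamma>) M))" using assms(1) by (simp add: tau_def)
  then show ?thesis by (rule yields_TauE) (use assms(2,3) in blast)
qed (use approximated_top assms in blast)

text \<open>With \<open>epsbar\<close> for the head variable, each argument contributes a factor
  \<open>tau b N\<close> to the tests of the resulting sum. A summand thus records which types of
  the arguments give the head application its type.\<close>

lemma var_headed_instance:
  "var_headed M \<Longrightarrow> lambda_term M \<Longrightarrow> tm_in (length \<Gamma>) M \<Longrightarrow>
   \<exists>ps. wsteps ext (psubst (eps_subst \<Gamma>) M) (TSum ps) \<and>
     (\<forall>(\<beta>, Q) \<in> set ps. yields_approximants Q \<longrightarrow> approximated M \<Gamma> \<beta>)"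
proof (induction M rule: var_headed.induct)
  case (1 i)
  have "approximated (Var i) \<Gamma> (\<Gamma> ! i)"
    unfolding approximated_def using 1(3) by (intro exI[of _ "Var i"]) (simp add: sem_var_def)
  then show ?case by (auto simp: epsbar_def taubar_sum_def)
next
  case (2 M N)
  obtain ps where ps: "wsteps ext (psubst (eps_subst \<Gamma>) M) (TSum ps)"
    "\<And>\<beta> Q. (\<beta>, Q) \<in> set ps \<Longrightarrow> yields_approximants Q \<Longrightarrow> approximated M \<Gamma> \<beta>"
    using 2 by auto
  let ?N = "psubst (eps_subst \<Gamma>) N"
  have "approximated (App M N) \<Gamma> c"
    if c: "(c, Q') \<in> set (applied_sum ext ps ?N)" and Q': "yields_approximants Q'" for c Q'
  proof -
    obtain a Q b where Q: "(a, Q) \<in> set ps" "(b, c) \<in> ext a" "Q' = QProd [Q, tau b ?N]"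
      using c set_applied_sum[of c Q' ?N ps] unfolding applied_sum_def set_filter mem_Collect_eq prod.case by blast
    have "yields_approximants Q" "yields_approximants (tau b ?N)"
      using Q' unfolding Q(3) by (auto elim: yields_QProdE)
    then have "approximated M \<Gamma> (arr b c)" "approximated N \<Gamma> b"
      using ps(2)[OF Q(1)] approximated_up represents_mem[OF ext Q(2)] yields_tau 2(3,4) by auto
    then show ?thesis using approximated_App 2(2,3) by auto
  qed
  moreover have "wsteps ext (psubst (eps_subst \<Gamma>) (App M N)) (TSum (applied_sum ext ps ?N))"
    using wsteps_App_TSum[OF ps(1)] by simp
  ultimately show ?case by blast
qed auto

text \<open>Uniqueness of weak head normal forms identifies \<open>W\<close> with the sum of
  \<open>var_headed_instance\<close> when \<open>M\<close> reaches a head variable. Otherwise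
  \<open>M\<close> reaches an abstraction, as a lambda-term never reduces to a sum.\<close>

lemma instance_whnf:
  assumes W: "wsteps ext (psubst (eps_subst \<Gamma>) M) W" "whnf W" and M: "lambda_term M" "tm_in (length \<Gamma>) M"
  shows "\<exists>M'. wsteps ext M M' \<and> lambda_term M' \<and> tm_in (length \<Gamma>) M' \<and>
    ((\<exists>ps. W = TSum ps \<and> (\<forall>(\<beta>, Q) \<in> set ps. yields_approximants Q \<longrightarrow> approximated M' \<Gamma> \<beta>)) \<or>
     (\<exists>K. M' = Lam K \<and> W = Lam (psubst (up (eps_subst \<Gamma>)) K)))"
proof -
  obtain M' where M': "wsteps ext M M'" "whnf M'" "wsteps ext (psubst (eps_subst \<Gamma>) M') W"
    "var_headed M' \<or> psubst (eps_subst \<Gamma>) M' = W"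
    using wsteps_reflect[OF W] by blast
  have in': "lambda_term M'" "tm_in (length \<Gamma>) M'"
    using bohm_steps_lambda_term[OF wsteps_bohm_steps[OF M'(1)] M(1)] wsteps_sound[OF M'(1) M(2)] by auto
  show ?thesis
  proof (cases "var_headed M'")
    case True
    then obtain ps where ps: "wsteps ext (psubst (eps_subst \<Gamma>) M') (TSum ps)"
      "\<forall>(\<beta>, Q) \<in> set ps. yields_approximants Q \<longrightarrow> approximated M' \<Gamma> \<beta>"
      using var_headed_instance in' by blast
    have "W = TSum ps" using wsteps_unique[OF M'(3) W(2) ps(1)] by simp
    then show ?thesis using M'(1) in' ps(2) by blast
  next
    case False
    then obtain K where "M' = Lam K" "W = Lam (psubst (up (eps_subst \<Gamma>)) K)"
      using M'(2,4) in'(1) by (auto simp: whnf_def)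
    then show ?thesis using M'(1) in' by blast
  qed
qed

lemma good_yields_approximants: "good ext Q \<Longrightarrow> yields_approximants Q"
proof (induction rule: good.induct)
  case (good_var N H \<alpha>)
  show ?case
  proof (rule yields_approximants.intros(1))
    fix M \<Gamma> assume M: "lambda_term M" "tm_in (length \<Gamma>) M" "N = psubst (eps_subst \<Gamma>) M"
    \<comment> \<open>Vacuous: by \<open>instance_whnf\<close> the instance ends in a sum or an
      abstraction, never in a variable head.\<close>
    show "approximated M \<Gamma> \<alpha>"
      using instance_whnf[of \<Gamma> M H] good_var M by auto
  qed
next
  case (good_lam N L \<alpha>)
  show ?case
  proof (rule yields_approximants.intros(1))
    fix M \<Gamma> assume M: "lambda_term M" "tm_in (length \<Gamma>) M" "N = psubst (eps_subst \<Gamma>) M"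
    obtain K where K: "wsteps ext M (Lam K)" "lambda_term K" "tm_in (Suc (length \<Gamma>)) K"
      "L = psubst (up (eps_subst \<Gamma>)) K"
      using instance_whnf[of \<Gamma> M "Lam L"] good_lam(1) M by auto
    have "approximated K (u # \<Gamma>) v" if "(u, v) \<in> ext \<alpha>" for u v
    proof -
      have "case_nat (epsbar u) (eps_subst \<Gamma>) = eps_subst (u # \<Gamma>)"
        by (rule HOL.ext) (simp split: nat.split)
      then have "subst 0 (epsbar u) L = psubst (eps_subst (u # \<Gamma>)) K" unfolding K(4) subst_up by simp
      then show ?thesis using good_lam.IH[OF that] yields_tau[of v "u # \<Gamma>" K] K(2,3) by simp
    qed
    then have "approximated (Lam K) \<Gamma> \<alpha>" using approximated_Lam K(2,3) by blast
    then show "approximated M \<Gamma> \<alpha>" using approximated_steps wsteps_bohm_steps[OF K(1)] by blast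
  qed
next
  case (good_sum N ps J \<alpha>)
  show ?case
  proof (rule yields_approximants.intros(1))
    fix M \<Gamma> assume M: "lambda_term M" "tm_in (length \<Gamma>) M" "N = psubst (eps_subst \<Gamma>) M"
    obtain M' where M': "wsteps ext M M'" "lambda_term M'" "tm_in (length \<Gamma>) M'"
      "\<forall>(\<beta>, Q) \<in> set ps. yields_approximants Q \<longrightarrow> approximated M' \<Gamma> \<beta>"
      using instance_whnf[of \<Gamma> M "TSum ps"] good_sum(1) M by auto
    have "approximated M' \<Gamma> b" if "b \<in> fst ` J" for b
      using that M'(4) good_sum(2) good_sum.IH by fastforce
    moreover have "finite (fst ` J)" using good_sum(2) finite_subset by blast
    ultimately have "approximated M' \<Gamma> \<alpha>" using approximated_meet good_sum(3) M'(2,3) by blast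
    then show "approximated M \<Gamma> \<alpha>" using approximated_steps wsteps_bohm_steps[OF M'(1)] by blast
  qed
qed (auto intro: yields_approximants.intros)

end

lemma (in reducibility) approximable: "approximable arr ext"
  unfolding approximable_def
proof (intro allI impI subset_antisym)
  fix n and M :: "'d tm" assume M: "tm_in n M \<and> lambda_term M"
  show "interp arr n M \<subseteq> (\<Union>A\<in>approximants ext M. interp_approx arr n A)"
  proof clarify
    fix \<Gamma> \<alpha> assume G: "(\<Gamma>, \<alpha>) \<in> interp arr n M"
    have len: "length \<Gamma> = n" using interp_length(1)[OF G] .
    have "approximated M \<Gamma> \<alpha>"
      using yields_tau[OF good_yields_approximants[OF interp_good_instance[OF G]]] M len by blast
    then obtain L where "(bohm_step ext)\<^sup>*\<^sup>* M L" "(\<Gamma>, \<alpha>) \<in> interp_approx arr n (direct_approx L)"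
      unfolding approximated_def interp_embed len by blast
    then show "(\<Gamma>, \<alpha>) \<in> (\<Union>A\<in>approximants ext M. interp_approx arr n A)"
      by (auto simp: approximants_def)
  qed
  show "(\<Union>A\<in>approximants ext M. interp_approx arr n A) \<subseteq> interp arr n M"
  proof (rule UN_least)
    fix A assume "A \<in> approximants ext M"
    then obtain L where L: "(bohm_step ext)\<^sup>*\<^sup>* M L" "A = direct_approx L" by (auto simp: approximants_def)
    have "tm_in n L" "interp arr n L = interp arr n M" using bohm_steps_sound[OF L(1)] M by blast+
    then show "interp_approx arr n A \<subseteq> interp arr n M"
      using direct_approx_le[of n L] unfolding L(2) interp_embed by simp
  qed
qed

section \<open>Instantiation of the candidate construction at the calculus with tests\<close>

theorem mainTheorem1:
  fixes arr :: "'d::bounded_semilattice_inf_top \<Rightarrow> 'd \<Rightarrow> 'd"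
    and ext :: "'d \<Rightarrow> ('d \<times> 'd) set"
  assumes "DEFiM arr ext"
    and "stratified_positive ext"
    and nontrivial: "\<exists>\<alpha>::'d. \<alpha> \<noteq> top"
  shows "sensible arr ext \<and> approximable arr ext"
proof -
  have fm: "filter_model arr" and ex: "extensional_by arr ext" and distr: "distributive TYPE('d)"
    using assms(1) by (auto simp: DEFiM_def)
  interpret arrow_model arr using fm by unfold_locales
  have rep: "represents ext" using ex by (auto simp: extensional_by_def represents_def arrows_def)
  interpret extensional_arrow_model arr ext using rep by unfold_locales
  interpret C: candidates arr App "wstep ext" "\<lambda>a. {M. accepts M a}" "{M. neutral ext M}"
    by (rule candidates)
  obtain V :: "'d \<Rightarrow> bool" and le :: "'d \<Rightarrow> 'd \<Rightarrow> bool"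
    where le: "reflp le" "transp le" "totalp le" "wfP (\<lambda>a b. le a b \<and> \<not> le b a)" "\<forall>a. le top a"
      and ext_V: "\<forall>c. \<forall>(a, b) \<in> ext c. le b c \<and>
           ((le c b \<and> le b c) \<and> c \<noteq> top \<and> b \<noteq> top \<longrightarrow> V c = V b) \<and> le a c \<and>
           ((le c a \<and> le a c) \<and> c \<noteq> top \<and> a \<noteq> top \<longrightarrow> V c \<noteq> V a)"
      and inf_V: "\<forall>a b. (le (inf a b) a \<or> le (inf a b) b) \<and>
           (le (inf a b) a \<and> \<not> le a (inf a b) \<longrightarrow> inf a b = b) \<and>
           ((le a b \<and> le b a) \<and> a \<noteq> top \<and> b \<noteq> top \<longrightarrow> V (inf a b) = (V a \<and> V b))"
    using assms(2) unfolding stratified_positive_def Let_def by (elim exE conjE) (rule that; assumption)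
  have total: "le a b \<or> le b a" for a b
    using reflpD[OF le(1)] totalpD[OF le(3)] by (cases "a = b") blast+
  interpret S: stratified_candidates arr App "wstep ext" "\<lambda>a. {M. accepts M a}" "{M. neutral ext M}" ext V le
  proof unfold_locales
    show "represents ext" by (rule rep)
    show "distributive TYPE('d)" by (rule distr)
    show "le a a" for a using le(1) by (rule reflpD)
    show "le a b \<Longrightarrow> le b c \<Longrightarrow> le a c" for a b c using le(2) by (rule transpD)
    show "wfP (\<lambda>a b. le a b \<and> \<not> le b a)" by (rule le(4))
    show "le a b \<or> le b a" for a b by (rule total)
    show "le top a" for a using le(5) by blast
    show "le u a \<and> le v a" if "(u, v) \<in> ext a" for u v a using ext_V that by blast
    show "V a = V v" if "(u, v) \<in> ext a" "le a v" "a \<noteq> top" "v \<noteq> top" for u v a using ext_V that by blast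
    show "V a \<noteq> V u" if "(u, v) \<in> ext a" "le a u" "a \<noteq> top" "u \<noteq> top" for u v a using ext_V that by blast
    show "le (inf a b) a \<or> le (inf a b) b" for a b using inf_V by blast
    show "inf a b = b" if "\<not> le a (inf a b)" for a b using inf_V total that by blast
    show "V (inf a b) = (V a \<and> V b)" if "le a b" "le b a" "a \<noteq> top" "b \<noteq> top" for a b
      using inf_V that by blast
  qed
  interpret reducibility arr ext S.candidate
    by (rule solves_reducibility[OF S.candidate_solves])
  show ?thesis using sensible[OF nontrivial] approximable by blast
qed

end
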